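(* The following three statements (each quantified over all Coxeter systems) are equivalent. (CIC) For all Coxeter groups $W_1, W_2$ and all $u_1,v_1 \in W_1$, $u_2,v_2 \in W_2$ such that the Bruhat intervals $[u_1,v_1]$ and $[u_2,v_2]$ are isomorphic as posets: (a) $R_{u_1,v_1}=R_{u_2,v_2}$, and (b) $P_{u_1,v_1}=P_{u_2,v_2}$. (Parabolic CIC) For all Coxeter groups $W_1,W_2$ with sets of simple generators $S_1,S_2$, all $J_1\subseteq S_1$, $J_2\subseteq S_2$, and all $u_1,v_1\in W_1^{J_1}$, $u_2,v_2\in W_2^{J_2}$ such that there is a poset isomorphism $\varphi:[u_1,v_1]\to[u_2,v_2]$ restricting to an isomorphism $[u_1,v_1]^{J_1}\to[u_2,v_2]^{J_2}$: (a) $R^{J_1,x}_{u_1,v_1}=R^{J_2,x}_{u_2,v_2}$ for $x\in\{-1,q\}$, and (b) $P^{J_1,x}_{u_1,v_1}=P^{J_2,x}_{u_2,v_2}$ for $x\in\{-1,q\}$. (Refined parabolic CIC) For all Coxeter groups $W_1,W_2$ with sets of simple generators $S_1,S_2$, all $J_1\subseteq S_1$, $J_2\subseteq S_2$, and all $u_1,v_1\in W_1^{J_1}$, $u_2,v_2\in W_2^{J_2}$ such that there is a poset isomorphism $\varphi:[u_1,v_1]\to[u_2,v_2]$ restricting to a bijection $A^{J_1}_{u_1,v_1}\to A^{J_2}_{u_2,v_2}$: (a) $R^{J_1,x}_{u_1,v_1}=R^{J_2,x}_{u_2,v_2}$ for $x\in\{-1,q\}$, and (b) $P^{J_1,q}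_{u_1,v_1}=P^{J_2,q}_{u_2,v_2}$.
   Context: Let $W$ be a Coxeter group with set of simple generators $S$, length function $\ell$ and identity $e$; let $J\subseteq S$. $W_J$ is the parabolic subgroup generated by $J$ and $W^J$ is the set of minimum-length representatives of the left cosets $wW_J$. $\leq$ denotes the (strong) Bruhat order on $W$, $\lessdot$ its cover relation, and $[u,v]=\{y\in W\mid u\leq y\leq v\}$, viewed as a poset under Bruhat order. For $u,v\in W^J$ put $[u,v]^J=[u,v]\cap W^J$ (with the induced order) and $A^J_{u,v}=\{a\in W^J\mid u\lessdot a\leq v\}$. Parabolic $R$-polynomials: for $x\in\{-1,q\}$, the family of polynomials $\{R^{J,x}_{u,v}\}_{u,v\in W^J}\subset\mathbb{Z}[q]$ is uniquely determined by: (i) $R^{J,x}_{u,v}=0$ if $u\not\leq v$; (ii) $R^{J,x}_{u,u}=1$; (iii) for all $s\in S$ with $\ell(sv)<\ell(v)$, $R^{J,x}_{u,v}$ equals $R^{J,x}_{su,sv}$ if $\ell(su)<\ell(u)$; equals $(q-1)R^{J,x}_{u,sv}+qR^{J,x}_{su,sv}$ if $\ell(su)>\ell(u)$ and $su\in W^J$; and equals $(q-1-x)R^{J,x}_{u,sv}$ if $\ell(su)>\ell(u)$ but $su\notin W^J$. Parabolic Kazhdan--Lusztig polynomials: for $x\in\{-1,q\}$, the family of polynomials $\{P^{J,x}_{u,v}\}_{u,v\in W^J}\subset\mathbb{Z}[q]$ is uniquely determined by: (i) $P^{J,x}_{u,v}=0$ if $u\not\leq v$; (ii) $P^{J,x}_{u,u}=1$;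 (iii) $\deg P^{J,x}_{u,v}\leq\frac12(\ell(v)-\ell(u)-1)$ if $u<v$; (iv) $q^{\ell(v)-\ell(u)}P^{J,x}_{u,v}(q^{-1})=\sum_{\sigma\in[u,v]^J}R^{J,x}_{u,\sigma}P^{J,x}_{\sigma,v}$. The ordinary polynomials $R_{u,v}$ and $P_{u,v}$ ($u,v\in W$) are the case $J=\emptyset$, which is independent of $x$. *)

theory Defs
  imports
    "HOL-Algebra.Generated_Groups"
    "HOL-Computational_Algebra.Computational_Algebra"
begin

section \<open>Coxeter systems\<close>

text \<open>Entries of a Coxeter matrix live in \<open>{1, 2, ..., \<infinity>}\<close>; the value \<open>0\<close> encodes \<open>\<infinity>\<close>.\<close>

definition coxeter_matrix :: "'a set \<Rightarrow> ('a \<Rightarrow> 'a \<Rightarrow> nat) \<Rightarrow> bool" where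
  "coxeter_matrix S m \<longleftrightarrow>
     (\<forall>s\<in>S. m s s = 1) \<and>
     (\<forall>s\<in>S. \<forall>t\<in>S. m s t = m t s \<and> (s \<noteq> t \<longrightarrow> m s t \<noteq> 1))"

text \<open>Congruence on words over \<open>S\<close> generated by the relators \<open>(s t)\<^bsup>m s t\<^esup>\<close>. As \<open>m s s = 1\<close>, every
  \<open>s s\<close> is a relator, so words in the generators without formal inverses suffice. If \<open>m s t = 0\<close>, the
  relator is the empty word and imposes nothing.\<close>

inductive word_cong :: "'a set \<Rightarrow> ('a \<Rightarrow> 'a \<Rightarrow> nat) \<Rightarrow> 'a list \<Rightarrow> 'a list \<Rightarrow> bool"
  for S m where
  relator: "s \<in> S \<Longrightarrow> t \<in> S \<Longrightarrow>
    word_cong S m (us @ concat (replicate (m s t) [s, t]) @ vs) (us @ vs)"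
| refl: "word_cong S m us us"
| sym: "word_cong S m us vs \<Longrightarrow> word_cong S m vs us"
| trans: "word_cong S m us vs \<Longrightarrow> word_cong S m vs ws \<Longrightarrow> word_cong S m us ws"

definition word_prod :: "('a, 'b) monoid_scheme \<Rightarrow> 'a list \<Rightarrow> 'a" where
  "word_prod G ws = foldr (\<otimes>\<^bsub>G\<^esub>) ws \<one>\<^bsub>G\<^esub>"

text \<open>The presentation \<open>\<langle>S | (s t)\<^bsup>m s t\<^esup>\<rangle>\<close>: two words over \<open>S\<close> have the same value in \<open>G\<close>
  if and only if the relations identify them.\<close>

locale coxeter_system = group G for G (structure) +
  fixes S :: "'a set"
  assumes simple_closed: "S \<subseteq> carrier G"
    and simple_generate: "generate G S = carrier G"
    and presentation: "\<exists>m. coxeter_matrix S m \<and>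
      (\<forall>us\<in>lists S. \<forall>vs\<in>lists S. word_prod G us = word_prod G vs \<longleftrightarrow> word_cong S m us vs)"

definition cox_length :: "('a, 'b) monoid_scheme \<Rightarrow> 'a set \<Rightarrow> 'a \<Rightarrow> nat" where
  "cox_length G S w = (LEAST n. \<exists>ws\<in>lists S. length ws = n \<and> word_prod G ws = w)"


section \<open>Bruhat order and parabolic quotients\<close>

definition cox_reflections :: "('a, 'b) monoid_scheme \<Rightarrow> 'a set \<Rightarrow> 'a set" where
  "cox_reflections G S = {w \<otimes>\<^bsub>G\<^esub> s \<otimes>\<^bsub>G\<^esub> inv\<^bsub>G\<^esub> w | w s. w \<in> carrier G \<and> s \<in> S}"

definition bruhat_step :: "('a, 'b) monoid_scheme \<Rightarrow> 'a set \<Rightarrow> 'a \<Rightarrow> 'a \<Rightarrow> bool" where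
  "bruhat_step G S u v \<longleftrightarrow> u \<in> carrier G \<and>
     (\<exists>t\<in>cox_reflections G S. v = u \<otimes>\<^bsub>G\<^esub> t) \<and> cox_length G S u < cox_length G S v"

definition bruhat_le :: "('a, 'b) monoid_scheme \<Rightarrow> 'a set \<Rightarrow> 'a \<Rightarrow> 'a \<Rightarrow> bool" where
  "bruhat_le G S = (bruhat_step G S)\<^sup>*\<^sup>*"

definition bruhat_less :: "('a, 'b) monoid_scheme \<Rightarrow> 'a set \<Rightarrow> 'a \<Rightarrow> 'a \<Rightarrow> bool" where
  "bruhat_less G S u v \<longleftrightarrow> bruhat_le G S u v \<and> u \<noteq> v"

definition bruhat_covers :: "('a, 'b) monoid_scheme \<Rightarrow> 'a set \<Rightarrow> 'a \<Rightarrow> 'a \<Rightarrow> bool" where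
  "bruhat_covers G S u v \<longleftrightarrow> bruhat_less G S u v \<and>
     \<not> (\<exists>z\<in>carrier G. bruhat_less G S u z \<and> bruhat_less G S z v)"

definition bruhat_interval :: "('a, 'b) monoid_scheme \<Rightarrow> 'a set \<Rightarrow> 'a \<Rightarrow> 'a \<Rightarrow> 'a set" where
  "bruhat_interval G S u v = {y \<in> carrier G. bruhat_le G S u y \<and> bruhat_le G S y v}"

definition min_reps :: "('a, 'b) monoid_scheme \<Rightarrow> 'a set \<Rightarrow> 'a set \<Rightarrow> 'a set" where
  "min_reps G S J =
     {w \<in> carrier G. \<forall>z \<in> w <#\<^bsub>G\<^esub> generate G J. cox_length G S w \<le> cox_length G S z}"

definition par_interval ::
    "('a, 'b) monoid_scheme \<Rightarrow> 'a set \<Rightarrow> 'a set \<Rightarrow> 'a \<Rightarrow> 'a \<Rightarrow> 'a set" where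
  "par_interval G S J u v = bruhat_interval G S u v \<inter> min_reps G S J"

definition par_atoms ::
    "('a, 'b) monoid_scheme \<Rightarrow> 'a set \<Rightarrow> 'a set \<Rightarrow> 'a \<Rightarrow> 'a \<Rightarrow> 'a set" where
  "par_atoms G S J u v =
     {a \<in> min_reps G S J. bruhat_covers G S u a \<and> bruhat_le G S a v}"

definition poset_iso ::
    "('a \<Rightarrow> 'b) \<Rightarrow> 'a set \<Rightarrow> ('a \<Rightarrow> 'a \<Rightarrow> bool) \<Rightarrow> 'b set \<Rightarrow> ('b \<Rightarrow> 'b \<Rightarrow> bool) \<Rightarrow> bool" where
  "poset_iso \<phi> A leA B leB \<longleftrightarrow>
     bij_betw \<phi> A B \<and> (\<forall>x\<in>A. \<forall>y\<in>A. leA x y \<longleftrightarrow> leB (\<phi> x) (\<phi> y))"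


section \<open>Parabolic R-polynomials and Kazhdan--Lusztig polynomials\<close>

abbreviation qX :: "int poly" where
  "qX \<equiv> [:0, 1:]"

text \<open>A family indexed by \<open>W\<^sup>J\<close> is a function on the whole type that vanishes when one of its
  arguments is not in \<open>W\<^sup>J\<close>; this makes the family unique as a function.\<close>

definition supported_on :: "'a set \<Rightarrow> ('a \<Rightarrow> 'a \<Rightarrow> int poly) \<Rightarrow> bool" where
  "supported_on A F \<longleftrightarrow> (\<forall>u v. u \<notin> A \<or> v \<notin> A \<longrightarrow> F u v = 0)"

definition is_par_R_family ::
    "('a, 'b) monoid_scheme \<Rightarrow> 'a set \<Rightarrow> 'a set \<Rightarrow> int poly \<Rightarrow> ('a \<Rightarrow> 'a \<Rightarrow> int poly) \<Rightarrow> bool" where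
  "is_par_R_family G S J x R \<longleftrightarrow>
     supported_on (min_reps G S J) R \<and>
     (\<forall>u\<in>min_reps G S J. \<forall>v\<in>min_reps G S J.
        (\<not> bruhat_le G S u v \<longrightarrow> R u v = 0) \<and>
        R u u = 1 \<and>
        (\<forall>s\<in>S. cox_length G S (s \<otimes>\<^bsub>G\<^esub> v) < cox_length G S v \<longrightarrow>
           (cox_length G S (s \<otimes>\<^bsub>G\<^esub> u) < cox_length G S u \<longrightarrow>
              R u v = R (s \<otimes>\<^bsub>G\<^esub> u) (s \<otimes>\<^bsub>G\<^esub> v)) \<and>
           (cox_length G S (s \<otimes>\<^bsub>G\<^esub> u) > cox_length G S u \<and> s \<otimes>\<^bsub>G\<^esub> u \<in> min_reps G S J \<longrightarrow>
              R u v = (qX - 1) * R u (s \<otimes>\<^bsub>G\<^esub> v) + qX * R (s \<otimes>\<^bsub>G\<^esub> u) (s \<otimes>\<^bsub>G\<^esub> v)) \<and>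
           (cox_length G S (s \<otimes>\<^bsub>G\<^esub> u) > cox_length G S u \<and> s \<otimes>\<^bsub>G\<^esub> u \<notin> min_reps G S J \<longrightarrow>
              R u v = (qX - 1 - x) * R u (s \<otimes>\<^bsub>G\<^esub> v))))"

definition par_R ::
    "('a, 'b) monoid_scheme \<Rightarrow> 'a set \<Rightarrow> 'a set \<Rightarrow> int poly \<Rightarrow> 'a \<Rightarrow> 'a \<Rightarrow> int poly" where
  "par_R G S J x = (THE R. is_par_R_family G S J x R)"

text \<open>\<open>q\<^sup>k p(q\<^bsup>-1\<^esup>)\<close>, computed in the fraction field of \<open>\<int>[q]\<close>.\<close>

definition q_flip :: "int \<Rightarrow> int poly \<Rightarrow> int poly fract" where
  "q_flip k p = to_fract qX powi k * poly (map_poly of_int p) (inverse (to_fract qX))"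

text \<open>The degree bound is stated with integers, doubled to clear the denominator. The convention
  \<open>degree 0 = 0\<close> is harmless, since the bound is nonnegative for \<open>u < v\<close>.\<close>

definition is_par_P_family ::
    "('a, 'b) monoid_scheme \<Rightarrow> 'a set \<Rightarrow> 'a set \<Rightarrow> int poly \<Rightarrow> ('a \<Rightarrow> 'a \<Rightarrow> int poly) \<Rightarrow> bool" where
  "is_par_P_family G S J x P \<longleftrightarrow>
     supported_on (min_reps G S J) P \<and>
     (\<forall>u\<in>min_reps G S J. \<forall>v\<in>min_reps G S J.
        (\<not> bruhat_le G S u v \<longrightarrow> P u v = 0) \<and>
        P u u = 1 \<and>
        (bruhat_less G S u v \<longrightarrow>
           2 * int (degree (P u v)) \<le> int (cox_length G S v) - int (cox_length G S u) - 1) \<and>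
        q_flip (int (cox_length G S v) - int (cox_length G S u)) (P u v) =
          to_fract (\<Sum>\<sigma>\<in>par_interval G S J u v. par_R G S J x u \<sigma> * P \<sigma> v))"

definition par_P ::
    "('a, 'b) monoid_scheme \<Rightarrow> 'a set \<Rightarrow> 'a set \<Rightarrow> int poly \<Rightarrow> 'a \<Rightarrow> 'a \<Rightarrow> int poly" where
  "par_P G S J x = (THE P. is_par_P_family G S J x P)"

text \<open>The ordinary polynomials are the case \<open>J = {}\<close>. The value \<open>x = -1\<close> is an arbitrary choice, by
  \<open>par_R_empty_indep\<close> and \<open>par_P_empty_indep\<close> below.\<close>

definition ord_R :: "('a, 'b) monoid_scheme \<Rightarrow> 'a set \<Rightarrow> 'a \<Rightarrow> 'a \<Rightarrow> int poly" where
  "ord_R G S = par_R G S {} (-1)"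

definition ord_P :: "('a, 'b) monoid_scheme \<Rightarrow> 'a set \<Rightarrow> 'a \<Rightarrow> 'a \<Rightarrow> int poly" where
  "ord_P G S = par_P G S {} (-1)"

context coxeter_system
begin

lemma min_reps_empty: "min_reps G S {} = carrier G"
  by (auto simp: min_reps_def generate_empty l_coset_def)

lemma is_par_R_family_empty_indep:
  "is_par_R_family G S {} x R \<longleftrightarrow> is_par_R_family G S {} y R"
proof -
  have "s \<otimes> u \<in> carrier G" if "s \<in> S" "u \<in> carrier G" for s u
    using that simple_closed by blast
  then show ?thesis
    unfolding is_par_R_family_def min_reps_empty by (simp cong: ball_cong)
qed

lemma par_R_empty_indep: "par_R G S {} x = par_R G S {} y"
proof -
  have "is_par_R_family G S {} x = is_par_R_family G S {} y"
    by (rule ext) (rule is_par_R_family_empty_indep)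
  then show ?thesis
    by (simp add: par_R_def)
qed

lemma par_P_empty_indep: "par_P G S {} x = par_P G S {} y"
  unfolding par_P_def is_par_P_family_def using par_R_empty_indep[of x y] by simp

end


section \<open>Combinatorial invariance conjectures\<close>

text \<open>HOL cannot quantify over types inside a formula, so the types \<open>'a\<close>, \<open>'b\<close> that contain the
  carriers of \<open>W1\<close>, \<open>W2\<close> are parameters. Size is no restriction as soon as the types are infinite: a
  Bruhat interval is finite and lies in a finitely generated, hence countable, standard parabolic
  subgroup.\<close>

definition CIC :: "'a itself \<Rightarrow> 'b itself \<Rightarrow> bool" where
  "CIC _ _ \<longleftrightarrow>
     (\<forall>(W1 :: 'a monoid) S1 (W2 :: 'b monoid) S2.
        coxeter_system W1 S1 \<and> coxeter_system W2 S2 \<longrightarrow>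
        (\<forall>u1\<in>carrier W1. \<forall>v1\<in>carrier W1. \<forall>u2\<in>carrier W2. \<forall>v2\<in>carrier W2.
           (\<exists>\<phi>. poset_iso \<phi> (bruhat_interval W1 S1 u1 v1) (bruhat_le W1 S1)
                           (bruhat_interval W2 S2 u2 v2) (bruhat_le W2 S2)) \<longrightarrow>
           ord_R W1 S1 u1 v1 = ord_R W2 S2 u2 v2 \<and>
           ord_P W1 S1 u1 v1 = ord_P W2 S2 u2 v2))"

definition parabolic_CIC :: "'a itself \<Rightarrow> 'b itself \<Rightarrow> bool" where
  "parabolic_CIC _ _ \<longleftrightarrow>
     (\<forall>(W1 :: 'a monoid) S1 J1 (W2 :: 'b monoid) S2 J2.
        coxeter_system W1 S1 \<and> coxeter_system W2 S2 \<and> J1 \<subseteq> S1 \<and> J2 \<subseteq> S2 \<longrightarrow>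
        (\<forall>u1\<in>min_reps W1 S1 J1. \<forall>v1\<in>min_reps W1 S1 J1.
         \<forall>u2\<in>min_reps W2 S2 J2. \<forall>v2\<in>min_reps W2 S2 J2.
           (\<exists>\<phi>. poset_iso \<phi> (bruhat_interval W1 S1 u1 v1) (bruhat_le W1 S1)
                           (bruhat_interval W2 S2 u2 v2) (bruhat_le W2 S2) \<and>
                poset_iso \<phi> (par_interval W1 S1 J1 u1 v1) (bruhat_le W1 S1)
                           (par_interval W2 S2 J2 u2 v2) (bruhat_le W2 S2)) \<longrightarrow>
           (\<forall>x\<in>{-1, qX}. par_R W1 S1 J1 x u1 v1 = par_R W2 S2 J2 x u2 v2) \<and>
           (\<forall>x\<in>{-1, qX}. par_P W1 S1 J1 x u1 v1 = par_P W2 S2 J2 x u2 v2)))"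

definition refined_parabolic_CIC :: "'a itself \<Rightarrow> 'b itself \<Rightarrow> bool" where
  "refined_parabolic_CIC _ _ \<longleftrightarrow>
     (\<forall>(W1 :: 'a monoid) S1 J1 (W2 :: 'b monoid) S2 J2.
        coxeter_system W1 S1 \<and> coxeter_system W2 S2 \<and> J1 \<subseteq> S1 \<and> J2 \<subseteq> S2 \<longrightarrow>
        (\<forall>u1\<in>min_reps W1 S1 J1. \<forall>v1\<in>min_reps W1 S1 J1.
         \<forall>u2\<in>min_reps W2 S2 J2. \<forall>v2\<in>min_reps W2 S2 J2.
           (\<exists>\<phi>. poset_iso \<phi> (bruhat_interval W1 S1 u1 v1) (bruhat_le W1 S1)
                           (bruhat_interval W2 S2 u2 v2) (bruhat_le W2 S2) \<and>
                bij_betw \<phi> (par_atoms W1 S1 J1 u1 v1) (par_atoms W2 S2 J2 u2 v2)) \<longrightarrow>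
           (\<forall>x\<in>{-1, qX}. par_R W1 S1 J1 x u1 v1 = par_R W2 S2 J2 x u2 v2) \<and>
           par_P W1 S1 J1 qX u1 v1 = par_P W2 S2 J2 qX u2 v2))"

end

theory Submission
  imports Defs
begin

text \<open>
  For \<open>J = {}\<close> either parabolic conjecture specialises to the ordinary one. The converse rests on two
  formulas of Deodhar, which express parabolic polynomials by ordinary ones, summed over the part of a
  coset below \<open>v\<close>:

  \<open>R\<^bsup>J,x\<^esup>\<^bsub>u,v\<^esub> = \<Sum> (-x)\<^bsup>\<ell>(y) - \<ell>(u)\<^esup> R\<^bsub>y,v\<^esub>\<close> and
  \<open>P\<^bsup>J,q\<^esup>\<^bsub>u,v\<^esub> = \<Sum> (-1)\<^bsup>\<ell>(y) - \<ell>(u)\<^esup> P\<^bsub>y,v\<^esub>\<close>, where \<open>y\<close> ranges over \<open>u W\<^sub>J \<inter> [u,v]\<close>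

  (\<open>par_R_eq\<close>, \<open>par_P_q_eq\<close>). The index set is visible to the poset: it consists of the
  elements of \<open>[u,v]\<close> that lie above no atom in \<open>W\<^sup>J\<close> (\<open>coset_below_atoms\<close>). Under the ordinary
  conjecture the summands are visible as well, the exponent \<open>\<ell>(y) - \<ell>(u)\<close> being the degree of
  \<open>R\<^bsub>u,y\<^esub>\<close>. This gives the refined conjecture. An isomorphism that respects \<open>W\<^sup>J\<close> on
  \<open>[u,v]\<close> respects these atoms in every subinterval with ends in \<open>W\<^sup>J\<close>, so it preserves all parabolic
  R-polynomials there, and these determine the parabolic Kazhdan--Lusztig polynomials recursively. This
  gives the parabolic conjecture for both values of \<open>x\<close>.

  The polynomials are definite descriptions, so existence and uniqueness are part of the
  proof. The ordinary R-polynomials are the entries of products of Hecke operators; such a product depends only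
  on the group element because left and right operators commute (\<open>foldr_Lop_unique\<close>). This also yields a
  recursion by right multiplication, from which the coset sums are seen to satisfy the parabolic
  recursion (\<open>is_par_R_family_RJ\<close>). Kazhdan--Lusztig polynomials exist because the R-polynomials satisfy an
  inversion identity (\<open>flip_kernel\<close>), which \<open>parabolic_sum_exchange\<close> transfers from \<open>W\<close> to \<open>W\<^sup>J\<close>.

  The required facts about Coxeter groups and Bruhat order (exchange condition, lifting property,
  parabolic decomposition) are derived from the presentation by means of the inversion cocycle
  (\<open>inversion_mult\<close>).
\<close>

section \<open>Words and length in a Coxeter system\<close>

context coxeter_system
begin

abbreviation W :: "'a set" where "W \<equiv> carrier G"
abbreviation wprod :: "'a list \<Rightarrow> 'a" where "wprod \<equiv> word_prod G"
abbreviation len :: "'a \<Rightarrow> nat" where "len \<equiv> cox_length G S"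
abbreviation Refls :: "'a set" where "Refls \<equiv> cox_reflections G S"

lemma simple_in [simp]: "s \<in> S \<Longrightarrow> s \<in> W"
  using simple_closed by blast

lemma wprod_Nil [simp]: "wprod [] = \<one>"
  by (simp add: word_prod_def)

lemma wprod_Cons [simp]: "wprod (s # ws) = s \<otimes> wprod ws"
  by (simp add: word_prod_def)

lemma wprod_closed [simp]: "ws \<in> lists S \<Longrightarrow> wprod ws \<in> W"
  by (induction ws) auto

lemma wprod_append:
  "us \<in> lists S \<Longrightarrow> vs \<in> lists S \<Longrightarrow> wprod (us @ vs) = wprod us \<otimes> wprod vs"
  by (induction us) (auto simp: m_assoc)

lemma cancel_inv_left [simp]:
  "x \<in> W \<Longrightarrow> y \<in> W \<Longrightarrow> inv x \<otimes> (x \<otimes> y) = y"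
  "x \<in> W \<Longrightarrow> y \<in> W \<Longrightarrow> x \<otimes> (inv x \<otimes> y) = y"
  by (simp_all flip: m_assoc)

lemma simple_square [simp]: "s \<in> S \<Longrightarrow> s \<otimes> s = \<one>"
proof -
  assume s: "s \<in> S"
  obtain m where m: "coxeter_matrix S m"
    and pres: "\<And>us vs. us \<in> lists S \<Longrightarrow> vs \<in> lists S \<Longrightarrow>
      wprod us = wprod vs \<longleftrightarrow> word_cong S m us vs"
    using presentation by blast
  have "word_cong S m ([] @ concat (replicate (m s s) [s, s]) @ []) ([] @ [])"
    using s by (intro word_cong.relator)
  moreover have "m s s = 1" using m s by (auto simp: coxeter_matrix_def)
  ultimately have "word_cong S m [s, s] []" by simp
  then have "wprod [s, s] = wprod []" using s pres[of "[s, s]" "[]"] by simp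
  then show ?thesis using s by simp
qed

lemma inv_simple [simp]: "s \<in> S \<Longrightarrow> inv s = s"
  by (simp add: inv_equality)

lemma simple_cancel [simp]: "s \<in> S \<Longrightarrow> x \<in> W \<Longrightarrow> s \<otimes> (s \<otimes> x) = x"
  by (simp flip: m_assoc)

lemma simple_cancel_right [simp]: "s \<in> S \<Longrightarrow> x \<in> W \<Longrightarrow> x \<otimes> s \<otimes> s = x"
  by (simp add: m_assoc)

lemma wprod_rev: "ws \<in> lists S \<Longrightarrow> wprod (rev ws) = inv (wprod ws)"
proof (induction ws)
  case (Cons a ws)
  then have "rev ws \<in> lists S" "[a] \<in> lists S" by (simp_all add: in_lists_conv_set)
  then have "wprod (rev (a # ws)) = wprod (rev ws) \<otimes> wprod [a]"
    unfolding rev.simps by (rule wprod_append)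
  then show ?case using Cons by (simp add: inv_mult_group)
qed simp

lemma generate_words:
  assumes "J \<subseteq> S"
  shows "generate G J = wprod ` lists J"
proof
  show "generate G J \<subseteq> wprod ` lists J"
  proof
    fix w assume "w \<in> generate G J"
    then show "w \<in> wprod ` lists J"
    proof induction
      case one
      show ?case by (rule image_eqI[of _ _ "[]"]) auto
    next
      case (incl h)
      then show ?case using assms by (intro image_eqI[of _ _ "[h]"]) auto
    next
      case (inv h)
      then have "h \<in> S" using assms by auto
      then show ?case using inv by (intro image_eqI[of _ _ "[h]"]) auto
    next
      case (eng h1 h2)
      then obtain us vs where "us \<in> lists J" "vs \<in> lists J" "h1 = wprod us" "h2 = wprod vs"
        by auto
      moreover from this have "us \<in> lists S" "vs \<in> lists S" using assms by auto
      ultimately show ?case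
        by (intro image_eqI[of _ _ "us @ vs"]) (auto simp: wprod_append)
    qed
  qed
next
  show "wprod ` lists J \<subseteq> generate G J"
  proof
    fix w assume "w \<in> wprod ` lists J"
    then obtain ws where "ws \<in> lists J" "w = wprod ws" by blast
    then show "w \<in> generate G J"
      by (induction ws arbitrary: w) (auto intro: generate.intros)
  qed
qed

lemma word_exists: "w \<in> W \<Longrightarrow> \<exists>ws\<in>lists S. wprod ws = w"
  using generate_words[of S] simple_generate by auto

lemma reduced_word:
  assumes "w \<in> W"
  obtains ws where "ws \<in> lists S" "wprod ws = w" "length ws = len w"
proof -
  have "\<exists>n. \<exists>ws\<in>lists S. length ws = n \<and> wprod ws = w"
    using word_exists[OF assms] by blast
  then have "\<exists>ws\<in>lists S. length ws = len w \<and> wprod ws = w"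
    unfolding cox_length_def by (rule LeastI_ex)
  then show ?thesis using that by blast
qed

lemma len_wprod_le: "ws \<in> lists S \<Longrightarrow> len (wprod ws) \<le> length ws"
  unfolding cox_length_def by (rule Least_le) auto

lemma len_one [simp]: "len \<one> = 0"
  using len_wprod_le[of "[]"] by simp

lemma len_eq_0: "w \<in> W \<Longrightarrow> len w = 0 \<longleftrightarrow> w = \<one>"
  by (metis reduced_word len_one length_0_conv wprod_Nil)


lemma rev_in_lists [simp]: "rev ws \<in> lists A \<longleftrightarrow> ws \<in> lists A"
  by (simp add: in_lists_conv_set)

lemma len_inv [simp]:
  assumes "w \<in> W"
  shows "len (inv w) = len w"
proof -
  have *: "len (inv w) \<le> len w" if w: "w \<in> W" for w
  proof -
    obtain ws where "ws \<in> lists S" "wprod ws = w" "length ws = len w"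
      using w by (rule reduced_word)
    then show ?thesis using len_wprod_le[of "rev ws"] by (simp add: wprod_rev)
  qed
  show ?thesis using *[of w] *[of "inv w"] assms by simp
qed

lemma len_mult_le:
  assumes "u \<in> W" "v \<in> W"
  shows "len (u \<otimes> v) \<le> len u + len v"
proof -
  obtain us where us: "us \<in> lists S" "wprod us = u" "length us = len u"
    using assms(1) by (rule reduced_word)
  obtain vs where vs: "vs \<in> lists S" "wprod vs = v" "length vs = len v"
    using assms(2) by (rule reduced_word)
  show ?thesis using len_wprod_le[of "us @ vs"] us vs by (simp add: wprod_append)
qed

lemma len_simple_le: "s \<in> S \<Longrightarrow> len s \<le> 1"
  using len_wprod_le[of "[s]"] by simp

section \<open>Inversions and the exchange condition\<close>

text \<open>Parity of the number of occurrences of \<open>t\<close> among the reflections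
  \<open>s\<^sub>1, s\<^sub>1 s\<^sub>2 s\<^sub>1, \<dots>\<close> of the word \<open>s\<^sub>1 s\<^sub>2 \<dots>\<close>. Unlike the number itself, the parity depends
  only on the group element that the word represents; this is what turns the presentation into the
  exchange condition.\<close>

fun inv_parity :: "'a list \<Rightarrow> 'a \<Rightarrow> bool" where
  "inv_parity [] t = False"
| "inv_parity (s # ws) t = ((t = s) \<noteq> inv_parity ws (s \<otimes> t \<otimes> s))"

lemma inv_parity_append:
  assumes "us \<in> lists S" "vs \<in> lists S" "t \<in> W"
  shows "inv_parity (us @ vs) t = (inv_parity us t \<noteq> inv_parity vs (inv (wprod us) \<otimes> t \<otimes> wprod us))"
  using assms
proof (induction us arbitrary: t)
  case (Cons s us)
  then have s: "s \<in> S" and us: "us \<in> lists S" by auto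
  have "inv (wprod (s # us)) \<otimes> t \<otimes> wprod (s # us) = inv (wprod us) \<otimes> (s \<otimes> t \<otimes> s) \<otimes> wprod us"
    using s us Cons.prems by (simp add: inv_mult_group m_assoc)
  then show ?case using Cons.IH[of "s \<otimes> t \<otimes> s"] s us Cons.prems by auto
qed simp

lemma conj_simple_eq_iff:
  assumes "s \<in> S" "x \<in> W" "y \<in> W"
  shows "s \<otimes> x \<otimes> s = y \<longleftrightarrow> x = s \<otimes> y \<otimes> s"
  using assms by (metis m_assoc simple_cancel simple_cancel_right m_closed simple_in)

lemma pow_shift:
  assumes "s \<in> S" "t \<in> S"
  shows "s \<otimes> (t \<otimes> ((s \<otimes> t) [^] (i::nat) \<otimes> s) \<otimes> t) \<otimes> s = (s \<otimes> t) [^] (i + 2) \<otimes> s"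
proof -
  have c: "s \<otimes> t \<in> W" using assms by simp
  have "(s \<otimes> t) [^] (i + 2) = (s \<otimes> t) \<otimes> (s \<otimes> t) [^] i \<otimes> (s \<otimes> t)"
    using c by (metis add_2_eq_Suc' nat_pow_Suc nat_pow_Suc2)
  then show ?thesis using assms by (simp add: m_assoc)
qed

text \<open>The reflections of the word \<open>(s t)\<^sup>k\<close> are \<open>(s t)\<^sup>i s\<close> for \<open>i < 2 k\<close>.\<close>

lemma inv_parity_alternating:
  assumes "s \<in> S" "t \<in> S" "x \<in> W"
  shows "inv_parity (concat (replicate k [s, t])) x \<longleftrightarrow>
    odd (\<Sum>i<2*k. if x = (s \<otimes> t) [^] (i::nat) \<otimes> s then 1 else (0::nat))"
  using assms(3)
proof (induction k arbitrary: x)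
  case (Suc k)
  define f where "f x i = (if x = (s \<otimes> t) [^] (i::nat) \<otimes> s then 1 else (0::nat))" for x i
  let ?y = "t \<otimes> (s \<otimes> x \<otimes> s) \<otimes> t"
  have y: "?y \<in> W" using assms Suc.prems by simp
  have shift: "f ?y i = f x (Suc (Suc i))" for i
  proof -
    have "?y = (s \<otimes> t) [^] i \<otimes> s \<longleftrightarrow> s \<otimes> x \<otimes> s = t \<otimes> ((s \<otimes> t) [^] i \<otimes> s) \<otimes> t"
      using assms Suc.prems by (intro conj_simple_eq_iff) auto
    also have "\<dots> \<longleftrightarrow> x = s \<otimes> (t \<otimes> ((s \<otimes> t) [^] i \<otimes> s) \<otimes> t) \<otimes> s"
      using assms Suc.prems by (intro conj_simple_eq_iff) auto
    also have "\<dots> \<longleftrightarrow> x = (s \<otimes> t) [^] (i + 2) \<otimes> s"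
      using pow_shift[OF assms(1,2)] by simp
    finally show ?thesis by (simp add: f_def)
  qed
  have "(\<Sum>i<2 * Suc k. f x i) = f x 0 + f x 1 + (\<Sum>i<2*k. f x (Suc (Suc i)))"
    by (simp add: sum.lessThan_Suc_shift del: sum.lessThan_Suc)
  also have "\<dots> = f x 0 + f x 1 + (\<Sum>i<2*k. f ?y i)" by (simp only: shift)
  finally have sum: "(\<Sum>i<2 * Suc k. f x i) = f x 0 + f x 1 + (\<Sum>i<2*k. f ?y i)" .
  have f0: "odd (f x 0) \<longleftrightarrow> x = s" using assms by (simp add: f_def)
  have f1: "odd (f x 1) \<longleftrightarrow> s \<otimes> x \<otimes> s = t"
    using assms Suc.prems by (simp add: f_def conj_simple_eq_iff)
  have "inv_parity (concat (replicate (Suc k) [s, t])) x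
     \<longleftrightarrow> ((x = s) \<noteq> ((s \<otimes> x \<otimes> s = t) \<noteq> inv_parity (concat (replicate k [s, t])) ?y))" by simp
  also have "\<dots> \<longleftrightarrow> odd (\<Sum>i<2 * Suc k. f x i)"
    unfolding sum using Suc.IH[OF y] f0 f1 by (auto simp: f_def[symmetric])
  finally show ?case by (simp add: f_def)
qed simp

lemma wprod_alternating:
  "s \<in> S \<Longrightarrow> t \<in> S \<Longrightarrow> wprod (concat (replicate k [s, t])) = (s \<otimes> t) [^] (k::nat)"
proof (induction k)
  case (Suc k)
  then have "wprod (concat (replicate (Suc k) [s, t])) = (s \<otimes> t) \<otimes> (s \<otimes> t) [^] k"
    by (simp add: m_assoc)
  also have "\<dots> = (s \<otimes> t) [^] Suc k" using Suc.prems by (intro nat_pow_Suc2[symmetric]) simp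
  finally show ?case .
qed simp

text \<open>A relator \<open>(s t)\<^sup>m\<close> runs through the list \<open>s, s t s, \<dots>\<close> of its reflections twice.\<close>

lemma inv_parity_relator:
  assumes "s \<in> S" "t \<in> S" "x \<in> W" "(s \<otimes> t) [^] (m::nat) = \<one>"
  shows "\<not> inv_parity (concat (replicate m [s, t])) x"
proof -
  define f where "f i = (if x = (s \<otimes> t) [^] (i::nat) \<otimes> s then 1 else (0::nat))" for i
  \<comment> \<open>the \<open>i\<close>-th and the \<open>(i + m)\<close>-th reflection coincide\<close>
  have "(s \<otimes> t) [^] (i + m) = (s \<otimes> t) [^] i" for i
    using assms by (simp flip: nat_pow_mult)
  then have per: "f (i + m) = f i" for i by (simp add: f_def)
  have "(\<Sum>i<2*m. f i) = (\<Sum>i<m. f i) + (\<Sum>i<m. f (i + m))"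
    by (simp add: mult_2 sum.nat_group lessThan_atLeast0 sum.atLeastLessThan_concat[of 0 m "m+m", symmetric]
        sum.shift_bounds_nat_ivl[of f 0 m m, simplified])
  then have "even (\<Sum>i<2*m. f i)" by (simp add: per)
  then show ?thesis using inv_parity_alternating[OF assms(1-3)] by (simp add: f_def)
qed

lemma word_cong_invariants:
  assumes "\<And>us vs. us \<in> lists S \<Longrightarrow> vs \<in> lists S \<Longrightarrow> wprod us = wprod vs \<longleftrightarrow> word_cong S m us vs"
    and "word_cong S m us vs"
  shows "(us \<in> lists S \<longleftrightarrow> vs \<in> lists S) \<and>
     (us \<in> lists S \<longrightarrow> (\<forall>x\<in>W. inv_parity us x = inv_parity vs x))"
  using assms(2)
proof induction
  case (relator s t us vs)
  let ?r = "concat (replicate (m s t) [s, t])"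
  have r: "?r \<in> lists S" using relator by (auto simp: in_lists_conv_set)
  have "word_cong S m ([] @ ?r @ []) ([] @ [])" using relator by (rule word_cong.relator)
  then have r1: "wprod ?r = \<one>" using assms(1)[OF r, of "[]"] by simp
  then have "(s \<otimes> t) [^] m s t = \<one>" using relator by (simp add: wprod_alternating)
  then have nr: "\<not> inv_parity ?r x" if "x \<in> W" for x
    using relator that by (intro inv_parity_relator)
  have "inv_parity (us @ ?r @ vs) x = inv_parity (us @ vs) x"
    if "us \<in> lists S" "vs \<in> lists S" "x \<in> W" for x
    using that r r1 nr by (simp add: inv_parity_append)
  then show ?case using r by auto
next
  case (trans us vs ws)
  then show ?case by simp
qed auto

lemma inv_parity_cong:
  assumes "us \<in> lists S" "vs \<in> lists S" "wprod us = wprod vs" "x \<in> W"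
  shows "inv_parity us x = inv_parity vs x"
proof -
  obtain m where pres: "\<And>us vs. us \<in> lists S \<Longrightarrow> vs \<in> lists S \<Longrightarrow>
      wprod us = wprod vs \<longleftrightarrow> word_cong S m us vs"
    using presentation by blast
  then have "word_cong S m us vs" using assms by simp
  from word_cong_invariants[OF pres this] show ?thesis using assms by auto
qed

definition inversion :: "'a \<Rightarrow> 'a \<Rightarrow> bool" where
  "inversion w t = inv_parity (SOME ws. ws \<in> lists S \<and> wprod ws = w) t"

lemma inversion_word:
  assumes "ws \<in> lists S" "t \<in> W"
  shows "inversion (wprod ws) t = inv_parity ws t"
proof -
  let ?w = "SOME us. us \<in> lists S \<and> wprod us = wprod ws"
  have "?w \<in> lists S \<and> wprod ?w = wprod ws"
    by (rule someI[of _ ws]) (use assms in auto)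
  then show ?thesis using assms inv_parity_cong[of ?w ws t] by (simp add: inversion_def)
qed

lemma inversion_one [simp]: "t \<in> W \<Longrightarrow> \<not> inversion \<one> t"
  using inversion_word[of "[]" t] by simp

lemma inversion_simple: "s \<in> S \<Longrightarrow> t \<in> W \<Longrightarrow> inversion s t \<longleftrightarrow> t = s"
  using inversion_word[of "[s]" t] by simp

text \<open>The cocycle rule for inversions. Most facts about lengths below are instances of it.\<close>

lemma inversion_mult:
  assumes "u \<in> W" "v \<in> W" "t \<in> W"
  shows "inversion (u \<otimes> v) t \<longleftrightarrow> (inversion u t \<noteq> inversion v (inv u \<otimes> t \<otimes> u))"
proof -
  obtain us vs where w: "us \<in> lists S" "wprod us = u" "vs \<in> lists S" "wprod vs = v"
    using word_exists assms by metis
  have t': "inv u \<otimes> t \<otimes> u \<in> W" using assms by simp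
  have "inversion (u \<otimes> v) t = inversion (wprod (us @ vs)) t"
    using w by (simp only: wprod_append)
  also have "\<dots> = inv_parity (us @ vs) t"
    using w assms by (intro inversion_word) auto
  also have "\<dots> = (inv_parity us t \<noteq> inv_parity vs (inv u \<otimes> t \<otimes> u))"
    using inv_parity_append[of us vs t] w assms by simp
  also have "inv_parity us t = inversion u t"
    using inversion_word[of us t] w assms by simp
  also have "inv_parity vs (inv u \<otimes> t \<otimes> u) = inversion v (inv u \<otimes> t \<otimes> u)"
    using inversion_word[OF w(3) t'] w by simp
  finally show ?thesis .
qed

lemma Refls_closed [simp]: "t \<in> Refls \<Longrightarrow> t \<in> W"
  by (auto simp: cox_reflections_def)

lemma Refls_square [simp]: "t \<in> Refls \<Longrightarrow> t \<otimes> t = \<one>"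
proof -
  assume "t \<in> Refls"
  then obtain u s where t: "t = u \<otimes> s \<otimes> inv u" and u: "u \<in> W" and s: "s \<in> S"
    unfolding cox_reflections_def by blast
  have "t \<otimes> t = u \<otimes> (s \<otimes> (inv u \<otimes> (u \<otimes> (s \<otimes> inv u))))"
    unfolding t using u s by (simp only: m_assoc simple_in inv_closed m_closed)
  also have "\<dots> = \<one>" using u s by simp
  finally show ?thesis .
qed

lemma Refls_inv [simp]: "t \<in> Refls \<Longrightarrow> inv t = t"
  by (simp add: inv_equality)

lemma Refls_cancel [simp]: "t \<in> Refls \<Longrightarrow> x \<in> W \<Longrightarrow> t \<otimes> (t \<otimes> x) = x"
  by (simp flip: m_assoc)

lemma simple_Refls [simp]: "s \<in> S \<Longrightarrow> s \<in> Refls"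
  unfolding cox_reflections_def by (rule CollectI, rule exI[of _ \<one>], rule exI[of _ s]) auto

lemma conj_Refls:
  assumes "t \<in> Refls" "w \<in> W"
  shows "w \<otimes> t \<otimes> inv w \<in> Refls"
proof -
  obtain u s where "t = u \<otimes> s \<otimes> inv u" "u \<in> W" "s \<in> S"
    using assms unfolding cox_reflections_def by blast
  then have "w \<otimes> t \<otimes> inv w = (w \<otimes> u) \<otimes> s \<otimes> inv (w \<otimes> u)" "w \<otimes> u \<in> W"
    using assms by (simp_all add: inv_mult_group m_assoc)
  then show ?thesis using \<open>s \<in> S\<close> unfolding cox_reflections_def by blast
qed

lemma conj_Refls': "t \<in> Refls \<Longrightarrow> w \<in> W \<Longrightarrow> inv w \<otimes> t \<otimes> w \<in> Refls"
  using conj_Refls[of t "inv w"] by simp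

lemma inversion_inv:
  assumes "u \<in> W" "t \<in> W"
  shows "inversion u t \<longleftrightarrow> inversion (inv u) (inv u \<otimes> t \<otimes> u)"
  using inversion_mult[of u "inv u" t] assms by simp

text \<open>In a palindromic word \<open>u s u\<^sup>-\<^sup>1\<close> the contributions of \<open>u\<close> and \<open>u\<^sup>-\<^sup>1\<close> cancel, and the middle
  letter remains.\<close>

lemma inversion_self:
  assumes "t \<in> Refls"
  shows "inversion t t"
proof -
  obtain u s where t: "t = u \<otimes> s \<otimes> inv u" and u: "u \<in> W" and s: "s \<in> S"
    using assms unfolding cox_reflections_def by blast
  have tc: "t \<in> W" using assms by simp
  \<comment> \<open>the reflection \<open>t\<close>, transported across the prefix \<open>u\<close>, is the middle letter\<close>
  have 1: "inv u \<otimes> t \<otimes> u = s" using t u s by (simp add: m_assoc)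
  have "inversion t t \<longleftrightarrow> inversion (u \<otimes> (s \<otimes> inv u)) t" using t u s by (simp add: m_assoc)
  also have "\<dots> \<longleftrightarrow> (inversion u t \<noteq> inversion (s \<otimes> inv u) s)"
    using u s tc by (simp add: inversion_mult 1)
  also have "inversion (s \<otimes> inv u) s \<longleftrightarrow> \<not> inversion (inv u) s"
    using u s by (simp add: inversion_mult inversion_simple)
  also have "inversion u t \<longleftrightarrow> inversion (inv u) s"
    using inversion_inv[OF u tc] by (simp add: 1)
  finally show ?thesis by simp
qed

text \<open>If \<open>t\<close> is the \<open>i\<close>-th reflection of a word, multiplying the word by \<open>t\<close> cancels the \<open>i\<close>-th
  letter.\<close>

lemma inv_parity_deletion:
  assumes "ws \<in> lists S" "t \<in> W" "inv_parity ws t"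
  shows "\<exists>i<length ws. t \<otimes> wprod ws = wprod (take i ws @ drop (Suc i) ws)"
  using assms
proof (induction ws arbitrary: t)
  case (Cons s ws)
  then have s: "s \<in> S" and ws: "ws \<in> lists S" by auto
  show ?case
  proof (cases "t = s")
    case True
    then show ?thesis using s ws by (intro exI[of _ 0]) simp
  next
    case False
    then have "inv_parity ws (s \<otimes> t \<otimes> s)" using Cons.prems by simp
    then obtain i where i: "i < length ws"
      and eq: "s \<otimes> t \<otimes> s \<otimes> wprod ws = wprod (take i ws @ drop (Suc i) ws)"
      using Cons.IH[of "s \<otimes> t \<otimes> s"] s ws Cons.prems by auto
    have "t \<otimes> wprod (s # ws) = s \<otimes> (s \<otimes> t \<otimes> s \<otimes> wprod ws)"
      using s ws Cons.prems by (simp add: m_assoc)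
    also have "\<dots> = wprod (take (Suc i) (s # ws) @ drop (Suc (Suc i)) (s # ws))"
      using eq by simp
    finally show ?thesis using i by (intro exI[of _ "Suc i"]) simp
  qed
qed simp

lemma inversion_less:
  assumes "w \<in> W" "t \<in> W" "inversion w t"
  shows "len (t \<otimes> w) < len w"
proof -
  obtain ws where ws: "ws \<in> lists S" "wprod ws = w" "length ws = len w"
    using assms(1) by (rule reduced_word)
  then have "inv_parity ws t" using assms inversion_word by blast
  then obtain i where i: "i < length ws" "t \<otimes> w = wprod (take i ws @ drop (Suc i) ws)"
    using inv_parity_deletion ws assms by blast
  have "take i ws @ drop (Suc i) ws \<in> lists S"
    using ws(1) by (auto simp: in_lists_conv_set dest: in_set_takeD in_set_dropD)
  from len_wprod_le[OF this] show ?thesis using i ws by simp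
qed

text \<open>By the cocycle rule \<open>t\<close> is an inversion of exactly one of \<open>w\<close> and \<open>t w\<close>.\<close>

lemma not_inversion_greater:
  assumes "w \<in> W" "t \<in> Refls" "\<not> inversion w t"
  shows "len w < len (t \<otimes> w)"
proof -
  have "inversion (t \<otimes> w) t"
    using assms inversion_self[OF assms(2)] by (simp add: inversion_mult)
  from inversion_less[OF _ _ this] show ?thesis using assms by simp
qed

lemma inversion_iff:
  assumes "w \<in> W" "t \<in> Refls"
  shows "inversion w t \<longleftrightarrow> len (t \<otimes> w) < len w"
  using inversion_less[of w t] not_inversion_greater[of w t] assms by fastforce

lemma refl_len_neq: "w \<in> W \<Longrightarrow> t \<in> Refls \<Longrightarrow> len (t \<otimes> w) \<noteq> len w"
  using inversion_less[of w t] not_inversion_greater[of w t] by fastforce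

lemma strong_exchange:
  assumes "ws \<in> lists S" "t \<in> Refls" "len (t \<otimes> wprod ws) < len (wprod ws)"
  shows "\<exists>i<length ws. t \<otimes> wprod ws = wprod (take i ws @ drop (Suc i) ws)"
proof -
  have "inv_parity ws t" using assms inversion_iff[of "wprod ws" t] by (simp add: inversion_word)
  then show ?thesis using inv_parity_deletion assms by simp
qed

lemma len_simple_mult:
  assumes "s \<in> S" "w \<in> W"
  shows "len (s \<otimes> w) = Suc (len w) \<or> len w = Suc (len (s \<otimes> w))"
proof -
  have "len (s \<otimes> w) \<le> Suc (len w)"
    using len_mult_le[of s w] len_simple_le assms by fastforce
  moreover have "len w \<le> Suc (len (s \<otimes> w))"
    using len_mult_le[of s "s \<otimes> w"] len_simple_le assms by fastforce
  moreover have "len (s \<otimes> w) \<noteq> len w" using assms refl_len_neq by simp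
  ultimately show ?thesis by linarith
qed

lemma len_mult_simple:
  assumes "s \<in> S" "w \<in> W"
  shows "len (w \<otimes> s) = Suc (len w) \<or> len w = Suc (len (w \<otimes> s))"
  using len_simple_mult[of s "inv w"] assms len_inv[of "w \<otimes> s"] len_inv[of w]
  by (simp add: inv_mult_group)

text \<open>By the cocycle rule \<open>s\<close> can become an inversion on passing from \<open>u\<close> to \<open>u t\<close> only if
  \<open>u\<^sup>-\<^sup>1 s u = t\<close>.\<close>

lemma exchange_eq:
  assumes "s \<in> S" "t \<in> S" "u \<in> W"
    and "len u < len (s \<otimes> u)" "len (s \<otimes> u \<otimes> t) < len (u \<otimes> t)"
  shows "s \<otimes> u = u \<otimes> t"
proof -
  have "\<not> inversion u s" using assms inversion_iff by simp
  moreover have "inversion (u \<otimes> t) s" using assms inversion_iff by (simp add: m_assoc)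
  ultimately have "inversion t (inv u \<otimes> s \<otimes> u)" using assms by (simp add: inversion_mult)
  then have "inv u \<otimes> s \<otimes> u = t" using assms by (simp add: inversion_simple)
  then have "u \<otimes> (inv u \<otimes> s \<otimes> u) = u \<otimes> t" by simp
  then show ?thesis using assms by (simp add: m_assoc)
qed

lemma left_descent_exists:
  assumes "w \<in> W" "w \<noteq> \<one>"
  obtains s where "s \<in> S" "len (s \<otimes> w) < len w"
proof -
  obtain ws where ws: "ws \<in> lists S" "wprod ws = w" "length ws = len w"
    using assms(1) by (rule reduced_word)
  then obtain s us where "ws = s # us" using assms(2) by (cases ws) auto
  then have "s \<in> S" "us \<in> lists S" using ws by auto
  moreover from this have "s \<otimes> w = wprod us" using ws(2) \<open>ws = s # us\<close> by (simp flip: ws(2))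
  ultimately have "s \<in> S" "len (s \<otimes> w) < len w"
    using ws \<open>ws = s # us\<close> len_wprod_le[of us] by auto
  then show ?thesis using that by blast
qed

end

context coxeter_system
begin

section \<open>Bruhat order\<close>

abbreviation step :: "'a \<Rightarrow> 'a \<Rightarrow> bool" where "step \<equiv> bruhat_step G S"
abbreviation ble :: "'a \<Rightarrow> 'a \<Rightarrow> bool" (infix "\<preceq>" 50) where "x \<preceq> y \<equiv> bruhat_le G S x y"

abbreviation Bint :: "'a \<Rightarrow> 'a \<Rightarrow> 'a set" where "Bint \<equiv> bruhat_interval G S"

lemma step_closed: "step u v \<Longrightarrow> u \<in> W \<and> v \<in> W"
  by (auto simp: bruhat_step_def)

text \<open>The definition multiplies by reflections on the right, while inversions are about multiplication
  on the left. Conjugation passes from one to the other.\<close>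

lemma step_left_iff:
  assumes "u \<in> W"
  shows "step u v \<longleftrightarrow> (\<exists>t\<in>Refls. v = t \<otimes> u) \<and> len u < len v"
proof -
  have "(\<exists>t\<in>Refls. v = u \<otimes> t) \<longleftrightarrow> (\<exists>t\<in>Refls. v = t \<otimes> u)"
  proof
    assume "\<exists>t\<in>Refls. v = u \<otimes> t"
    then obtain t where t: "t \<in> Refls" "v = u \<otimes> t" by blast
    then have "v = (u \<otimes> t \<otimes> inv u) \<otimes> u" using assms by (simp add: m_assoc)
    then show "\<exists>t\<in>Refls. v = t \<otimes> u" using conj_Refls t(1) assms by blast
  next
    assume "\<exists>t\<in>Refls. v = t \<otimes> u"
    then obtain t where t: "t \<in> Refls" "v = t \<otimes> u" by blast
    then have "v = u \<otimes> (inv u \<otimes> t \<otimes> u)" using assms by (simp add: m_assoc)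
    then show "\<exists>t\<in>Refls. v = u \<otimes> t" using conj_Refls' t(1) assms by blast
  qed
  then show ?thesis using assms by (auto simp: bruhat_step_def)
qed

lemma step_inv:
  assumes "step u v"
  shows "step (inv u) (inv v)"
proof -
  have c: "u \<in> W" "v \<in> W" using step_closed[OF assms] by auto
  obtain t where t: "t \<in> Refls" "v = u \<otimes> t" using assms by (auto simp: bruhat_step_def)
  then have "inv v = t \<otimes> inv u" using c by (simp add: inv_mult_group)
  moreover have "len (inv u) < len (inv v)" using assms c by (simp add: bruhat_step_def)
  ultimately show ?thesis using t(1) c step_left_iff[of "inv u" "inv v"] by auto
qed

lemma ble_refl [simp]: "u \<preceq> u"
  by (simp add: bruhat_le_def)

lemma ble_trans: "u \<preceq> v \<Longrightarrow> v \<preceq> w \<Longrightarrow> u \<preceq> w"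
  by (simp add: bruhat_le_def)

lemma step_ble: "step u v \<Longrightarrow> u \<preceq> v"
  by (simp add: bruhat_le_def)

lemma ble_induct [consumes 1, case_names base step]:
  assumes "u \<preceq> v" "P u" "\<And>x y. u \<preceq> x \<Longrightarrow> step x y \<Longrightarrow> P x \<Longrightarrow> P y"
  shows "P v"
  using assms unfolding bruhat_le_def by (induction rule: rtranclp_induct) auto

lemma ble_carrier: "u \<preceq> v \<Longrightarrow> u \<in> W \<longleftrightarrow> v \<in> W"
  by (induction rule: ble_induct) (auto dest: step_closed)

lemma ble_len: "u \<preceq> v \<Longrightarrow> u = v \<or> len u < len v"
  by (induction rule: ble_induct) (auto simp: bruhat_step_def)

lemma ble_len_le: "u \<preceq> v \<Longrightarrow> len u \<le> len v"
  using ble_len by fastforce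

lemma ble_eq: "u \<preceq> v \<Longrightarrow> len v \<le> len u \<Longrightarrow> u = v"
  using ble_len by fastforce

lemma ble_antisym: "u \<preceq> v \<Longrightarrow> v \<preceq> u \<Longrightarrow> u = v"
  using ble_eq ble_len_le by blast

lemma ble_inv_imp: "u \<preceq> v \<Longrightarrow> inv u \<preceq> inv v"
proof (induction rule: ble_induct)
  case (step x y)
  then show ?case using step_inv step_ble ble_trans by blast
qed simp

lemma ble_inv:
  "u \<in> W \<Longrightarrow> v \<in> W \<Longrightarrow> inv u \<preceq> inv v \<longleftrightarrow> u \<preceq> v"
  using ble_inv_imp[of u v] ble_inv_imp[of "inv u" "inv v"] by auto

lemma simple_up: "s \<in> S \<Longrightarrow> u \<in> W \<Longrightarrow> len u < len (s \<otimes> u) \<Longrightarrow> u \<preceq> s \<otimes> u"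
  by (rule step_ble) (auto simp: step_left_iff intro!: bexI[of _ s])

lemma simple_down:
  assumes "s \<in> S" "u \<in> W" "len (s \<otimes> u) < len u"
  shows "s \<otimes> u \<preceq> u"
  using simple_up[of s "s \<otimes> u"] assms by simp

text \<open>Among the inversions, left multiplication by \<open>s\<close> changes only the status of \<open>s\<close> itself, so a
  step along any other reflection survives it.\<close>

lemma step_simple:
  assumes "s \<in> S" "step u v"
  shows "v = s \<otimes> u \<or> step (s \<otimes> u) (s \<otimes> v)"
proof (cases "v = s \<otimes> u")
  case False
  have u: "u \<in> W" using step_closed[OF assms(2)] by auto
  then obtain t where t: "t \<in> Refls" "v = t \<otimes> u" and less: "len u < len v"
    using assms(2) by (auto simp: step_left_iff)
  let ?t = "s \<otimes> t \<otimes> s"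
  have tR: "?t \<in> Refls" using conj_Refls[of t s] t assms by simp
  have sv: "s \<otimes> v = ?t \<otimes> (s \<otimes> u)" using t u assms by (simp add: m_assoc)
  have "?t \<noteq> s"
  proof
    assume "?t = s"
    then have "t = s \<otimes> s \<otimes> s" using conj_simple_eq_iff[of s t s] assms t by simp
    then show False using False t assms by simp
  qed
  moreover have "\<not> inversion u t" using inversion_iff[of u t] t u less by simp
  moreover have "s \<otimes> ?t \<otimes> s = t" using t assms by (simp add: m_assoc)
  ultimately have "\<not> inversion (s \<otimes> u) ?t"
    using t u assms by (simp add: inversion_mult inversion_simple)
  then have "len (s \<otimes> u) < len (?t \<otimes> (s \<otimes> u))"
    using tR u assms by (intro not_inversion_greater) auto
  then have "step (s \<otimes> u) (s \<otimes> v)"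
    using u assms tR sv by (subst step_left_iff) auto
  then show ?thesis ..
qed simp

text \<open>Apply \<open>s\<close> to a chain from \<open>u\<close> to \<open>v\<close>. Either every step survives, or some step is
  multiplication by \<open>s\<close>; the first such step gives \<open>s u \<preceq> v\<close> and the last one gives \<open>u \<preceq> s v\<close>.\<close>

lemma lifting_dichotomy:
  assumes "s \<in> S" "u \<in> W" "u \<preceq> v"
  shows "s \<otimes> u \<preceq> s \<otimes> v \<or> (s \<otimes> u \<preceq> v \<and> u \<preceq> s \<otimes> v)"
  using assms(3)
proof (induction rule: ble_induct)
  case (step x y)
  have x: "x \<in> W" using step_closed[OF step(2)] by simp
  consider "y = s \<otimes> x" | "step (s \<otimes> x) (s \<otimes> y)" using step_simple assms step by blast
  then show ?case
  proof cases
    case 1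
    then have "s \<otimes> y = x" using x assms by simp
    then show ?thesis using 1 step by auto
  next
    case 2
    then show ?thesis using step step_ble ble_trans by blast
  qed
qed simp

text \<open>The lifting property, according to whether \<open>s\<close> is a descent of \<open>u\<close> or of \<open>v\<close>.\<close>

lemma lifting_mult_ble:
  assumes "s \<in> S" "v \<in> W" "u \<preceq> v" "len (s \<otimes> v) < len v"
  shows "s \<otimes> u \<preceq> v"
  using lifting_dichotomy[OF assms(1) _ assms(3)] assms simple_down ble_trans ble_carrier by metis

lemma lifting_up:
  assumes "s \<in> S" "v \<in> W" "u \<preceq> v" "len (s \<otimes> v) < len v" "len u < len (s \<otimes> u)"
  shows "u \<preceq> s \<otimes> v"
  using lifting_dichotomy[OF assms(1) _ assms(3)] assms simple_up ble_trans ble_carrier by metis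

lemma lifting_down:
  assumes "s \<in> S" "v \<in> W" "u \<preceq> v" "len (s \<otimes> u) < len u"
  shows "s \<otimes> u \<preceq> s \<otimes> v"
  using lifting_dichotomy[OF assms(1) _ assms(3)] assms simple_down ble_trans ble_carrier by metis

lemma lifting_mult_up:
  assumes "s \<in> S" "v \<in> W" "u \<preceq> v" "len v < len (s \<otimes> v)"
  shows "s \<otimes> u \<preceq> s \<otimes> v"
  using lifting_dichotomy[OF assms(1) _ assms(3)] assms simple_up ble_trans ble_carrier by metis

text \<open>Right-hand versions of the lifting property, obtained by inversion.\<close>

lemma right_mult_ble:
  assumes "s \<in> S" "v \<in> W" "u \<preceq> v" "len (v \<otimes> s) < len v"
  shows "u \<otimes> s \<preceq> v"
proof -
  have u: "u \<in> W" using assms ble_carrier by blast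
  have "s \<otimes> inv u \<preceq> inv v"
    using assms u len_inv[of "v \<otimes> s"] by (intro lifting_mult_ble) (auto simp: ble_inv inv_mult_group)
  then have "inv (u \<otimes> s) \<preceq> inv v" using assms u by (simp add: inv_mult_group)
  then show ?thesis using assms u by (simp add: ble_inv)
qed

lemma right_up:
  assumes "s \<in> S" "v \<in> W" "u \<preceq> v" "len (v \<otimes> s) < len v" "len u < len (u \<otimes> s)"
  shows "u \<preceq> v \<otimes> s"
proof -
  have u: "u \<in> W" using assms ble_carrier by blast
  have "inv u \<preceq> s \<otimes> inv v"
    using assms u len_inv[of "v \<otimes> s"] len_inv[of "u \<otimes> s"]
    by (intro lifting_up) (auto simp: ble_inv inv_mult_group)
  then have "inv u \<preceq> inv (v \<otimes> s)" using assms u by (simp add: inv_mult_group)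
  then show ?thesis using assms u by (simp add: ble_inv)
qed

lemma finite_below:
  assumes "v \<in> W"
  shows "finite {u. u \<preceq> v}"
  using assms
proof (induction "len v" arbitrary: v rule: less_induct)
  case less
  show ?case
  proof (cases "v = \<one>")
    case True
    have "{u. u \<preceq> v} \<subseteq> {\<one>}" using ble_len True by fastforce
    then show ?thesis using finite_subset by blast
  next
    case False
    then obtain s where s: "s \<in> S" "len (s \<otimes> v) < len v"
      using left_descent_exists less by blast
    let ?D = "{u. u \<preceq> s \<otimes> v}"
    have fin: "finite ?D" using less s by simp
    have "{u. u \<preceq> v} \<subseteq> ?D \<union> (\<lambda>u. s \<otimes> u) ` ?D"
    proof
      fix u assume "u \<in> {u. u \<preceq> v}"
      then have uv: "u \<preceq> v" and u: "u \<in> W" using ble_carrier less by auto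
      show "u \<in> ?D \<union> (\<lambda>u. s \<otimes> u) ` ?D"
      proof (cases "len u < len (s \<otimes> u)")
        case True
        then show ?thesis using lifting_up s uv less by simp
      next
        case False
        then have "len (s \<otimes> u) < len u" using len_simple_mult[of s u] s u by auto
        then have "s \<otimes> u \<in> ?D" using lifting_down s uv less by simp
        moreover have "u = s \<otimes> (s \<otimes> u)" using s u by simp
        ultimately show ?thesis by blast
      qed
    qed
    then show ?thesis using fin finite_subset by blast
  qed
qed

lemma finite_interval: "v \<in> W \<Longrightarrow> finite (Bint u v)"
  by (rule finite_subset[OF _ finite_below]) (auto simp: bruhat_interval_def)

end

section \<open>Parabolic decompositions\<close>

locale parabolic = coxeter_system +
  fixes J :: "'a set"
  assumes J_sub: "J \<subseteq> S"
begin

abbreviation WJ :: "'a set" where "WJ \<equiv> generate G J"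
abbreviation MR :: "'a set" where "MR \<equiv> min_reps G S J"
abbreviation Jint :: "'a \<Rightarrow> 'a \<Rightarrow> 'a set" where "Jint \<equiv> par_interval G S J"
abbreviation Jatoms :: "'a \<Rightarrow> 'a \<Rightarrow> 'a set" where "Jatoms \<equiv> par_atoms G S J"

lemma J_in [simp]: "s \<in> J \<Longrightarrow> s \<in> S"
  using J_sub by blast

lemma WJ_closed [simp]: "z \<in> WJ \<Longrightarrow> z \<in> W"
  using generate_in_carrier[of J z] J_sub simple_closed by blast

lemma WJ_mult: "y \<in> WJ \<Longrightarrow> z \<in> WJ \<Longrightarrow> y \<otimes> z \<in> WJ"
  by (rule generate.eng)

lemma WJ_inv: "z \<in> WJ \<Longrightarrow> inv z \<in> WJ"
  by (rule generate_m_inv_closed) (use J_sub simple_closed in auto)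

lemma WJ_simple [simp]: "s \<in> J \<Longrightarrow> s \<in> WJ"
  by (rule generate.incl)

lemma lists_J_S: "ws \<in> lists J \<Longrightarrow> ws \<in> lists S"
  using J_sub by (auto simp: in_lists_conv_set)

lemma MR_iff: "u \<in> MR \<longleftrightarrow> u \<in> W \<and> (\<forall>z\<in>WJ. len u \<le> len (u \<otimes> z))"
  by (auto simp: min_reps_def l_coset_def)

lemma MR_closed [simp]: "u \<in> MR \<Longrightarrow> u \<in> W"
  by (simp add: min_reps_def)

text \<open>A shortest word over \<open>J\<close> is reduced over \<open>S\<close>: otherwise the exchange condition deletes letters from
  it, and the remaining letters still lie in \<open>J\<close>.\<close>

lemma reduced_word_J:
  assumes "z \<in> WJ"
  obtains ws where "ws \<in> lists J" "wprod ws = z" "length ws = len z"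
proof -
  have ex: "\<exists>ws. ws \<in> lists J \<and> wprod ws = z" using assms generate_words[OF J_sub] by auto
  define ws where "ws = arg_min length (\<lambda>ws. ws \<in> lists J \<and> wprod ws = z)"
  have ws: "ws \<in> lists J" "wprod ws = z"
    and least: "\<And>us. us \<in> lists J \<Longrightarrow> wprod us = z \<Longrightarrow> length ws \<le> length us"
    using arg_min_nat_lemma[of "\<lambda>ws. ws \<in> lists J \<and> wprod ws = z" _ length] ex
    unfolding ws_def by blast+
  have red: "len (wprod us) = length us \<or> (\<exists>vs. set vs \<subseteq> set us \<and> wprod vs = wprod us \<and> length vs < length us)"
    if "us \<in> lists S" for us
    using that
  proof (induction us)
    case (Cons s us)
    then have s: "s \<in> S" and us: "us \<in> lists S" by auto
    consider "len (wprod us) = length us"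
      | vs where "set vs \<subseteq> set us" "wprod vs = wprod us" "length vs < length us"
      using Cons by auto
    then show ?case
    proof cases
      case 1
      show ?thesis
      proof (cases "len (s \<otimes> wprod us) < len (wprod us)")
        case True
        then obtain i where i: "i < length us" "s \<otimes> wprod us = wprod (take i us @ drop (Suc i) us)"
          using strong_exchange us s by (meson simple_Refls)
        have "set (take i us @ drop (Suc i) us) \<subseteq> set us"
          by (auto dest: in_set_takeD in_set_dropD)
        then show ?thesis using i by (intro disjI2 exI[of _ "take i us @ drop (Suc i) us"]) auto
      next
        case False
        then show ?thesis using 1 len_simple_mult[of s "wprod us"] s us by auto
      qed
    next
      case 2
      then show ?thesis by (intro disjI2 exI[of _ "s # vs"]) auto
    qed
  qed simp
  have "len z = length ws"
  proof (rule ccontr)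
    assume "len z \<noteq> length ws"
    then obtain vs where vs: "set vs \<subseteq> set ws" "wprod vs = z" "length vs < length ws"
      using red[of ws] ws lists_J_S by auto
    then have "vs \<in> lists J" using ws(1) by (auto simp: in_lists_conv_set)
    then show False using least[of vs] vs by simp
  qed
  then show ?thesis using that ws by simp
qed

lemma WJ_induct [consumes 1, case_names one mult]:
  assumes "z \<in> WJ" and one: "P \<one>"
    and mult: "\<And>z s. z \<in> WJ \<Longrightarrow> s \<in> J \<Longrightarrow> len (z \<otimes> s) = Suc (len z) \<Longrightarrow> P z \<Longrightarrow> P (z \<otimes> s)"
  shows "P z"
proof -
  have "P (wprod zs)" if "zs \<in> lists J" "length zs = len (wprod zs)" for zs
    using that
  proof (induction zs rule: rev_induct)
    case (snoc s zs)
    then have s: "s \<in> J" and zs: "zs \<in> lists J" "zs \<in> lists S" using lists_J_S by auto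
    have zc: "wprod zs \<in> W" using zs by simp
    have app: "wprod (zs @ [s]) = wprod zs \<otimes> s" using zs s by (simp add: wprod_append)
    have "len (wprod zs) = length zs"
      using snoc.prems(2) app len_mult_le[of "wprod zs" s] len_simple_le[of s] s zc len_wprod_le[OF zs(2)]
      by simp
    moreover have "wprod zs \<in> WJ" using zs generate_words[OF J_sub] by blast
    ultimately show ?case using mult[of "wprod zs" s] snoc.IH snoc.prems(2) zs s app by simp
  qed (use one in simp)
  then show ?thesis using reduced_word_J[OF assms(1)] by metis
qed

text \<open>A shortening of \<open>u z a\<close> deletes a letter by the exchange condition: a letter of \<open>u\<close>
  contradicts the minimality of \<open>u\<close> in its coset, a letter of \<open>z\<close> contradicts \<open>\<ell>(z a) > \<ell>(z)\<close>.\<close>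

lemma len_MR_mult:
  assumes u: "u \<in> MR" and "z \<in> WJ"
  shows "len (u \<otimes> z) = len u + len z"
  using assms(2)
proof (induction rule: WJ_induct)
  case one
  then show ?case using u by simp
next
  case (mult z a)
  have uc: "u \<in> W" and zc: "z \<in> W" and a: "a \<in> S" using u mult by auto
  let ?w = "u \<otimes> z"
  have "\<not> len (?w \<otimes> a) < len ?w"
  proof
    assume less: "len (?w \<otimes> a) < len ?w"
    obtain us where us: "us \<in> lists S" "wprod us = u" "length us = len u"
      using uc by (rule reduced_word)
    obtain zs where zs: "zs \<in> lists J" "wprod zs = z" "length zs = len z"
      using mult(1) by (rule reduced_word_J)
    have zsS: "zs \<in> lists S" using zs lists_J_S by simp
    \<comment> \<open>right multiplication of \<open>w\<close> by \<open>a\<close> is left multiplication by the reflection \<open>w a w\<^sup>-\<^sup>1\<close>\<close>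
    let ?t = "?w \<otimes> a \<otimes> inv ?w"
    have wc: "?w \<in> W" using uc zc by simp
    have tR: "?t \<in> Refls" using wc a by (intro conj_Refls) auto
    have tw: "?t \<otimes> ?w = ?w \<otimes> a" using wc a by (simp add: m_assoc)
    have pw: "wprod (us @ zs) = ?w" using us zs zsS by (simp add: wprod_append)
    obtain i where i: "i < length (us @ zs)"
      and del: "?w \<otimes> a = wprod (take i (us @ zs) @ drop (Suc i) (us @ zs))"
      using strong_exchange[of "us @ zs" ?t] us(1) zsS tR less pw tw by auto
    show False
    proof (cases "i < length us")
      case True
      let ?us = "take i us @ drop (Suc i) us"
      have usS: "?us \<in> lists S"
        using us(1) by (auto simp: in_lists_conv_set dest: in_set_takeD in_set_dropD)
      have "?w \<otimes> a = wprod (?us @ zs)" using del True by simp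
      also have "\<dots> = wprod ?us \<otimes> z" using wprod_append[OF usS zsS] zs by simp
      finally have e: "?w \<otimes> a = wprod ?us \<otimes> z" .
      have "u \<otimes> (z \<otimes> a \<otimes> inv z) = (?w \<otimes> a) \<otimes> inv z"
        using uc zc a by (simp add: m_assoc)
      also have "\<dots> = wprod ?us"
        unfolding e using wprod_closed[OF usS] zc by (simp add: m_assoc)
      finally have "u \<otimes> (z \<otimes> a \<otimes> inv z) = wprod ?us" .
      moreover have "z \<otimes> a \<otimes> inv z \<in> WJ" using mult by (simp add: WJ_mult WJ_inv)
      ultimately have "len u \<le> len (wprod ?us)" using u by (metis MR_iff)
      then show False using len_wprod_le[OF usS] us(3) True by simp
    next
      case False
      define j where "j = i - length us"
      have j: "j < length zs" using i False by (simp add: j_def)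
      let ?zs = "take j zs @ drop (Suc j) zs"
      have zsS': "?zs \<in> lists S"
        using zsS by (auto simp: in_lists_conv_set dest: in_set_takeD in_set_dropD)
      have "Suc i - length us = Suc j" using False by (simp add: j_def)
      then have "take i (us @ zs) @ drop (Suc i) (us @ zs) = us @ ?zs"
        using False by (simp add: j_def)
      then have "?w \<otimes> a = u \<otimes> wprod ?zs" using del us wprod_append[OF us(1) zsS'] by simp
      then have "u \<otimes> (z \<otimes> a) = u \<otimes> wprod ?zs" using uc zc a by (simp add: m_assoc)
      then have "z \<otimes> a = wprod ?zs" using uc zc a wprod_closed[OF zsS'] by simp
      then have "len (z \<otimes> a) < length zs" using len_wprod_le[OF zsS'] j by simp
      then show False using mult zs by simp
    qed
  qed
  then have "len (?w \<otimes> a) = Suc (len ?w)" using len_mult_simple[of a ?w] uc zc a by auto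
  then show ?case using mult uc zc a by (simp add: m_assoc)
qed

lemma MR_decomposition:
  assumes "y \<in> W"
  obtains u z where "u \<in> MR" "z \<in> WJ" "y = u \<otimes> z"
proof -
  define z where "z = arg_min (\<lambda>z. len (y \<otimes> z)) (\<lambda>z. z \<in> WJ)"
  have "\<one> \<in> WJ" by (rule generate.one)
  from arg_min_nat_lemma[of "\<lambda>z. z \<in> WJ", OF this, of "\<lambda>z. len (y \<otimes> z)"]
  have z: "z \<in> WJ" "\<And>x. x \<in> WJ \<Longrightarrow> len (y \<otimes> z) \<le> len (y \<otimes> x)"
    unfolding z_def by auto
  have "y \<otimes> z \<in> MR"
    unfolding MR_iff using z assms by (auto simp: m_assoc WJ_mult)
  moreover have "y = (y \<otimes> z) \<otimes> inv z" using z assms by (simp add: m_assoc)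
  ultimately show ?thesis using that WJ_inv z by blast
qed

lemma MR_unique:
  assumes "u \<in> MR" "u' \<in> MR" "z \<in> WJ" "z' \<in> WJ" "u \<otimes> z = u' \<otimes> z'"
  shows "u = u'"
proof -
  have c: "u \<in> W" "u' \<in> W" "z \<in> W" "z' \<in> W" using assms by auto
  have "u' = u \<otimes> (z \<otimes> inv z')"
  proof -
    have "u' = u' \<otimes> z' \<otimes> inv z'" using c by (simp add: m_assoc)
    also have "\<dots> = u \<otimes> (z \<otimes> inv z')" unfolding assms(5)[symmetric] using c by (simp add: m_assoc)
    finally show ?thesis .
  qed
  moreover have "z \<otimes> inv z' \<in> WJ" using assms by (simp add: WJ_mult WJ_inv)
  ultimately have l: "len u' = len u + len (z \<otimes> inv z')" using len_MR_mult assms by metis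
  have "u = u' \<otimes> (z' \<otimes> inv z)"
  proof -
    have "u = u \<otimes> z \<otimes> inv z" using c by (simp add: m_assoc)
    also have "\<dots> = u' \<otimes> (z' \<otimes> inv z)" unfolding assms(5) using c by (simp add: m_assoc)
    finally show ?thesis .
  qed
  moreover have "z' \<otimes> inv z \<in> WJ" using assms by (simp add: WJ_mult WJ_inv)
  ultimately have "len u = len u' + len (z' \<otimes> inv z)" using len_MR_mult assms by metis
  then have "len (z \<otimes> inv z') = 0" using l by simp
  then have "z \<otimes> inv z' = \<one>" using c by (subst (asm) len_eq_0) auto
  then show ?thesis using \<open>u' = u \<otimes> (z \<otimes> inv z')\<close> c by simp
qed

lemma MR_descent_iff:
  assumes "u \<in> W"
  shows "u \<in> MR \<longleftrightarrow> (\<forall>s\<in>J. len u < len (u \<otimes> s))"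
proof
  assume u: "u \<in> MR"
  show "\<forall>s\<in>J. len u < len (u \<otimes> s)"
  proof
    fix s assume s: "s \<in> J"
    then have "len u \<le> len (u \<otimes> s)" using u by (simp add: MR_iff)
    then show "len u < len (u \<otimes> s)" using len_mult_simple[of s u] s assms by auto
  qed
next
  assume r: "\<forall>s\<in>J. len u < len (u \<otimes> s)"
  obtain v z where v: "v \<in> MR" "z \<in> WJ" "u = v \<otimes> z" using assms by (rule MR_decomposition)
  have "\<exists>s\<in>J. len (v \<otimes> z \<otimes> s) < len (v \<otimes> z)" if "z \<in> WJ" "z \<noteq> \<one>" for z
    using that
  proof (induction rule: WJ_induct)
    case (mult z s)
    have "v \<otimes> (z \<otimes> s) \<otimes> s = v \<otimes> z" using v mult by (simp add: m_assoc)
    moreover have "len (v \<otimes> z) < len (v \<otimes> (z \<otimes> s))"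
      using len_MR_mult[OF v(1)] mult by (simp add: WJ_mult)
    ultimately show ?case using mult by (intro bexI[of _ s]) simp_all
  qed simp
  then have "z = \<one>" using r v less_asym by blast
  then show "u \<in> MR" using v by simp
qed

lemma MR_simple_down:
  assumes "u \<in> MR" "s \<in> S" "len (s \<otimes> u) < len u"
  shows "s \<otimes> u \<in> MR"
proof -
  have uc: "u \<in> W" using assms by simp
  have "len (s \<otimes> u) < len (s \<otimes> u \<otimes> t)" if "t \<in> J" for t
  proof -
    have "len u < len (u \<otimes> t)" using assms that uc MR_descent_iff by blast
    then have "len (s \<otimes> u) < len (u \<otimes> t) - 1" using assms by linarith
    moreover have "len (u \<otimes> t) \<le> Suc (len (s \<otimes> u \<otimes> t))"
      using len_simple_mult[of s "u \<otimes> t"] assms uc that by (auto simp: m_assoc)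
    ultimately show ?thesis by linarith
  qed
  then show ?thesis using MR_descent_iff[of "s \<otimes> u"] uc assms by simp
qed

text \<open>Deodhar's lemma. If \<open>s u\<close> leaves \<open>W\<^sup>J\<close>, it has a right descent \<open>t \<in> J\<close>, which \<open>u\<close> does not have;
  comparing lengths, \<open>s\<close> is a left descent of \<open>u t\<close> but not of \<open>u\<close>, so \<open>s u = u t\<close>.\<close>

lemma deodhar:
  assumes "u \<in> MR" "s \<in> S" "s \<otimes> u \<notin> MR"
  obtains t where "t \<in> J" "s \<otimes> u = u \<otimes> t" "len u < len (s \<otimes> u)"
proof -
  have uc: "u \<in> W" using assms by simp
  have up: "len u < len (s \<otimes> u)"
    using MR_simple_down assms len_simple_mult[of s u] uc by fastforce
  obtain t where t: "t \<in> J" "\<not> len (s \<otimes> u) < len (s \<otimes> u \<otimes> t)"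
    using MR_descent_iff[of "s \<otimes> u"] assms uc by auto
  have ut: "len u < len (u \<otimes> t)" using MR_descent_iff[of u] assms t uc by auto
  have "len (s \<otimes> u \<otimes> t) < len (u \<otimes> t)"
    using t ut up len_mult_simple[of t "s \<otimes> u"] len_simple_mult[of s u] len_mult_simple[of t u] assms uc by auto
  then have "s \<otimes> u = u \<otimes> t" using exchange_eq assms t up uc by simp
  then show ?thesis using that t up by blast
qed

lemma MR_ble_mult:
  assumes "u \<in> MR" "z \<in> WJ"
  shows "u \<preceq> u \<otimes> z"
  using assms(2)
proof (induction rule: WJ_induct)
  case one
  then show ?case using assms by simp
next
  case (mult z s)
  have uc: "u \<in> W" using assms by simp
  have "len (u \<otimes> z) < len (u \<otimes> (z \<otimes> s))"
    using len_MR_mult[OF assms(1)] mult by (simp add: WJ_mult)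
  then have "step (u \<otimes> z) (u \<otimes> (z \<otimes> s))"
    using uc mult by (auto simp: bruhat_step_def m_assoc intro!: bexI[of _ s])
  then show ?case using mult step_ble ble_trans by metis
qed

text \<open>An element of \<open>W\<^sup>J\<close> below \<open>u z\<close> has no right descent in \<open>J\<close>, so the letters of \<open>z\<close> can be
  removed one at a time by right lifting.\<close>

lemma MR_ble_project:
  assumes "x \<in> MR" "u \<in> MR" "z \<in> WJ" "x \<preceq> u \<otimes> z"
  shows "x \<preceq> u"
  using assms(3,4)
proof (induction rule: WJ_induct)
  case one
  then show ?case using assms by simp
next
  case (mult z s)
  have c: "u \<in> W" "x \<in> W" "z \<in> W" using assms mult by simp_all
  have "len (u \<otimes> z) < len (u \<otimes> (z \<otimes> s))"
    using len_MR_mult[OF assms(2)] mult by (simp add: WJ_mult)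
  moreover have "len x < len (x \<otimes> s)" using MR_descent_iff[of x] mult assms c by auto
  ultimately have "x \<preceq> u \<otimes> (z \<otimes> s) \<otimes> s"
    using right_up[of s "u \<otimes> (z \<otimes> s)" x] mult c by (simp add: m_assoc)
  then have "x \<preceq> u \<otimes> z" using c mult by (simp add: m_assoc)
  then show ?case using mult by simp
qed

text \<open>The chain property of \<open>W\<^sup>J\<close>, for the bottom of a chain. The induction removes a left descent \<open>s\<close>
  of \<open>b\<close>. If \<open>u \<preceq> s b\<close> fails, then \<open>s u < u\<close>, and the atom \<open>a\<close> found in \<open>[s u, s b]\<close> is lifted to \<open>s a\<close>; were \<open>s a\<close> outside
  \<open>W\<^sup>J\<close>, Deodhar's lemma and projection would give \<open>u \<preceq> a\<close>, hence \<open>u = a\<close> by length.\<close>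

lemma MR_atom_exists:
  assumes "u \<in> MR" "b \<in> MR" "u \<preceq> b" "u \<noteq> b"
  shows "\<exists>a\<in>MR. u \<preceq> a \<and> a \<preceq> b \<and> len a = Suc (len u)"
  using assms
proof (induction "len b" arbitrary: u b rule: less_induct)
  case less
  note u = less.prems(1) and b = less.prems(2)
  have uc: "u \<in> W" and bc: "b \<in> W" using u b by auto
  have "b \<noteq> \<one>" using less.prems ble_len by fastforce
  then obtain s where s: "s \<in> S" and sb: "len (s \<otimes> b) < len b"
    using bc left_descent_exists by blast
  have sbM: "s \<otimes> b \<in> MR" using MR_simple_down b s sb by simp
  have sbb: "s \<otimes> b \<preceq> b" using simple_down bc s sb by simp
  have lb: "len b = Suc (len (s \<otimes> b))" using len_simple_mult[of s b] bc s sb by auto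
  show ?case
  proof (cases "u \<preceq> s \<otimes> b \<and> u \<noteq> s \<otimes> b")
    case True
    then obtain a where "a \<in> MR" "u \<preceq> a" "a \<preceq> s \<otimes> b" "len a = Suc (len u)"
      using less.hyps[OF sb u sbM] by blast
    then show ?thesis using sbb ble_trans by blast
  next
    case nlt: False
    show ?thesis
    proof (cases "len u < len (s \<otimes> u)")
      case True
      then have "u \<preceq> s \<otimes> b" using lifting_up s bc less.prems sb by simp
      then have "u = s \<otimes> b" using nlt by simp
      then show ?thesis using less.prems lb by (intro bexI[of _ b]) auto
    next
      case False
      then have su: "len u = Suc (len (s \<otimes> u))" using len_simple_mult[of s u] uc s by auto
      then have suM: "s \<otimes> u \<in> MR" using MR_simple_down u s by simp
      have sc: "s \<otimes> u \<in> W" using uc s by simp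
      have susb: "s \<otimes> u \<preceq> s \<otimes> b" using lifting_down s bc less.prems su by simp
      have nub: "\<not> u \<preceq> s \<otimes> b"
      proof
        assume "u \<preceq> s \<otimes> b"
        then have "u = s \<otimes> b" using nlt by simp
        then show False using su lb bc s by simp
      qed
      have "s \<otimes> u \<noteq> s \<otimes> b" using uc bc s less.prems by simp
      then obtain a where a: "a \<in> MR" "s \<otimes> u \<preceq> a" "a \<preceq> s \<otimes> b" and la: "len a = Suc (len (s \<otimes> u))"
        using less.hyps[OF sb suM sbM susb] by blast
      have ac: "a \<in> W" using a by simp
      have au: "a \<noteq> u" using nub a by auto
      \<comment> \<open>otherwise lifting \<open>s u \<preceq> a\<close> past \<open>s\<close> gives \<open>s u = s a\<close> by length, so \<open>a = u\<close>\<close>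
      have up: "len a < len (s \<otimes> a)"
      proof (rule ccontr)
        assume "\<not> len a < len (s \<otimes> a)"
        then have sa: "len a = Suc (len (s \<otimes> a))" using len_simple_mult[of s a] ac s by auto
        then have "s \<otimes> u \<preceq> s \<otimes> a" using lifting_up[of s a "s \<otimes> u"] s ac a uc su by simp
        then have "s \<otimes> u = s \<otimes> a" using ble_eq sa la by simp
        then show False using au uc ac s by simp
      qed
      have usa: "u \<preceq> s \<otimes> a"
        using lifting_mult_up[of s a "s \<otimes> u"] s ac a up uc by simp
      have sab: "s \<otimes> a \<preceq> b"
        using lifting_mult_up[of s "s \<otimes> b" a] s bc a sb by simp
      have "s \<otimes> a \<in> MR"
      proof (rule ccontr)
        assume "s \<otimes> a \<notin> MR"
        then obtain t where t: "t \<in> J" "s \<otimes> a = a \<otimes> t" using deodhar a s by blast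
        then have "u \<preceq> a" using MR_ble_project[of u a t] u a usa by simp
        then have "u = a" using ble_eq la su by simp
        then show False using au by simp
      qed
      moreover have "len (s \<otimes> a) = Suc (len u)" using len_simple_mult[of s a] ac s up la su by auto
      ultimately show ?thesis using usa sab by blast
    qed
  qed
qed

end

section \<open>Reversal of polynomials\<close>

text \<open>The value at \<open>q\<^sup>-\<^sup>1\<close>. Working with ring homomorphisms into the fraction field makes reversal
  multiplicative without degree side conditions.\<close>

definition inv_eval :: "int poly \<Rightarrow> int poly fract" where
  "inv_eval p = poly (map_poly of_int p) (inverse (to_fract qX))"

lemma q_flip_inv_eval: "q_flip k p = to_fract qX powi k * inv_eval p"
  by (simp add: q_flip_def inv_eval_def)

lemma inv_eval_0 [simp]: "inv_eval 0 = 0"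
  by (simp add: inv_eval_def)

lemma inv_eval_pCons: "inv_eval (pCons a p) = of_int a + inverse (to_fract qX) * inv_eval p"
  by (simp add: inv_eval_def map_poly_pCons)

lemma inv_eval_add: "inv_eval (p + r) = inv_eval p + inv_eval r"
proof (induction p r rule: poly_induct2)
  case (pCons a p b r)
  then show ?case by (simp add: inv_eval_pCons algebra_simps)
qed simp

lemma inv_eval_smult: "inv_eval (smult a p) = of_int a * inv_eval p"
  by (induction p) (simp_all add: inv_eval_pCons algebra_simps)

lemma inv_eval_mult: "inv_eval (p * r) = inv_eval p * inv_eval r"
  by (induction p) (simp_all add: inv_eval_pCons inv_eval_add inv_eval_smult algebra_simps)

lemma inv_eval_uminus: "inv_eval (- p) = - inv_eval p"
  using inv_eval_smult[of "-1" p] by simp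

lemma inv_eval_diff: "inv_eval (p - r) = inv_eval p - inv_eval r"
  using inv_eval_add[of p "- r"] by (simp add: inv_eval_uminus)

lemma inv_eval_1 [simp]: "inv_eval 1 = 1"
  by (simp add: one_pCons inv_eval_pCons)

lemma inv_eval_sum: "inv_eval (\<Sum>i\<in>A. f i) = (\<Sum>i\<in>A. inv_eval (f i))"
  by (induction A rule: infinite_finite_induct) (auto simp: inv_eval_add)

lemma inv_eval_qX: "inv_eval qX = inverse (to_fract qX)"
  by (simp add: inv_eval_pCons)

lemma q_flip_add: "q_flip k (p + r) = q_flip k p + q_flip k r"
  and q_flip_diff: "q_flip k (p - r) = q_flip k p - q_flip k r"
  and q_flip_uminus: "q_flip k (- p) = - q_flip k p"
  and q_flip_0 [simp]: "q_flip k 0 = 0"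
  and q_flip_1 [simp]: "q_flip 0 1 = 1"
  by (simp_all add: q_flip_inv_eval inv_eval_add inv_eval_diff inv_eval_uminus algebra_simps)

lemma q_flip_sum: "q_flip k (\<Sum>i\<in>A. f i) = (\<Sum>i\<in>A. q_flip k (f i))"
  by (simp add: q_flip_inv_eval inv_eval_sum sum_distrib_left)

lemma q_flip_mult: "q_flip (k + l) (p * r) = q_flip k p * q_flip l r"
  by (simp add: q_flip_inv_eval inv_eval_mult power_int_add)

lemma q_flip_qX: "q_flip 1 qX = 1"
  by (simp add: q_flip_inv_eval inv_eval_qX)

lemma q_flip_power: "q_flip (int n * k) (p ^ n) = q_flip k p ^ n"
proof (induction n)
  case (Suc n)
  then show ?case using q_flip_mult[of k "int n * k" p "p ^ n"] by (simp add: algebra_simps)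
qed simp

lemma to_fract_power: "to_fract (p ^ n) = to_fract p ^ n"
  by (induction n) auto

lemma q_flip_monom:
  assumes "i \<le> n"
  shows "q_flip (int n) (monom c i) = to_fract (monom c (n - i))"
proof -
  have "monom c i = smult c (qX ^ i)" "monom c (n - i) = smult c (qX ^ (n - i))"
    by (simp_all add: monom_altdef)
  moreover have "inv_eval (qX ^ i) = inverse (to_fract qX) ^ i"
    by (induction i) (simp_all add: inv_eval_pCons)
  moreover have "to_fract (smult c p) = of_int c * to_fract p" for p :: "int poly"
  proof -
    have "smult c p = of_int c * p" by (simp add: of_int_poly)
    moreover have "to_fract (of_int c :: int poly) = of_int c"
    proof -
      have "to_fract (of_nat k :: int poly) = of_nat k" for k by (induction k) auto
      then show ?thesis by (cases c rule: int_diff_cases) simp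
    qed
    ultimately show ?thesis by simp
  qed
  moreover have "to_fract qX ^ n * inverse (to_fract qX) ^ i = to_fract qX ^ (n - i)"
    using assms by (simp add: power_diff field_simps)
  ultimately show ?thesis
    by (simp add: q_flip_inv_eval inv_eval_smult to_fract_power algebra_simps)
qed

lemma q_flip_poly:
  assumes "degree p \<le> n"
  shows "q_flip (int n) p = to_fract (\<Sum>i\<le>n. monom (coeff p (n - i)) i)"
proof -
  have "q_flip (int n) p = q_flip (int n) (\<Sum>i\<le>n. monom (coeff p i) i)"
    using poly_as_sum_of_monoms'[OF assms] by simp
  also have "\<dots> = (\<Sum>i\<le>n. to_fract (monom (coeff p i) (n - i)))"
    by (simp add: q_flip_sum q_flip_monom)
  also have "\<dots> = (\<Sum>i\<le>n. to_fract (monom (coeff p (n - i)) i))"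
    by (rule sum.reindex_bij_witness[of _ "\<lambda>i. n - i" "\<lambda>i. n - i"]) auto
  finally show ?thesis by simp
qed

lemma coeff_flip_sum:
  "coeff (\<Sum>i\<le>n. monom (coeff p (n - i)) i) j = (if j \<le> n then coeff p (n - j) else 0)"
  by (simp add: coeff_sum)

text \<open>The difference \<open>d\<close> of two solutions is fixed by reversal, so its coefficients are symmetric about
  \<open>n / 2\<close>; the degree bound kills the upper half, hence also the lower.\<close>

lemma q_flip_unique:
  assumes "2 * degree p < n" "2 * degree p' < n"
    and "q_flip (int n) p = to_fract (p + z)" "q_flip (int n) p' = to_fract (p' + z)"
  shows "p = p'"
proof -
  define d where "d = p - p'"
  have deg: "2 * degree d < n"
    using degree_diff_le_max[of p p'] assms(1,2) by (simp add: d_def)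
  have "q_flip (int n) d = to_fract d"
    using assms(3,4) by (simp add: d_def q_flip_diff)
  then have eq: "d = (\<Sum>i\<le>n. monom (coeff d (n - i)) i)"
  proof -
    have "degree d \<le> n" using deg by simp
    from q_flip_poly[OF this] have "to_fract d = to_fract (\<Sum>i\<le>n. monom (coeff d (n - i)) i)"
      using \<open>q_flip (int n) d = to_fract d\<close> by (simp only:)
    then show ?thesis by (simp only: to_fract_eq_iff)
  qed
  have "coeff d i = 0" for i
  proof (cases "degree d < i")
    case False
    then have "degree d < n - i" "i \<le> n" using deg by auto
    then have "coeff d (n - i) = 0" by (simp add: coeff_eq_0)
    then show ?thesis using coeff_flip_sum[of d n i] eq by simp
  qed (simp add: coeff_eq_0)
  then have "d = 0" by (simp add: poly_eq_iff)
  then show ?thesis by (simp add: d_def)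
qed

text \<open>If \<open>z\<close> had degree \<open>d > n\<close>, then clearing denominators would give a polynomial identity whose left side has constant
  term the leading coefficient of \<open>z\<close>, while \<open>q\<^bsup>d - n\<^esup>\<close> divides the right side.\<close>

lemma q_flip_antisymmetric_degree:
  assumes "q_flip (int n) z = - to_fract z"
  shows "degree z \<le> n"
proof (rule ccontr)
  assume "\<not> degree z \<le> n"
  then have less: "n < degree z" by simp
  let ?d = "degree z"
  have "q_flip (int ?d) z = to_fract qX ^ (?d - n) * q_flip (int n) z"
  proof -
    have "to_fract qX ^ ?d = to_fract qX ^ (?d - n) * to_fract qX ^ n"
      using less by (metis le_add_diff_inverse2 less_imp_le power_add)
    then show ?thesis by (simp add: q_flip_inv_eval)
  qed
  also have "\<dots> = to_fract (- (qX ^ (?d - n) * z))"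
    by (simp add: assms to_fract_power)
  finally have eq: "(\<Sum>i\<le>?d. monom (coeff z (?d - i)) i) = - (qX ^ (?d - n) * z)"
    by (simp only: q_flip_poly[OF order_refl] to_fract_eq_iff)
  have "coeff (\<Sum>i\<le>?d. monom (coeff z (?d - i)) i) 0 = lead_coeff z"
    by (simp add: coeff_flip_sum)
  moreover have "coeff (- (qX ^ (?d - n) * z)) 0 = 0"
    using less by (simp add: coeff_mult_0 coeff_0_power)
  ultimately have "z = 0" using eq by simp
  then show False using less by simp
qed

text \<open>A polynomial that reversal negates has coefficients antisymmetric about \<open>n / 2\<close>; its lower half
  with the opposite sign is the required solution.\<close>

lemma q_flip_solution:
  assumes "q_flip (int n) z = - to_fract z" "0 < n"
  shows "\<exists>p. 2 * degree p < n \<and> q_flip (int n) p = to_fract (p + z)"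
proof -
  have deg: "degree z \<le> n" using q_flip_antisymmetric_degree assms by blast
  have "(\<Sum>i\<le>n. monom (coeff z (n - i)) i) = - z"
  proof -
    have "to_fract (\<Sum>i\<le>n. monom (coeff z (n - i)) i) = to_fract (- z)"
      unfolding q_flip_poly[OF deg, symmetric] by (simp add: assms)
    then show ?thesis by (simp only: to_fract_eq_iff)
  qed
  then have anti: "coeff z (n - i) = - coeff z i" if "i \<le> n" for i
    using coeff_flip_sum[of z n i] that by simp
  \<comment> \<open>the index bound is equivalent to \<open>2 i < n\<close>; a middle coefficient of \<open>z\<close> vanishes by antisymmetry\<close>
  define p where "p = (\<Sum>i<(n + 1) div 2. monom (- coeff z i) i)"
  have cp: "coeff p j = (if 2 * j < n then - coeff z j else 0)" for j
  proof -
    have "coeff p j = (if j < (n + 1) div 2 then - coeff z j else 0)"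
      by (simp add: p_def coeff_sum)
    moreover have "j < (n + 1) div 2 \<longleftrightarrow> 2 * j < n" by linarith
    ultimately show ?thesis by simp
  qed
  have dp: "2 * degree p < n"
  proof (cases "p = 0")
    case False
    then have "coeff p (degree p) \<noteq> 0" by simp
    then show ?thesis using cp by metis
  qed (use assms in simp)
  have "(\<Sum>i\<le>n. monom (coeff p (n - i)) i) = p + z"
  proof (rule poly_eqI)
    fix j
    show "coeff (\<Sum>i\<le>n. monom (coeff p (n - i)) i) j = coeff (p + z) j"
    proof (cases "j \<le> n")
      case True
      have "coeff z j = 0" if "2 * j = n"
      proof -
        have "n - j = j" using that by simp
        then show ?thesis using anti[of j] that by simp
      qed
      then show ?thesis unfolding coeff_flip_sum unfolding coeff_add cp using True anti[OF True] by auto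
    next
      case False
      then have "coeff z j = 0" using deg by (simp add: coeff_eq_0)
      then show ?thesis unfolding coeff_flip_sum unfolding coeff_add cp using False by auto
    qed
  qed
  then have "q_flip (int n) p = to_fract (p + z)" using q_flip_poly[of p n] dp by simp
  then show ?thesis using dp by blast
qed

text \<open>Sums over Bruhat ideals are compared by pairing \<open>y\<close> with \<open>s y\<close> or \<open>y s\<close>, since the recursions
  treat the shorter and the longer element of a pair differently.\<close>

lemma sum_over_pairs:
  fixes f g :: "'i \<Rightarrow> 'r :: comm_ring_1"
  assumes "finite A" and i: "\<And>a. a \<in> A \<Longrightarrow> i a \<in> A" "\<And>a. a \<in> A \<Longrightarrow> i (i a) = a"
    and P: "\<And>a. a \<in> A \<Longrightarrow> P (i a) \<longleftrightarrow> \<not> P a"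
    and eq: "\<And>a. a \<in> A \<Longrightarrow> P a \<Longrightarrow> f a + f (i a) = c * (g a + g (i a))"
  shows "sum f A = c * sum g A"
proof -
  have split: "sum h A = (\<Sum>a\<in>{a\<in>A. P a}. h a + h (i a))" for h :: "'i \<Rightarrow> 'r"
  proof -
    have "sum h A = sum h {a\<in>A. P a} + sum h {a\<in>A. \<not> P a}"
      using sum.Int_Diff[OF assms(1), of h "{a. P a}"] by (simp add: Int_def set_diff_eq)
    also have "sum h {a\<in>A. \<not> P a} = (\<Sum>a\<in>{a\<in>A. P a}. h (i a))"
      by (rule sum.reindex_bij_witness[of _ i i]) (use i P in auto)
    finally show ?thesis by (simp add: sum.distrib)
  qed
  show ?thesis unfolding split by (simp add: eq sum_distrib_left)
qed

section \<open>Ordinary R-polynomials\<close>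

context coxeter_system
begin

\<comment> \<open>The polynomial \<open>q\<close> is the literal \<open>[:0, 1:]\<close>; products with it should stay products.\<close>
declare mult_pCons_left [simp del] mult_pCons_right [simp del]

text \<open>The recursion for ordinary R-polynomials says that \<open>Lop s\<close> maps the column \<open>R\<^bsub>\<cdot>,v\<^esub>\<close> to
  \<open>R\<^bsub>\<cdot>,sv\<^esub>\<close> if \<open>s v > v\<close>. So the column of \<open>v = s\<^sub>1 \<dots> s\<^sub>k\<close> has to be \<open>L\<^sub>1 \<dots> L\<^sub>k\<close> applied to the unit vector
  at the identity, and the problem is independence of the reduced word. \<open>Lop\<close> and its right-hand
  twin \<open>Mop\<close> are, up to signs and powers of \<open>q\<close>, the inverses of multiplication by generators in the
  Hecke algebra.\<close>

definition Lop :: "'a \<Rightarrow> ('a \<Rightarrow> int poly) \<Rightarrow> 'a \<Rightarrow> int poly" where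
  "Lop s f u = (if u \<in> W then
     (if len (s \<otimes> u) < len u then f (s \<otimes> u) else (qX - 1) * f u + qX * f (s \<otimes> u)) else 0)"

definition Mop :: "'a \<Rightarrow> ('a \<Rightarrow> int poly) \<Rightarrow> 'a \<Rightarrow> int poly" where
  "Mop s f u = (if u \<in> W then
     (if len (u \<otimes> s) < len u then f (u \<otimes> s) else (qX - 1) * f u + qX * f (u \<otimes> s)) else 0)"

text \<open>\<open>q\<close> times the inverse of \<open>Lop s\<close>, by the quadratic relation. It is the better operator for
  bookkeeping: it maps unit vectors to unit vectors as long as lengths increase.\<close>

definition Dop :: "'a \<Rightarrow> ('a \<Rightarrow> int poly) \<Rightarrow> 'a \<Rightarrow> int poly" where
  "Dop s f u = Lop s f u - (qX - 1) * f u"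

definition delta :: "'a \<Rightarrow> 'a \<Rightarrow> int poly" where
  "delta w u = (if u = w then 1 else 0)"

text \<open>Left and right operators commute pointwise whenever left multiplication by \<open>s\<close> behaves the same at \<open>u\<close>
  and at \<open>u t\<close>; otherwise \<open>s u = u t\<close>, and the two sides coincide for that reason.\<close>

lemma Lop_Mop:
  assumes "s \<in> S" "t \<in> S"
  shows "Lop s (Mop t f) = Mop t (Lop s f)"
proof
  fix u
  show "Lop s (Mop t f) u = Mop t (Lop s f) u"
  proof (cases "u \<in> W")
    case u: True
    have c: "s \<otimes> u \<in> W" "u \<otimes> t \<in> W" "s \<otimes> u \<otimes> t = s \<otimes> (u \<otimes> t)"
      using u assms by (simp_all add: m_assoc)
    note steps = len_simple_mult[OF assms(1) u] len_mult_simple[OF assms(2) u]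
      len_simple_mult[OF assms(1) c(2)] len_mult_simple[OF assms(2) c(1)]
    show ?thesis
    proof (cases "len (s \<otimes> u) < len u \<longleftrightarrow> len (s \<otimes> (u \<otimes> t)) < len (u \<otimes> t)")
      case True
      then have "len (u \<otimes> t) < len u \<longleftrightarrow> len (s \<otimes> (u \<otimes> t)) < len (s \<otimes> u)"
        using steps c(3) by auto
      then show ?thesis using u c True by (simp add: Lop_def Mop_def algebra_simps)
    next
      case False
      have "s \<otimes> u = u \<otimes> t"
      proof (cases "len (s \<otimes> u) < len u")
        case True
        then have "len (s \<otimes> u) < len (s \<otimes> (s \<otimes> u))" "len (s \<otimes> (s \<otimes> u) \<otimes> t) < len (s \<otimes> u \<otimes> t)"
          using False u assms steps c by auto
        then have "s \<otimes> (s \<otimes> u) = s \<otimes> u \<otimes> t" using exchange_eq[of s t "s \<otimes> u"] assms u by simp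
        then have "s \<otimes> (s \<otimes> (s \<otimes> u)) = s \<otimes> (s \<otimes> (u \<otimes> t))" using c assms u by (simp add: m_assoc)
        then show ?thesis using u assms c by simp
      next
        case f: False
        then have "len u < len (s \<otimes> u)" "len (s \<otimes> u \<otimes> t) < len (u \<otimes> t)"
          using False steps c by auto
        then show ?thesis using exchange_eq assms u by simp
      qed
      then have e: "u \<otimes> t = s \<otimes> u" "s \<otimes> u \<otimes> t = u" "s \<otimes> (s \<otimes> u) = u" using c u assms by simp_all
      show ?thesis unfolding Lop_def Mop_def using u c by (simp add: e)
    qed
  qed (simp add: Lop_def Mop_def)
qed

lemma Dop_Mop:
  assumes "s \<in> S" "t \<in> S"
  shows "Dop s (Mop t f) = Mop t (Dop s f)"
proof -
  have "Mop t (Dop s f) u = Mop t (Lop s f) u - (qX - 1) * Mop t f u" for u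
    by (simp add: Mop_def Dop_def algebra_simps)
  then show ?thesis by (auto simp: Dop_def Lop_Mop[OF assms, symmetric])
qed

lemma Lop_supp: "u \<notin> W \<Longrightarrow> Lop s f u = 0"
  by (simp add: Lop_def)

lemma simple_neq_one: "s \<in> S \<Longrightarrow> len s = 1 \<and> s \<noteq> \<one>"
  using len_simple_mult[of s \<one>] by auto

lemma Lop_delta_one:
  assumes "s \<in> S"
  shows "Lop s (delta \<one>) = Mop s (delta \<one>)"
proof
  fix u
  show "Lop s (delta \<one>) u = Mop s (delta \<one>) u"
  proof (cases "u \<in> W")
    case u: True
    consider "u = \<one>" | "u = s" | "u \<noteq> \<one>" "u \<noteq> s" by blast
    then show ?thesis
    proof cases
      case 1
      then show ?thesis using assms simple_neq_one by (simp add: Lop_def Mop_def delta_def)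
    next
      case 2
      then show ?thesis using assms simple_neq_one by (simp add: Lop_def Mop_def delta_def)
    next
      case 3
      have "s \<otimes> u \<noteq> \<one>" using 3 u assms by (metis inv_simple inv_equality inv_inv simple_in)
      moreover have "u \<otimes> s \<noteq> \<one>" using 3 u assms by (metis inv_simple inv_equality simple_in)
      ultimately show ?thesis using 3 by (simp add: Lop_def Mop_def delta_def)
    qed
  qed (simp add: Lop_def Mop_def)
qed

lemma Lop_foldr_Mop: "s \<in> S \<Longrightarrow> ws \<in> lists S \<Longrightarrow> Lop s (foldr Mop ws f) = foldr Mop ws (Lop s f)"
  by (induction ws) (simp_all add: Lop_Mop)

lemma Dop_foldr_Mop: "s \<in> S \<Longrightarrow> ws \<in> lists S \<Longrightarrow> Dop s (foldr Mop ws f) = foldr Mop ws (Dop s f)"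
  by (induction ws) (simp_all add: Dop_Mop)

lemma foldr_Dop_Mop:
  "us \<in> lists S \<Longrightarrow> ws \<in> lists S \<Longrightarrow> foldr Dop us (foldr Mop ws f) = foldr Mop ws (foldr Dop us f)"
  by (induction us) (simp_all add: Dop_foldr_Mop)

lemma foldr_Lop_Mop: "ws \<in> lists S \<Longrightarrow> foldr Lop ws (delta \<one>) = foldr Mop (rev ws) (delta \<one>)"
proof (induction ws)
  case (Cons s ws)
  then have s: "s \<in> S" and ws: "rev ws \<in> lists S" "ws \<in> lists S" by (auto simp: in_lists_conv_set)
  have "foldr Lop (s # ws) (delta \<one>) = foldr Mop (rev ws) (Lop s (delta \<one>))"
    using Cons.IH[OF ws(2)] Lop_foldr_Mop[OF s ws(1)] by simp
  then show ?case using s by (simp add: Lop_delta_one)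
qed simp

lemma Dop_Lop:
  assumes "s \<in> S" "\<And>u. u \<notin> W \<Longrightarrow> f u = 0"
  shows "Dop s (Lop s f) = (\<lambda>u. qX * f u)"
proof
  fix u
  show "Dop s (Lop s f) u = qX * f u"
  proof (cases "u \<in> W")
    case u: True
    show ?thesis
    proof (cases "len (s \<otimes> u) < len u")
      case True
      then show ?thesis using u assms by (simp add: Dop_def Lop_def)
    next
      case False
      then have "len u < len (s \<otimes> u)" using len_simple_mult[of s u] u assms by auto
      then show ?thesis using u assms by (simp add: Dop_def Lop_def algebra_simps)
    qed
  qed (simp add: assms Dop_def Lop_def)
qed

lemma Lop_Dop:
  assumes "s \<in> S" "\<And>u. u \<notin> W \<Longrightarrow> f u = 0"
  shows "Lop s (Dop s f) = (\<lambda>u. qX * f u)"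
proof
  fix u
  show "Lop s (Dop s f) u = qX * f u"
  proof (cases "u \<in> W")
    case u: True
    show ?thesis
    proof (cases "len (s \<otimes> u) < len u")
      case True
      then show ?thesis using u assms by (simp add: Dop_def Lop_def)
    next
      case False
      then have "len u < len (s \<otimes> u)" using len_simple_mult[of s u] u assms by auto
      then show ?thesis using u assms by (simp add: Dop_def Lop_def algebra_simps)
    qed
  qed (simp add: assms Lop_def)
qed

lemma Lop_scale: "Lop s (\<lambda>u. c * f u) = (\<lambda>u. c * Lop s f u)"
  by (auto simp: Lop_def algebra_simps)

lemma Dop_scale: "Dop s (\<lambda>u. c * f u) = (\<lambda>u. c * Dop s f u)"
  by (auto simp: Dop_def Lop_scale algebra_simps)

lemma foldr_Lop_scale: "foldr Lop ws (\<lambda>u. c * f u) = (\<lambda>u. c * foldr Lop ws f u)"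
  by (induction ws) (simp_all add: Lop_scale)

lemma foldr_Dop_scale: "foldr Dop ws (\<lambda>u. c * f u) = (\<lambda>u. c * foldr Dop ws f u)"
  by (induction ws) (simp_all add: Dop_scale)

lemma foldr_Lop_supp:
  "(\<And>u. u \<notin> W \<Longrightarrow> f u = 0) \<Longrightarrow> u \<notin> W \<Longrightarrow> foldr Lop ws f u = 0"
  by (induction ws) (simp_all add: Lop_supp)

lemma foldr_Dop_supp:
  "(\<And>u. u \<notin> W \<Longrightarrow> f u = 0) \<Longrightarrow> u \<notin> W \<Longrightarrow> foldr Dop ws f u = 0"
  by (induction ws) (simp_all add: Dop_def Lop_supp)

lemma foldr_Dop_Lop:
  assumes "ws \<in> lists S" and f: "\<And>u. u \<notin> W \<Longrightarrow> f u = 0"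
  shows "foldr Dop (rev ws) (foldr Lop ws f) = (\<lambda>u. qX ^ length ws * f u)"
  using assms(1)
proof (induction ws)
  case (Cons s ws)
  then have s: "s \<in> S" and ws: "ws \<in> lists S" by auto
  have "foldr Dop (rev (s # ws)) (foldr Lop (s # ws) f)
      = foldr Dop (rev ws) (Dop s (Lop s (foldr Lop ws f)))" by simp
  also have "Dop s (Lop s (foldr Lop ws f)) = (\<lambda>u. qX * foldr Lop ws f u)"
    using s foldr_Lop_supp[OF f] by (intro Dop_Lop)
  finally show ?case by (simp add: foldr_Dop_scale Cons.IH mult.assoc)
qed simp

lemma foldr_Lop_Dop:
  assumes "ws \<in> lists S" and f: "\<And>u. u \<notin> W \<Longrightarrow> f u = 0"
  shows "foldr Lop ws (foldr Dop (rev ws) f) = (\<lambda>u. qX ^ length ws * f u)"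
  using assms(1)
proof (induction ws rule: rev_induct)
  case (snoc s ws)
  then have s: "s \<in> S" and ws: "ws \<in> lists S" by auto
  have "foldr Lop (ws @ [s]) (foldr Dop (rev (ws @ [s])) f)
      = foldr Lop ws (Lop s (Dop s (foldr Dop (rev ws) f)))" by simp
  also have "Lop s (Dop s (foldr Dop (rev ws) f)) = (\<lambda>u. qX * foldr Dop (rev ws) f u)"
    using s foldr_Dop_supp[OF f] by (intro Lop_Dop)
  finally show ?case by (simp add: foldr_Lop_scale snoc.IH[OF ws] mult.assoc)
qed simp

lemma Dop_delta:
  assumes "s \<in> S" "w \<in> W" "len w < len (s \<otimes> w)"
  shows "Dop s (delta w) = delta (s \<otimes> w)"
proof
  fix u
  show "Dop s (delta w) u = delta (s \<otimes> w) u"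
  proof (cases "u \<in> W")
    case u: True
    have iff: "s \<otimes> u = w \<longleftrightarrow> u = s \<otimes> w" using assms u by auto
    have "w \<noteq> s \<otimes> w" using assms by auto
    then show ?thesis using assms u by (auto simp: Dop_def Lop_def delta_def iff)
  qed (use assms in \<open>auto simp: Dop_def Lop_def delta_def\<close>)
qed

lemma foldr_Dop_delta:
  "ws \<in> lists S \<Longrightarrow> length ws = len (wprod ws) \<Longrightarrow> foldr Dop ws (delta \<one>) = delta (wprod ws)"
proof (induction ws)
  case (Cons s ws)
  then have s: "s \<in> S" and ws: "ws \<in> lists S" by auto
  have l: "len (wprod ws) = length ws" "len (wprod ws) < len (s \<otimes> wprod ws)"
    using Cons.prems(2) len_wprod_le[OF ws] len_simple_mult[of s "wprod ws"] s ws by auto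
  then show ?case using Cons.IH ws s by (simp add: Dop_delta)
qed simp

lemma delta_one_supp: "u \<notin> W \<Longrightarrow> delta \<one> u = 0"
  by (auto simp: delta_def)

text \<open>Put \<open>X = L\<^sub>1 \<dots> L\<^sub>k \<delta>\<close> for one of the words. Rewritten with right operators, \<open>X\<close> is
  a right-hand word applied to \<open>\<delta>\<close>, so \<open>D\<close>-operators pass through to \<open>\<delta>\<close>, where their product visibly
  depends on the group element only. Hence the \<open>D\<close>-products of both reversed words send \<open>X\<close> to the same
  vector \<open>q\<^sup>k \<delta>\<close>, and applying the \<open>L\<close>-product of the other word cancels \<open>D\<close> against \<open>L\<close>.\<close>

lemma foldr_Lop_unique:
  assumes ws: "ws \<in> lists S" "length ws = len (wprod ws)"
    and ws': "ws' \<in> lists S" "length ws' = len (wprod ws')"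
    and eq: "wprod ws = wprod ws'"
  shows "foldr Lop ws (delta \<one>) = foldr Lop ws' (delta \<one>)"
proof -
  define X where "X = foldr Lop ws (delta \<one>)"
  have X: "X = foldr Mop (rev ws) (delta \<one>)" using ws by (simp add: X_def foldr_Lop_Mop)
  have supp: "u \<notin> W \<Longrightarrow> X u = 0" for u
    unfolding X_def by (intro foldr_Lop_supp delta_one_supp)
  have rD: "foldr Dop (rev us) X = foldr Mop (rev ws) (delta (inv (wprod us)))"
    if us: "us \<in> lists S" "length us = len (wprod us)" for us
  proof -
    have "foldr Dop (rev us) X = foldr Mop (rev ws) (foldr Dop (rev us) (delta \<one>))"
      unfolding X using us ws by (intro foldr_Dop_Mop) auto
    also have "foldr Dop (rev us) (delta \<one>) = delta (wprod (rev us))"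
      using us by (intro foldr_Dop_delta) (simp_all add: wprod_rev)
    finally show ?thesis using us by (simp add: wprod_rev)
  qed
  have "foldr Dop (rev ws') X = foldr Dop (rev ws) X"
    using rD[OF ws] rD[OF ws'] eq by simp
  also have "\<dots> = (\<lambda>u. qX ^ length ws * delta \<one> u)"
    unfolding X_def by (intro foldr_Dop_Lop ws delta_one_supp)
  finally have "foldr Lop ws' (foldr Dop (rev ws') X)
      = (\<lambda>u. qX ^ length ws * foldr Lop ws' (delta \<one>) u)"
    by (simp add: foldr_Lop_scale)
  moreover have "foldr Lop ws' (foldr Dop (rev ws') X) = (\<lambda>u. qX ^ length ws' * X u)"
    by (intro foldr_Lop_Dop ws' supp)
  ultimately have e: "(\<lambda>u. qX ^ length ws' * X u) = (\<lambda>u. qX ^ length ws * foldr Lop ws' (delta \<one>) u)"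
    by simp
  have "length ws = length ws'" using ws ws' eq by simp
  then have "X u = foldr Lop ws' (delta \<one>) u" for u using fun_cong[OF e, of u] by simp
  then show ?thesis by (simp add: X_def fun_eq_iff)
qed

definition Rcol :: "'a \<Rightarrow> 'a \<Rightarrow> int poly" where
  "Rcol v = foldr Lop (SOME ws. ws \<in> lists S \<and> wprod ws = v \<and> length ws = len v) (delta \<one>)"

abbreviation Rpol :: "'a \<Rightarrow> 'a \<Rightarrow> int poly" where "Rpol u v \<equiv> Rcol v u"

lemma Rcol_word:
  assumes "ws \<in> lists S" "length ws = len (wprod ws)"
  shows "Rcol (wprod ws) = foldr Lop ws (delta \<one>)"
proof -
  let ?P = "\<lambda>us. us \<in> lists S \<and> wprod us = wprod ws \<and> length us = len (wprod ws)"
  have "?P (SOME us. ?P us)" by (rule someI[of _ ws]) (use assms in simp)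
  then show ?thesis unfolding Rcol_def by (intro foldr_Lop_unique) (use assms in auto)
qed

lemma Rcol_one: "Rcol \<one> = delta \<one>"
  using Rcol_word[of "[]"] by simp

lemma Rcol_left:
  assumes "s \<in> S" "v \<in> W" "len v < len (s \<otimes> v)"
  shows "Rcol (s \<otimes> v) = Lop s (Rcol v)"
proof -
  obtain ws where ws: "ws \<in> lists S" "wprod ws = v" "length ws = len v"
    using assms(2) by (rule reduced_word)
  have "len (s \<otimes> v) = Suc (len v)" using len_simple_mult[of s v] assms by auto
  then have "Rcol (wprod (s # ws)) = foldr Lop (s # ws) (delta \<one>)"
    using ws assms by (intro Rcol_word) auto
  moreover have "Rcol (wprod ws) = foldr Lop ws (delta \<one>)" using ws by (intro Rcol_word) auto
  ultimately show ?thesis using ws by simp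
qed

text \<open>Right multiplication by \<open>s \<in> J\<close> moves inside a coset \<open>u W\<^sub>J\<close>, so this recursion relates the
  summands of a coset sum to each other. It rests on the description of the columns by right operators.\<close>

lemma Rcol_right:
  assumes "s \<in> S" "v \<in> W" "len v < len (v \<otimes> s)"
  shows "Rcol (v \<otimes> s) = Mop s (Rcol v)"
proof -
  obtain ws where ws: "ws \<in> lists S" "wprod ws = v" "length ws = len v"
    using assms(2) by (rule reduced_word)
  have app: "wprod (ws @ [s]) = v \<otimes> s" using ws assms by (simp add: wprod_append)
  have "len (v \<otimes> s) = Suc (len v)" using len_mult_simple[of s v] assms by auto
  then have "Rcol (v \<otimes> s) = foldr Lop (ws @ [s]) (delta \<one>)"
    using Rcol_word[of "ws @ [s]"] ws assms app by auto
  also have "\<dots> = foldr Mop (rev (ws @ [s])) (delta \<one>)"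
    using ws assms by (intro foldr_Lop_Mop) auto
  also have "\<dots> = Mop s (foldr Lop ws (delta \<one>))" using ws by (simp add: foldr_Lop_Mop)
  also have "foldr Lop ws (delta \<one>) = Rcol v" using Rcol_word[of ws] ws by auto
  finally show ?thesis .
qed

lemma Rpol_left:
  assumes "s \<in> S" "v \<in> W" "u \<in> W" "len (s \<otimes> v) < len v"
  shows "Rpol u v = (if len (s \<otimes> u) < len u then Rpol (s \<otimes> u) (s \<otimes> v)
    else (qX - 1) * Rpol u (s \<otimes> v) + qX * Rpol (s \<otimes> u) (s \<otimes> v))"
  using Rcol_left[of s "s \<otimes> v"] assms by (simp add: Lop_def)

lemma Rpol_right:
  assumes "s \<in> S" "v \<in> W" "u \<in> W" "len (v \<otimes> s) < len v"
  shows "Rpol u v = (if len (u \<otimes> s) < len u then Rpol (u \<otimes> s) (v \<otimes> s)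
    else (qX - 1) * Rpol u (v \<otimes> s) + qX * Rpol (u \<otimes> s) (v \<otimes> s))"
  using Rcol_right[of s "v \<otimes> s"] assms by (simp add: Mop_def)

lemma Rpol_zero:
  assumes "u \<in> W" "v \<in> W" "\<not> u \<preceq> v"
  shows "Rpol u v = 0"
  using assms
proof (induction "len v" arbitrary: u v rule: less_induct)
  case less
  note u = less.prems(1) and v = less.prems(2)
  show ?case
  proof (cases "v = \<one>")
    case True
    then show ?thesis using less.prems by (auto simp: Rcol_one delta_def)
  next
    case False
    then obtain s where s: "s \<in> S" "len (s \<otimes> v) < len v" using left_descent_exists v by blast
    have svv: "s \<otimes> v \<preceq> v" using simple_down s v by simp
    have su: "\<not> s \<otimes> u \<preceq> s \<otimes> v"
    proof
      assume "s \<otimes> u \<preceq> s \<otimes> v"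
      then have "s \<otimes> (s \<otimes> u) \<preceq> v" using lifting_mult_ble[of s v "s \<otimes> u"] s v svv ble_trans by blast
      then show False using less.prems s by simp
    qed
    have "\<not> u \<preceq> s \<otimes> v" using svv ble_trans less.prems by blast
    then show ?thesis
      using su less.hyps[OF s(2)] s u v by (simp add: Rpol_left[OF s(1) v u s(2)])
  qed
qed

text \<open>The leading term comes from \<open>(q - 1) R\<^bsub>u,sv\<^esub>\<close>; the degree recovers the length difference from
  the polynomial.\<close>

lemma Rpol_degree:
  assumes "v \<in> W" "u \<preceq> v"
  shows "degree (Rpol u v) = len v - len u \<and> lead_coeff (Rpol u v) = 1"
  using assms
proof (induction "len v" arbitrary: u v rule: less_induct)
  case less
  note v = less.prems(1)
  have u: "u \<in> W" using ble_carrier less.prems by blast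
  show ?case
  proof (cases "v = \<one>")
    case True
    then have "u = \<one>" using less.prems ble_len by fastforce
    then show ?thesis using True by (auto simp: Rcol_one delta_def)
  next
    case False
    then obtain s where s: "s \<in> S" "len (s \<otimes> v) < len v" using left_descent_exists v by blast
    have lv: "len v = Suc (len (s \<otimes> v))" using len_simple_mult[of s v] s v by auto
    have svc: "s \<otimes> v \<in> W" using s v by simp
    show ?thesis
    proof (cases "len (s \<otimes> u) < len u")
      case True
      then have lu: "len u = Suc (len (s \<otimes> u))" using len_simple_mult[of s u] s u by auto
      have "s \<otimes> u \<preceq> s \<otimes> v" using lifting_down less.prems s True by simp
      from less.hyps[OF s(2) svc this]
      have "degree (Rpol (s \<otimes> u) (s \<otimes> v)) = len v - len u" "lead_coeff (Rpol (s \<otimes> u) (s \<otimes> v)) = 1"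
        using lu lv by (simp, blast)
      then show ?thesis using True by (simp add: Rpol_left[OF s(1) v u s(2)])
    next
      case False
      then have lu: "len (s \<otimes> u) = Suc (len u)" using len_simple_mult[of s u] s u by auto
      have uv: "u \<preceq> s \<otimes> v" using lifting_up less.prems s lu by simp
      let ?p = "Rpol u (s \<otimes> v)" and ?r = "Rpol (s \<otimes> u) (s \<otimes> v)"
      have p: "degree ?p = len (s \<otimes> v) - len u" "lead_coeff ?p = 1"
        using less.hyps[OF s(2) svc uv] by auto
      have p0: "?p \<noteq> 0" using p by auto
      have q1: "qX - 1 = [:-1, 1:]" by (simp add: one_pCons)
      have dq: "degree ((qX - 1) * ?p) = len v - len u"
        using p p0 lv ble_len_le[OF uv] unfolding q1 by (simp add: degree_mult_eq Suc_diff_le)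
      have lq: "lead_coeff ((qX - 1) * ?p) = 1"
        unfolding q1 lead_coeff_mult p(2) by simp
      have dr: "degree (qX * ?r) < len v - len u"
      proof (cases "s \<otimes> u \<preceq> s \<otimes> v")
        case True
        have "degree ?r = len (s \<otimes> v) - len (s \<otimes> u)" using less.hyps[OF s(2) svc True] by simp
        then have "degree (qX * ?r) \<le> Suc (len (s \<otimes> v) - len (s \<otimes> u))"
          using degree_mult_le[of qX ?r] by simp
        then show ?thesis using ble_len_le[OF True] lu lv by linarith
      next
        case False
        then have "?r = 0" using Rpol_zero s u v by simp
        then show ?thesis using ble_len_le[OF uv] lv by simp
      qed
      have e: "Rpol u v = (qX - 1) * ?p + qX * ?r"
        using False by (simp add: Rpol_left[OF s(1) v u s(2)])
      have "degree (Rpol u v) = len v - len u" using dq dr unfolding e by (simp add: degree_add_eq_left)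
      moreover have "coeff (qX * ?r) (len v - len u) = 0" using dr by (rule coeff_eq_0)
      ultimately show ?thesis using dq lq unfolding e by simp
    qed
  qed
qed

lemma Rpol_self: "v \<in> W \<Longrightarrow> Rpol v v = 1"
proof -
  assume v: "v \<in> W"
  have "degree (Rpol v v) = 0" "lead_coeff (Rpol v v) = 1" using Rpol_degree[OF v, of v] by auto
  then show ?thesis by (metis degree_0_id one_pCons)
qed

definition eps :: "'a \<Rightarrow> int poly" where "eps w = (-1) ^ len w"

lemma eps_simple: "s \<in> S \<Longrightarrow> w \<in> W \<Longrightarrow> eps (s \<otimes> w) = - eps w"
  using len_simple_mult[of s w] by (auto simp: eps_def)

lemma eps_square [simp]: "eps w * eps w = 1"
  by (simp add: eps_def flip: power_add power_mult_distrib)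

lemma eps_square' [simp]: "eps w * (eps w * p) = p"
  by (simp flip: mult.assoc)

abbreviation flip_len :: "'a \<Rightarrow> 'a \<Rightarrow> int poly \<Rightarrow> int poly fract" where
  "flip_len u v \<equiv> q_flip (int (len v) - int (len u))"

lemma Rpol_flip:
  assumes "u \<in> W" "v \<in> W"
  shows "flip_len u v (Rpol u v) = to_fract (eps u * eps v * Rpol u v)"
  using assms
proof (induction "len v" arbitrary: u v rule: less_induct)
  case less
  note u = less.prems(1) and v = less.prems(2)
  show ?case
  proof (cases "v = \<one>")
    case True
    then show ?thesis by (cases "u = \<one>") (auto simp: Rcol_one delta_def eps_def)
  next
    case False
    then obtain s where s: "s \<in> S" "len (s \<otimes> v) < len v" using left_descent_exists v by blast
    have lv: "len v = Suc (len (s \<otimes> v))" using len_simple_mult[of s v] s v by auto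
    have c: "s \<otimes> v \<in> W" "s \<otimes> u \<in> W" using s u v by auto
    have es: "eps (s \<otimes> u) = - eps u" "eps (s \<otimes> v) = - eps v" using eps_simple s u v by auto
    show ?thesis
    proof (cases "len (s \<otimes> u) < len u")
      case True
      then have lu: "len u = Suc (len (s \<otimes> u))" using len_simple_mult[of s u] s u by auto
      show ?thesis using less.hyps[OF s(2) c(2) c(1)] True lu lv es
        by (simp add: Rpol_left[OF s(1) v u s(2)])
    next
      case False
      then have lu: "len (s \<otimes> u) = Suc (len u)" using len_simple_mult[of s u] s u by auto
      let ?p = "Rpol u (s \<otimes> v)" and ?r = "Rpol (s \<otimes> u) (s \<otimes> v)"
      have 1: "flip_len u v ((qX - 1) * ?p)
          = q_flip 1 (qX - 1) * flip_len u (s \<otimes> v) ?p"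
        using lv by (simp flip: q_flip_mult add: algebra_simps)
      have 2: "flip_len u v (qX * ?r)
          = q_flip 2 qX * flip_len (s \<otimes> u) (s \<otimes> v) ?r"
        using lv lu by (simp flip: q_flip_mult add: algebra_simps)
      have 3: "q_flip 1 (qX - 1) = to_fract (1 - qX)"
        using q_flip_mult[of 1 0 1 1]
        by (simp add: q_flip_diff q_flip_qX) (simp add: q_flip_inv_eval)
      have 4: "q_flip 2 qX = to_fract qX"
        by (simp add: q_flip_inv_eval inv_eval_qX power_int_def power2_eq_square)
      have "flip_len u v (Rpol u v)
          = flip_len u v ((qX - 1) * ?p) + flip_len u v (qX * ?r)"
        using False by (simp only: Rpol_left[OF s(1) v u s(2)] if_False q_flip_add)
      also have "\<dots> = to_fract (1 - qX) * to_fract (eps u * eps (s \<otimes> v) * ?p)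
          + to_fract qX * to_fract (eps (s \<otimes> u) * eps (s \<otimes> v) * ?r)"
        by (simp only: 1 2 3 4 less.hyps[OF s(2) u c(1)] less.hyps[OF s(2) c(2) c(1)])
      also have "\<dots> = to_fract ((1 - qX) * (eps u * eps (s \<otimes> v) * ?p) + qX * (eps (s \<otimes> u) * eps (s \<otimes> v) * ?r))"
        by (simp only: to_fract_mult to_fract_add)
      also have "(1 - qX) * (eps u * eps (s \<otimes> v) * ?p) + qX * (eps (s \<otimes> u) * eps (s \<otimes> v) * ?r)
          = eps u * eps v * Rpol u v"
        using False by (simp add: Rpol_left[OF s(1) v u s(2)] es algebra_simps)
      finally show ?thesis .
    qed
  qed
qed

text \<open>The Kazhdan--Lusztig involution squares to the identity, in coordinates. The pairing \<open>y \<leftrightarrow> s y\<close>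
  for a left descent \<open>s\<close> of \<open>v\<close> expresses the sum for \<open>(u, v)\<close> by the sums \<open>K\<close> for \<open>(u, s v)\<close> and \<open>(s u, s v)\<close>.\<close>

lemma Rpol_kernel:
  assumes "u \<in> W" "v \<in> W"
  shows "(\<Sum>y\<in>{y. y \<preceq> v}. eps y * Rpol u y * Rpol y v) = (if u = v then eps v else 0)"
  using assms
proof (induction "len v" arbitrary: u v rule: less_induct)
  case less
  note u = less.prems(1) and v = less.prems(2)
  show ?case
  proof (cases "v = \<one>")
    case True
    have "{y. y \<preceq> \<one>} = {\<one>}" using ble_len by fastforce
    then show ?thesis using True by (auto simp: Rcol_one delta_def)
  next
    case False
    then obtain s where s: "s \<in> S" "len (s \<otimes> v) < len v" using left_descent_exists v by blast
    have lv: "len v = Suc (len (s \<otimes> v))" using len_simple_mult[of s v] s v by auto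
    have c: "s \<otimes> v \<in> W" "s \<otimes> u \<in> W" using s u v by auto
    define Y where "Y = {y. y \<preceq> v}"
    have Yc: "y \<in> W" if "y \<in> Y" for y using that v ble_carrier by (auto simp: Y_def)
    have fin: "finite Y" using finite_below v by (simp add: Y_def)
    have Ys: "s \<otimes> y \<in> Y" if "y \<in> Y" for y
      using that lifting_mult_ble[of s v y] s v by (simp add: Y_def)
    have svv: "s \<otimes> v \<preceq> v" using simple_down s v by simp
    \<comment> \<open>the sum for \<open>(x, s v)\<close>, taken over the \<open>s\<close>-stable index set \<open>Y\<close>\<close>
    define K where "K x = (\<Sum>y\<in>Y. eps y * Rpol x y * Rpol y (s \<otimes> v))" for x
    have K: "K x = (if x = s \<otimes> v then eps (s \<otimes> v) else 0)" if "x \<in> W" for x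
    proof -
      have "K x = (\<Sum>y\<in>{y. y \<preceq> s \<otimes> v}. eps y * Rpol x y * Rpol y (s \<otimes> v))"
        unfolding K_def
      proof (rule sum.mono_neutral_right[OF fin])
        show "{y. y \<preceq> s \<otimes> v} \<subseteq> Y" using svv ble_trans by (auto simp: Y_def)
        show "\<forall>y\<in>Y - {y. y \<preceq> s \<otimes> v}. eps y * Rpol x y * Rpol y (s \<otimes> v) = 0"
          using Rpol_zero Yc c by simp
      qed
      then show ?thesis using less.hyps[OF s(2) that c(1)] by simp
    qed
    let ?P = "\<lambda>y. len y < len (s \<otimes> y)"
    have flip: "?P (s \<otimes> y) \<longleftrightarrow> \<not> ?P y" if "y \<in> Y" for y
      using len_simple_mult[of s y] s Yc[OF that] by auto
    have rec: "Rpol y v = (qX - 1) * Rpol y (s \<otimes> v) + qX * Rpol (s \<otimes> y) (s \<otimes> v)"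
      "Rpol (s \<otimes> y) v = Rpol y (s \<otimes> v)" "eps (s \<otimes> y) = - eps y"
      "Rpol u (s \<otimes> y) = (if len (s \<otimes> u) < len u then Rpol (s \<otimes> u) y
         else (qX - 1) * Rpol u y + qX * Rpol (s \<otimes> u) y)"
      "Rpol (s \<otimes> u) (s \<otimes> y) = (if len (s \<otimes> u) < len u then (qX - 1) * Rpol (s \<otimes> u) y + qX * Rpol u y
         else Rpol u y)"
      if "y \<in> Y" "?P y" for y
      using Rpol_left[OF s(1) v Yc[OF that(1)] s(2)] Rpol_left[OF s(1) v _ s(2), of "s \<otimes> y"]
        Rpol_left[OF s(1) _ u, of "s \<otimes> y"] Rpol_left[OF s(1) _ c(2), of "s \<otimes> y"]
        len_simple_mult[of s u] eps_simple[of s y] s Yc[OF that(1)] that u by (auto split: if_splits)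
    have inv: "s \<otimes> (s \<otimes> y) = y" if "y \<in> Y" for y using s Yc[OF that] by simp
    have vu: "s \<otimes> u = s \<otimes> v \<longleftrightarrow> u = v" using s u v by simp
    show ?thesis
    proof (cases "len (s \<otimes> u) < len u")
      case True
      have "(\<Sum>y\<in>Y. eps y * Rpol u y * Rpol y v)
        = 1 * (\<Sum>y\<in>Y. (qX - 1) * (eps y * Rpol u y * Rpol y (s \<otimes> v)) - eps y * Rpol (s \<otimes> u) y * Rpol y (s \<otimes> v))"
        using fin Ys inv flip
      proof (rule sum_over_pairs[where i = "\<lambda>y. s \<otimes> y" and P = ?P])
        fix y assume y: "y \<in> Y" "?P y"
        show "eps y * Rpol u y * Rpol y v + eps (s \<otimes> y) * Rpol u (s \<otimes> y) * Rpol (s \<otimes> y) v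
          = 1 * ((qX - 1) * (eps y * Rpol u y * Rpol y (s \<otimes> v)) - eps y * Rpol (s \<otimes> u) y * Rpol y (s \<otimes> v)
          + ((qX - 1) * (eps (s \<otimes> y) * Rpol u (s \<otimes> y) * Rpol (s \<otimes> y) (s \<otimes> v))
             - eps (s \<otimes> y) * Rpol (s \<otimes> u) (s \<otimes> y) * Rpol (s \<otimes> y) (s \<otimes> v)))"
          unfolding rec[OF y] using True by (simp only: if_True) algebra
      qed
      also have "\<dots> = (qX - 1) * K u - K (s \<otimes> u)"
        by (simp add: K_def sum_subtractf sum_distrib_left)
      also have "\<dots> = (if u = v then eps v else 0)"
      proof -
        have "u \<noteq> s \<otimes> v" using True s v by auto
        then show ?thesis using K u c vu eps_simple s v by simp
      qed
      finally show ?thesis by (simp add: Y_def)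
    next
      case False
      have "(\<Sum>y\<in>Y. eps y * Rpol u y * Rpol y v)
        = - qX * (\<Sum>y\<in>Y. eps y * Rpol (s \<otimes> u) y * Rpol y (s \<otimes> v))"
        using fin Ys inv flip
      proof (rule sum_over_pairs[where i = "\<lambda>y. s \<otimes> y" and P = ?P])
        fix y assume y: "y \<in> Y" "?P y"
        show "eps y * Rpol u y * Rpol y v + eps (s \<otimes> y) * Rpol u (s \<otimes> y) * Rpol (s \<otimes> y) v
          = - qX * (eps y * Rpol (s \<otimes> u) y * Rpol y (s \<otimes> v)
             + eps (s \<otimes> y) * Rpol (s \<otimes> u) (s \<otimes> y) * Rpol (s \<otimes> y) (s \<otimes> v))"
          unfolding rec[OF y] using False by (simp only: if_False) algebra
      qed
      also have "\<dots> = - qX * K (s \<otimes> u)" by (simp add: K_def)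
      also have "\<dots> = (if u = v then eps v else 0)"
      proof -
        have "u \<noteq> v" using False s by auto
        then show ?thesis using K c vu by simp
      qed
      finally show ?thesis by (simp add: Y_def)
    qed
  qed
qed

end

section \<open>Parabolic R-polynomials\<close>

text \<open>The hypothesis holds for \<open>x = -1\<close> and \<open>x = q\<close>, the two roots of \<open>x\<^sup>2 = (q - 1) x + q\<close>; the
  other root is \<open>q - 1 - x\<close>. The identity says that a signed coset sum is an eigenvector of the
  pairing along a simple reflection that preserves the coset.\<close>

lemma pair_identity:
  fixes x q p A B :: "'r :: comm_ring_1"
  assumes "x * x = (q - 1) * x + q"
  shows "p * ((q - 1) * A + q * B) + (- x * p) * A = (q - 1 - x) * (p * A + (- x * p) * B)"
proof -
  have "(q - 1 - x) * (p * A + (- x * p) * B) = (q - 1 - x) * (p * A) + (x * x - (q - 1) * x) * (p * B)"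
    by (simp add: algebra_simps)
  also have "x * x - (q - 1) * x = q" using assms by simp
  finally show ?thesis by (simp add: algebra_simps)
qed

context parabolic
begin

definition coset_below :: "'a \<Rightarrow> 'a \<Rightarrow> 'a set" where
  "coset_below u v = {y. (\<exists>z\<in>WJ. y = u \<otimes> z) \<and> y \<preceq> v}"

lemma coset_below_closed: "u \<in> MR \<Longrightarrow> y \<in> coset_below u v \<Longrightarrow> y \<in> W"
  by (auto simp: coset_below_def)

lemma finite_coset_below: "v \<in> W \<Longrightarrow> finite (coset_below u v)"
  by (rule finite_subset[OF _ finite_below[of v]]) (auto simp: coset_below_def)

lemma coset_below_len: "u \<in> MR \<Longrightarrow> y \<in> coset_below u v \<Longrightarrow> len u \<le> len y"
  by (auto simp: coset_below_def len_MR_mult)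

lemma coset_below_ble: "u \<in> MR \<Longrightarrow> y \<in> coset_below u v \<Longrightarrow> u \<preceq> y"
  by (auto simp: coset_below_def MR_ble_mult)

text \<open>Deodhar's sum. For arbitrary \<open>v\<close> it depends on \<open>v\<close> only through the coset representative,
  up to a scalar (\<open>coset_sum_project\<close>); for \<open>v \<in> W\<^sup>J\<close> it is the parabolic R-polynomial (\<open>par_R_eq\<close>).\<close>

definition coset_sum :: "int poly \<Rightarrow> 'a \<Rightarrow> 'a \<Rightarrow> int poly" where
  "coset_sum x u v = (\<Sum>y\<in>coset_below u v. (- x) ^ (len y - len u) * Rpol y v)"

definition RJ :: "int poly \<Rightarrow> 'a \<Rightarrow> 'a \<Rightarrow> int poly" where
  "RJ x u v = (if u \<in> MR \<and> v \<in> MR then coset_sum x u v else 0)"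

text \<open>As \<open>R\<^bsub>y,v\<^esub>\<close> vanishes unless \<open>y \<preceq> v\<close>, the index set may be enlarged inside the coset; this makes
  the sums for different \<open>v\<close> comparable.\<close>

lemma coset_sum_superset:
  assumes "u \<in> MR" "v \<in> W" "finite A" "coset_below u v \<subseteq> A" "\<And>y. y \<in> A \<Longrightarrow> \<exists>z\<in>WJ. y = u \<otimes> z"
  shows "coset_sum x u v = (\<Sum>y\<in>A. (- x) ^ (len y - len u) * Rpol y v)"
  unfolding coset_sum_def
proof (rule sum.mono_neutral_left[OF assms(3,4)], rule ballI)
  fix y assume y: "y \<in> A - coset_below u v"
  then obtain z where "z \<in> WJ" "y = u \<otimes> z" using assms(5) by blast
  with y have "\<not> y \<preceq> v" "y \<in> W" using assms(1) by (auto simp: coset_below_def)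
  then show "(- x) ^ (len y - len u) * Rpol y v = 0" using Rpol_zero assms by simp
qed

lemma coset_below_mono: "v \<preceq> w \<Longrightarrow> coset_below u v \<subseteq> coset_below u w"
  using ble_trans by (auto simp: coset_below_def)

text \<open>Common core of two situations in which a simple reflection preserves \<open>u W\<^sub>J\<close>: right
  multiplication by \<open>s \<in> J\<close>, and left multiplication by \<open>s\<close> with \<open>s u = u t\<close>, \<open>t \<in> J\<close>.\<close>

lemma coset_sum_involution:
  assumes x: "x * x = (qX - 1) * x + qX"
    and u: "u \<in> MR" and v: "v \<in> W" and v': "v' \<preceq> v"
    and i: "\<And>y. y \<in> coset_below u v \<Longrightarrow> i y \<in> coset_below u v"
      "\<And>y. y \<in> coset_below u v \<Longrightarrow> i (i y) = y"
      "\<And>y. y \<in> coset_below u v \<Longrightarrow> len (i y) = Suc (len y) \<or> len y = Suc (len (i y))"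
    and R: "\<And>y. y \<in> coset_below u v \<Longrightarrow> len y < len (i y) \<Longrightarrow>
        Rpol y v = (qX - 1) * Rpol y v' + qX * Rpol (i y) v'"
      "\<And>y. y \<in> coset_below u v \<Longrightarrow> len y < len (i y) \<Longrightarrow> Rpol (i y) v = Rpol y v'"
  shows "coset_sum x u v = (qX - 1 - x) * coset_sum x u v'"
proof -
  let ?A = "coset_below u v"
  have fin: "finite ?A" using v by (rule finite_coset_below)
  have "(\<Sum>y\<in>?A. (- x) ^ (len y - len u) * Rpol y v)
    = (qX - 1 - x) * (\<Sum>y\<in>?A. (- x) ^ (len y - len u) * Rpol y v')"
  proof (rule sum_over_pairs[OF fin, where i = i and P = "\<lambda>y. len y < len (i y)"])
    fix y assume y: "y \<in> ?A"
    show "i y \<in> ?A" "i (i y) = y" using i y by auto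
    show "len (i y) < len (i (i y)) \<longleftrightarrow> \<not> len y < len (i y)" using i(2,3)[OF y] by auto
    assume up: "len y < len (i y)"
    then have k: "len (i y) - len u = Suc (len y - len u)"
      using i(3)[OF y] coset_below_len[OF u y] by linarith
    show "(- x) ^ (len y - len u) * Rpol y v + (- x) ^ (len (i y) - len u) * Rpol (i y) v
      = (qX - 1 - x) * ((- x) ^ (len y - len u) * Rpol y v' + (- x) ^ (len (i y) - len u) * Rpol (i y) v')"
      unfolding R[OF y up] k power_Suc by (rule pair_identity[OF x])
  qed
  moreover have "coset_sum x u v' = (\<Sum>y\<in>?A. (- x) ^ (len y - len u) * Rpol y v')"
  proof (rule coset_sum_superset[OF u _ fin coset_below_mono[OF v']])
    show "v' \<in> W" using v' v ble_carrier by blast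
  qed (auto simp: coset_below_def)
  ultimately show ?thesis by (simp add: coset_sum_def)
qed

lemma coset_sum_right:
  assumes x: "x * x = (qX - 1) * x + qX"
    and u: "u \<in> MR" and v: "v \<in> W" and s: "s \<in> J" and less: "len (v \<otimes> s) < len v"
  shows "coset_sum x u v = (qX - 1 - x) * coset_sum x u (v \<otimes> s)"
proof (rule coset_sum_involution[OF x u v, where i = "\<lambda>y. y \<otimes> s"])
  have sS: "s \<in> S" using s by simp
  show "v \<otimes> s \<preceq> v" using right_mult_ble sS v less ble_refl by simp
  fix y assume y: "y \<in> coset_below u v"
  then obtain z where z: "z \<in> WJ" "y = u \<otimes> z" "y \<preceq> v" by (auto simp: coset_below_def)
  have yc: "y \<in> W" using coset_below_closed u y by blast
  have "y \<otimes> s \<preceq> v" using right_mult_ble sS v z less by blast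
  moreover have "y \<otimes> s = u \<otimes> (z \<otimes> s)" using u z s by (simp add: m_assoc)
  ultimately show "y \<otimes> s \<in> coset_below u v" using z s by (auto simp: coset_below_def WJ_mult)
  show "y \<otimes> s \<otimes> s = y" using yc s by simp
  show "len (y \<otimes> s) = Suc (len y) \<or> len y = Suc (len (y \<otimes> s))" using yc sS by (intro len_mult_simple)
  assume up: "len y < len (y \<otimes> s)"
  show "Rpol y v = (qX - 1) * Rpol y (v \<otimes> s) + qX * Rpol (y \<otimes> s) (v \<otimes> s)"
    "Rpol (y \<otimes> s) v = Rpol y (v \<otimes> s)"
    using Rpol_right[OF sS v yc less] Rpol_right[OF sS v _ less, of "y \<otimes> s"] up yc s by auto
qed

lemma coset_sum_project:
  assumes x: "x * x = (qX - 1) * x + qX" and u: "u \<in> MR" and w: "w \<in> MR" and z: "z \<in> WJ"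
  shows "coset_sum x u (w \<otimes> z) = (qX - 1 - x) ^ len z * coset_sum x u w"
  using z
proof (induction rule: WJ_induct)
  case one
  then show ?case using w by simp
next
  case (mult z s)
  have c: "w \<in> W" "z \<in> W" "s \<in> S" using w mult by auto
  have e: "w \<otimes> (z \<otimes> s) \<otimes> s = w \<otimes> z" using c by (simp add: m_assoc)
  have "len (w \<otimes> z) < len (w \<otimes> (z \<otimes> s))"
    using len_MR_mult[OF w] mult by (simp add: WJ_mult)
  then have "coset_sum x u (w \<otimes> (z \<otimes> s)) = (qX - 1 - x) * coset_sum x u (w \<otimes> (z \<otimes> s) \<otimes> s)"
    using c mult e by (intro coset_sum_right[OF x u]) auto
  then show ?case using mult e by (simp add: mult.assoc)
qed

lemma left_coset_len:
  assumes "u \<in> MR" "s \<otimes> u \<in> MR" "s \<in> S" "z \<in> WJ"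
  shows "len (s \<otimes> (u \<otimes> z)) + len u = len (u \<otimes> z) + len (s \<otimes> u)"
  using assms len_MR_mult[of "s \<otimes> u" z] len_MR_mult[of u z] by (simp add: m_assoc)

text \<open>Left multiplication by \<open>s\<close> as a bijection from \<open>u W\<^sub>J\<close> to \<open>s u W\<^sub>J\<close>.\<close>

lemma coset_sum_shift:
  assumes u: "u \<in> MR" and su: "s \<otimes> u \<in> MR" and s: "s \<in> S" and v: "v \<in> W"
    and less: "len (s \<otimes> v) < len v"
  shows "(\<Sum>y\<in>coset_below u v. (- x) ^ (len y - len u) * Rpol (s \<otimes> y) (s \<otimes> v)) = coset_sum x (s \<otimes> u) (s \<otimes> v)"
proof -
  let ?A = "coset_below u v"
  let ?B = "(\<lambda>y. s \<otimes> y) ` ?A"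
  have fin: "finite ?A" using v by (rule finite_coset_below)
  have Ac: "y \<in> W" if "y \<in> ?A" for y using coset_below_closed u that by blast
  have inj: "inj_on (\<lambda>y. s \<otimes> y) ?A" using Ac s by (intro inj_onI) (metis simple_cancel)
  have svv: "s \<otimes> v \<preceq> v" using simple_down s v less by simp
  have "coset_sum x (s \<otimes> u) (s \<otimes> v) = (\<Sum>y\<in>?B. (- x) ^ (len y - len (s \<otimes> u)) * Rpol y (s \<otimes> v))"
  proof (rule coset_sum_superset[OF su])
    show "coset_below (s \<otimes> u) (s \<otimes> v) \<subseteq> ?B"
    proof
      fix y assume "y \<in> coset_below (s \<otimes> u) (s \<otimes> v)"
      then obtain z where z: "z \<in> WJ" "y = s \<otimes> u \<otimes> z" "y \<preceq> s \<otimes> v" by (auto simp: coset_below_def)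
      then have sy: "s \<otimes> y = u \<otimes> z" "y = s \<otimes> (s \<otimes> y)" using u s by (simp_all add: m_assoc)
      have "s \<otimes> y \<preceq> v" using lifting_mult_ble[of s v y] s v less z svv ble_trans by blast
      then have "s \<otimes> y \<in> ?A" using sy z by (auto simp: coset_below_def)
      then show "y \<in> ?B" using sy by blast
    qed
    show "\<exists>z\<in>WJ. y = s \<otimes> u \<otimes> z" if "y \<in> ?B" for y
    proof -
      obtain z where "z \<in> WJ" "y = s \<otimes> (u \<otimes> z)" using \<open>y \<in> ?B\<close> by (auto simp: coset_below_def)
      then show ?thesis using s u by (intro bexI[of _ z]) (simp_all add: m_assoc)
    qed
  qed (use fin s v in auto)
  also have "\<dots> = (\<Sum>y\<in>?A. (- x) ^ (len (s \<otimes> y) - len (s \<otimes> u)) * Rpol (s \<otimes> y) (s \<otimes> v))"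
    by (rule sum.reindex[OF inj, unfolded comp_def])
  also have "\<dots> = (\<Sum>y\<in>?A. (- x) ^ (len y - len u) * Rpol (s \<otimes> y) (s \<otimes> v))"
  proof (rule sum.cong[OF HOL.refl])
    fix y assume y: "y \<in> ?A"
    then obtain z where "z \<in> WJ" "y = u \<otimes> z" by (auto simp: coset_below_def)
    then have "len (s \<otimes> y) + len u = len y + len (s \<otimes> u)" using left_coset_len u su s by simp
    then have "len (s \<otimes> y) - len (s \<otimes> u) = len y - len u"
      using coset_below_len[OF u y] by linarith
    then show "(- x) ^ (len (s \<otimes> y) - len (s \<otimes> u)) * Rpol (s \<otimes> y) (s \<otimes> v)
      = (- x) ^ (len y - len u) * Rpol (s \<otimes> y) (s \<otimes> v)" by simp
  qed
  finally show ?thesis by simp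
qed

lemma coset_sum_left:
  assumes u: "u \<in> MR" and s: "s \<in> S" and v: "v \<in> W"
    and less: "len (s \<otimes> v) < len v" and su: "s \<otimes> u \<in> MR"
  shows "coset_sum x u v = (if len (s \<otimes> u) < len u then coset_sum x (s \<otimes> u) (s \<otimes> v)
    else (qX - 1) * coset_sum x u (s \<otimes> v) + qX * coset_sum x (s \<otimes> u) (s \<otimes> v))"
proof -
  let ?A = "coset_below u v" and ?w = "\<lambda>y. (- x) ^ (len y - len u)"
  have svv: "s \<otimes> v \<preceq> v" using simple_down s v less by simp
  have 1: "(\<Sum>y\<in>?A. ?w y * Rpol (s \<otimes> y) (s \<otimes> v)) = coset_sum x (s \<otimes> u) (s \<otimes> v)"
    by (rule coset_sum_shift[OF u su s v less])
  have 2: "(\<Sum>y\<in>?A. ?w y * Rpol y (s \<otimes> v)) = coset_sum x u (s \<otimes> v)"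
    using u s v finite_coset_below[OF v] coset_below_mono[OF svv]
    by (intro coset_sum_superset[symmetric]) (auto simp: coset_below_def)
  have R: "Rpol y v = (if len (s \<otimes> u) < len u then Rpol (s \<otimes> y) (s \<otimes> v)
      else (qX - 1) * Rpol y (s \<otimes> v) + qX * Rpol (s \<otimes> y) (s \<otimes> v))" if y: "y \<in> ?A" for y
  proof -
    obtain z where "z \<in> WJ" "y = u \<otimes> z" using y by (auto simp: coset_below_def)
    then have "len (s \<otimes> y) + len u = len y + len (s \<otimes> u)" using left_coset_len u su s by simp
    then have "len (s \<otimes> y) < len y \<longleftrightarrow> len (s \<otimes> u) < len u" by linarith
    then show ?thesis using Rpol_left[OF s v coset_below_closed[OF u y] less] by simp
  qed
  have "coset_sum x u v = (\<Sum>y\<in>?A. ?w y * (if len (s \<otimes> u) < len u then Rpol (s \<otimes> y) (s \<otimes> v)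
      else (qX - 1) * Rpol y (s \<otimes> v) + qX * Rpol (s \<otimes> y) (s \<otimes> v)))"
    unfolding coset_sum_def by (rule sum.cong) (simp_all only: R)
  also have "\<dots> = (if len (s \<otimes> u) < len u then coset_sum x (s \<otimes> u) (s \<otimes> v)
    else (qX - 1) * coset_sum x u (s \<otimes> v) + qX * coset_sum x (s \<otimes> u) (s \<otimes> v))"
    unfolding 1[symmetric] 2[symmetric]
    by (simp add: distrib_left sum.distrib sum_distrib_left mult.left_commute)
  finally show ?thesis .
qed

lemma coset_sum_left_singular:
  assumes x: "x * x = (qX - 1) * x + qX"
    and u: "u \<in> MR" and s: "s \<in> S" and v: "v \<in> W"
    and less: "len (s \<otimes> v) < len v" and su: "s \<otimes> u \<notin> MR"
  shows "coset_sum x u v = (qX - 1 - x) * coset_sum x u (s \<otimes> v)"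
proof -
  obtain t where t: "t \<in> J" "s \<otimes> u = u \<otimes> t" using deodhar u s su by blast
  show ?thesis
  proof (rule coset_sum_involution[OF x u v, where i = "\<lambda>y. s \<otimes> y"])
    show "s \<otimes> v \<preceq> v" using simple_down s v less by simp
    fix y assume y: "y \<in> coset_below u v"
    then obtain z where z: "z \<in> WJ" "y = u \<otimes> z" "y \<preceq> v" by (auto simp: coset_below_def)
    have yc: "y \<in> W" using coset_below_closed u y by blast
    have "s \<otimes> y = (s \<otimes> u) \<otimes> z" using u z s by (simp add: m_assoc)
    also have "\<dots> = u \<otimes> (t \<otimes> z)" unfolding t(2) using u z t(1) by (simp add: m_assoc)
    finally have "s \<otimes> y = u \<otimes> (t \<otimes> z)" .
    moreover have "s \<otimes> y \<preceq> v" using lifting_mult_ble s v z less by blast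
    ultimately show "s \<otimes> y \<in> coset_below u v" using z t by (auto simp: coset_below_def WJ_mult)
    show "s \<otimes> (s \<otimes> y) = y" using yc s by simp
    show "len (s \<otimes> y) = Suc (len y) \<or> len y = Suc (len (s \<otimes> y))" using yc s by (intro len_simple_mult)
    assume up: "len y < len (s \<otimes> y)"
    show "Rpol y v = (qX - 1) * Rpol y (s \<otimes> v) + qX * Rpol (s \<otimes> y) (s \<otimes> v)"
      "Rpol (s \<otimes> y) v = Rpol y (s \<otimes> v)"
      using Rpol_left[OF s v yc less] Rpol_left[OF s v _ less, of "s \<otimes> y"] up yc s by auto
  qed
qed

lemma coset_below_self: "v \<in> MR \<Longrightarrow> coset_below v v = {v}"
proof -
  assume v: "v \<in> MR"
  have "y = v" if y: "y \<in> coset_below v v" for y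
  proof -
    have "v \<preceq> y" "y \<preceq> v" using coset_below_ble[OF v y] y by (auto simp: coset_below_def)
    then show ?thesis using ble_antisym by blast
  qed
  moreover have "v \<in> coset_below v v"
    using v by (auto simp: coset_below_def intro!: bexI[of _ \<one>] generate.one)
  ultimately show ?thesis by blast
qed

lemma RJ_self: "v \<in> MR \<Longrightarrow> RJ x v v = 1"
  by (simp add: RJ_def coset_sum_def coset_below_self Rpol_self)

lemma RJ_zero: "\<not> u \<preceq> v \<Longrightarrow> RJ x u v = 0"
proof -
  assume n: "\<not> u \<preceq> v"
  have "coset_below u v = {}" if u: "u \<in> MR"
  proof -
    have "y \<notin> coset_below u v" for y
      using n coset_below_ble[OF u, of y v] ble_trans[of u y v] by (auto simp: coset_below_def)
    then show ?thesis by blast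
  qed
  then show ?thesis by (simp add: RJ_def coset_sum_def)
qed

text \<open>The three cases of the recursion: left multiplication by \<open>s\<close> maps \<open>u W\<^sub>J\<close> onto a coset of shorter
  or of longer elements, or onto itself.\<close>

lemma is_par_R_family_RJ:
  assumes x: "x * x = (qX - 1) * x + qX"
  shows "is_par_R_family G S J x (RJ x)"
  unfolding is_par_R_family_def
proof (intro conjI ballI impI)
  show "supported_on MR (RJ x)" by (auto simp: supported_on_def RJ_def)
next
  fix u v s assume u: "u \<in> MR" and v: "v \<in> MR" and s: "s \<in> S" and less: "len (s \<otimes> v) < len v"
  have svM: "s \<otimes> v \<in> MR" using MR_simple_down v s less by simp
  show "RJ x u v = RJ x (s \<otimes> u) (s \<otimes> v)" if "len (s \<otimes> u) < len u"
    using coset_sum_left[OF u s _ less, of x] MR_simple_down[OF u s that] that u v svM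
    by (simp add: RJ_def)
  show "RJ x u v = (qX - 1) * RJ x u (s \<otimes> v) + qX * RJ x (s \<otimes> u) (s \<otimes> v)"
    if "len (s \<otimes> u) > len u \<and> s \<otimes> u \<in> MR"
    using coset_sum_left[OF u s _ less, of x] that u v svM by (simp add: RJ_def)
  show "RJ x u v = (qX - 1 - x) * RJ x u (s \<otimes> v)"
    if "len (s \<otimes> u) > len u \<and> s \<otimes> u \<notin> MR"
    using coset_sum_left_singular[OF x u s _ less] that u v svM by (simp add: RJ_def)
qed (auto simp: RJ_self RJ_zero)

lemma par_R_family_unique:
  assumes F: "is_par_R_family G S J x F" and H: "is_par_R_family G S J x H"
  shows "F = H"
proof (intro ext)
  fix u v
  have Fz: "F u v = 0" and Hz: "H u v = 0" if "u \<notin> MR \<or> v \<notin> MR" for u v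
    using F H that by (auto simp: is_par_R_family_def supported_on_def)
  have "F u v = H u v" if "u \<in> MR" "v \<in> MR" for u v
    using that
  proof (induction "len v" arbitrary: u v rule: less_induct)
    case less
    note u = less.prems(1) and v = less.prems(2)
    show ?case
    proof (cases "v = \<one>")
      case True
      have "u = v \<or> \<not> u \<preceq> v" using True ble_len by fastforce
      then show ?thesis using F H u v by (auto simp: is_par_R_family_def)
    next
      case False
      then obtain s where s: "s \<in> S" "len (s \<otimes> v) < len v"
        using left_descent_exists v by (metis MR_closed)
      have svM: "s \<otimes> v \<in> MR" using MR_simple_down v s by simp
      have IH: "F w (s \<otimes> v) = H w (s \<otimes> v)" for w
        using less.hyps[OF s(2) _ svM, of w] Fz Hz by (cases "w \<in> MR") auto
      have rec: "(len (s \<otimes> u) < len u \<longrightarrow> X u v = X (s \<otimes> u) (s \<otimes> v)) \<and>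
          (len (s \<otimes> u) > len u \<and> s \<otimes> u \<in> MR \<longrightarrow>
            X u v = (qX - 1) * X u (s \<otimes> v) + qX * X (s \<otimes> u) (s \<otimes> v)) \<and>
          (len (s \<otimes> u) > len u \<and> s \<otimes> u \<notin> MR \<longrightarrow> X u v = (qX - 1 - x) * X u (s \<otimes> v))"
        if "is_par_R_family G S J x X" for X
        using that u v s unfolding is_par_R_family_def by blast
      consider "len (s \<otimes> u) < len u" | "len (s \<otimes> u) > len u" "s \<otimes> u \<in> MR"
        | "len (s \<otimes> u) > len u" "s \<otimes> u \<notin> MR"
        using len_simple_mult[of s u] s u by fastforce
      then show ?thesis by cases (use rec[OF F] rec[OF H] IH in simp_all)
    qed
  qed
  then show "F u v = H u v" using Fz Hz by (cases "u \<in> MR \<and> v \<in> MR") auto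
qed

lemma par_R_eq:
  assumes "x * x = (qX - 1) * x + qX"
  shows "par_R G S J x = RJ x"
  unfolding par_R_def
proof (rule the_equality)
  show "is_par_R_family G S J x (RJ x)" using assms by (rule is_par_R_family_RJ)
  then show "F = RJ x" if "is_par_R_family G S J x F" for F using that by (intro par_R_family_unique)
qed

end

lemma x_relation: "x \<in> {-1, qX} \<Longrightarrow> x * x = (qX - 1) * x + qX"
  by (auto simp: algebra_simps)

context parabolic
begin

text \<open>Reversal replaces the root \<open>x\<close> by the other root \<open>q - 1 - x\<close>.\<close>

lemma RJ_flip:
  assumes x: "x \<in> {-1, qX}" and u: "u \<in> MR" and v: "v \<in> MR"
  shows "flip_len u v (RJ x u v) = to_fract (eps u * eps v * RJ (qX - 1 - x) u v)"
proof -
  have x1: "q_flip 1 (- x) = to_fract (qX - 1 - x)"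
  proof (cases "x = -1")
    case True
    then show ?thesis by (simp add: q_flip_inv_eval)
  next
    case False
    then have "x = qX" using x by simp
    then show ?thesis using q_flip_uminus[of 1 qX] by (simp add: q_flip_qX)
  qed
  have "flip_len u v ((- x) ^ (len y - len u) * Rpol y v)
     = to_fract (eps u * eps v * ((- (qX - 1 - x)) ^ (len y - len u) * Rpol y v))"
    if y: "y \<in> coset_below u v" for y
  proof -
    have l: "len u \<le> len y" using coset_below_len u y by simp
    have yc: "y \<in> W" "v \<in> W" using coset_below_closed u y v by auto
    have "len y = len u + (len y - len u)" using l by simp
    then have e: "eps y = eps u * (-1) ^ (len y - len u)"
      unfolding eps_def by (metis power_add)
    have "int (len v) - int (len u) = int (len y - len u) * 1 + (int (len v) - int (len y))"
      using l by simp
    then have "flip_len u v ((- x) ^ (len y - len u) * Rpol y v)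
       = q_flip (int (len y - len u) * 1) ((- x) ^ (len y - len u)) * flip_len y v (Rpol y v)"
      by (simp only: q_flip_mult)
    also have "\<dots> = to_fract (qX - 1 - x) ^ (len y - len u) * to_fract (eps y * eps v * Rpol y v)"
      by (simp only: q_flip_power x1 Rpol_flip[OF yc])
    also have "\<dots> = to_fract ((qX - 1 - x) ^ (len y - len u) * (eps y * eps v * Rpol y v))"
      by (simp only: to_fract_mult to_fract_power)
    also have "(qX - 1 - x) ^ (len y - len u) * (eps y * eps v * Rpol y v)
       = eps u * eps v * ((- (qX - 1 - x)) ^ (len y - len u) * Rpol y v)"
      unfolding e power_minus[of "qX - 1 - x"] by (simp only: mult_ac)
    finally show ?thesis .
  qed
  then show ?thesis using u v
    by (simp add: RJ_def coset_sum_def q_flip_sum sum_distrib_left to_fract_sum del: to_fract_mult)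
qed

lemma par_interval_iff:
  "v \<in> W \<Longrightarrow> y \<in> Jint u v \<longleftrightarrow> y \<in> MR \<and> u \<preceq> y \<and> y \<preceq> v"
  by (auto simp: par_interval_def bruhat_interval_def)

lemma finite_par_interval: "v \<in> W \<Longrightarrow> finite (Jint u v)"
  by (simp add: par_interval_def finite_interval)

text \<open>Projection to \<open>W\<^sup>J\<close> keeps an element of \<open>[u, v]\<close> above \<open>u\<close>, and lowers it, so it stays below \<open>v\<close>.\<close>

lemma interval_partition:
  assumes u: "u \<in> MR" and v: "v \<in> W"
  shows "Bint u v = (\<Union>w\<in>Jint u v. coset_below w v)"
proof (intro equalityI subsetI)
  fix y assume "y \<in> Bint u v"
  then have y: "y \<in> W" "u \<preceq> y" "y \<preceq> v" by (auto simp: bruhat_interval_def)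
  obtain w z where w: "w \<in> MR" "z \<in> WJ" "y = w \<otimes> z" using y(1) by (rule MR_decomposition)
  have "u \<preceq> w" using MR_ble_project[OF u w(1,2)] y w by simp
  moreover have "w \<preceq> v" using MR_ble_mult[OF w(1,2)] y w ble_trans by blast
  ultimately have "w \<in> Jint u v" using w v by (simp add: par_interval_iff)
  moreover have "y \<in> coset_below w v" using w y by (auto simp: coset_below_def)
  ultimately show "y \<in> (\<Union>w\<in>Jint u v. coset_below w v)" by blast
next
  fix y assume "y \<in> (\<Union>w\<in>Jint u v. coset_below w v)"
  then obtain w where w: "w \<in> MR" "u \<preceq> w" "y \<in> coset_below w v" using v by (auto simp: par_interval_iff)
  have "w \<preceq> y" "y \<preceq> v" using coset_below_ble[OF w(1,3)] w(3) by (simp_all add: coset_below_def)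
  then show "y \<in> Bint u v"
    using w ble_trans[OF w(2)] coset_below_closed[OF w(1,3)] by (simp add: bruhat_interval_def)
qed

lemma coset_below_disjoint:
  assumes "w \<in> MR" "w' \<in> MR" "w \<noteq> w'"
  shows "coset_below w v \<inter> coset_below w' v = {}"
  using assms MR_unique by (fastforce simp: coset_below_def)

text \<open>Transfers convolution identities from \<open>W\<close> to \<open>W\<^sup>J\<close>. By \<open>coset_sum_project\<close> the double sum on
  the left collapses to the sum of \<open>coset_sum x u y * h y\<close> over all \<open>y \<in> [u, v]\<close>; expanding \<open>coset_sum\<close> and
  exchanging the summations gives the right side. It is used for \<open>h y = \<plusminus> R\<^bsub>y,v\<^esub>\<close> and for
  \<open>h y = P\<^bsub>y,v\<^esub>\<close>.\<close>

lemma parabolic_sum_exchange: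
  assumes x: "x * x = (qX - 1) * x + qX" and u: "u \<in> MR" and v: "v \<in> MR"
  shows "(\<Sum>w\<in>Jint u v. RJ x u w *
       (\<Sum>y\<in>coset_below w v. (qX - 1 - x) ^ (len y - len w) * h y))
    = (\<Sum>w\<in>coset_below u v. (- x) ^ (len w - len u) * (\<Sum>y\<in>Bint w v. Rpol w y * h y))"
proof -
  have vc: "v \<in> W" using v by simp
  let ?I = "Jint u v"
  have "(\<Sum>w\<in>?I. RJ x u w * (\<Sum>y\<in>coset_below w v. (qX - 1 - x) ^ (len y - len w) * h y))
    = (\<Sum>w\<in>?I. \<Sum>y\<in>coset_below w v. coset_sum x u y * h y)"
  proof (rule sum.cong[OF HOL.refl])
    fix w assume "w \<in> ?I"
    then have w: "w \<in> MR" using vc by (simp add: par_interval_iff)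
    have "RJ x u w * ((qX - 1 - x) ^ (len y - len w) * h y) = coset_sum x u y * h y"
      if y: "y \<in> coset_below w v" for y
    proof -
      obtain z where z: "z \<in> WJ" "y = w \<otimes> z" using y by (auto simp: coset_below_def)
      then have "len y - len w = len z" using len_MR_mult w by simp
      then show ?thesis using coset_sum_project[OF x u w z(1)] z u w by (simp add: RJ_def mult_ac)
    qed
    then show "RJ x u w * (\<Sum>y\<in>coset_below w v. (qX - 1 - x) ^ (len y - len w) * h y)
      = (\<Sum>y\<in>coset_below w v. coset_sum x u y * h y)"
      unfolding sum_distrib_left by (rule sum.cong[OF HOL.refl])
  qed
  also have "\<dots> = (\<Sum>y\<in>Bint u v. coset_sum x u y * h y)"
    unfolding interval_partition[OF u vc]
    by (rule sum.UNION_disjoint[symmetric])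
      (use finite_par_interval finite_coset_below vc coset_below_disjoint in \<open>auto simp: par_interval_iff\<close>)
  also have "\<dots> = (\<Sum>y\<in>Bint u v. \<Sum>w\<in>coset_below u v.
      (- x) ^ (len w - len u) * (Rpol w y * h y))"
  proof (rule sum.cong[OF HOL.refl])
    fix y assume y: "y \<in> Bint u v"
    then have "coset_sum x u y = (\<Sum>w\<in>coset_below u v. (- x) ^ (len w - len u) * Rpol w y)"
      using u vc finite_coset_below[OF vc] coset_below_mono[of y v u]
      by (intro coset_sum_superset) (auto simp: bruhat_interval_def coset_below_def)
    then show "coset_sum x u y * h y = (\<Sum>w\<in>coset_below u v. (- x) ^ (len w - len u) * (Rpol w y * h y))"
      by (simp add: sum_distrib_right mult.assoc)
  qed
  also have "\<dots> = (\<Sum>w\<in>coset_below u v. \<Sum>y\<in>Bint u v.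
      (- x) ^ (len w - len u) * (Rpol w y * h y))"
    by (rule sum.swap)
  also have "\<dots> = (\<Sum>w\<in>coset_below u v. (- x) ^ (len w - len u) * (\<Sum>y\<in>Bint w v. Rpol w y * h y))"
  proof (rule sum.cong[OF HOL.refl])
    fix w assume w: "w \<in> coset_below u v"
    have uw: "u \<preceq> w" and wc: "w \<in> W"
      using coset_below_ble[OF u w] coset_below_closed[OF u w] by auto
    have "(\<Sum>y\<in>Bint u v. Rpol w y * h y) = (\<Sum>y\<in>Bint w v. Rpol w y * h y)"
    proof (rule sum.mono_neutral_right[OF finite_interval[OF vc]])
      show "Bint w v \<subseteq> Bint u v"
        using uw ble_trans by (auto simp: bruhat_interval_def)
      show "\<forall>y\<in>Bint u v - Bint w v. Rpol w y * h y = 0"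
        using Rpol_zero[OF wc] by (auto simp: bruhat_interval_def)
    qed
    then show "(\<Sum>y\<in>Bint u v. (- x) ^ (len w - len u) * (Rpol w y * h y))
      = (- x) ^ (len w - len u) * (\<Sum>y\<in>Bint w v. Rpol w y * h y)"
      by (simp flip: sum_distrib_left)
  qed
  finally show ?thesis .
qed

lemma RJ_kernel:
  assumes x: "x * x = (qX - 1) * x + qX" and u: "u \<in> MR" and v: "v \<in> MR"
  shows "(\<Sum>w\<in>Jint u v. eps w * RJ x u w * RJ (qX - 1 - x) w v) = (if u = v then eps v else 0)"
proof -
  have vc: "v \<in> W" using v by simp
  let ?I = "Jint u v" and ?x = "qX - 1 - x"
  have "(\<Sum>w\<in>?I. eps w * RJ x u w * RJ ?x w v)
    = (\<Sum>w\<in>?I. RJ x u w * (\<Sum>y\<in>coset_below w v. ?x ^ (len y - len w) * (eps y * Rpol y v)))"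
  proof (rule sum.cong[OF HOL.refl])
    fix w assume "w \<in> ?I"
    then have w: "w \<in> MR" using vc by (simp add: par_interval_iff)
    have "eps w * ((- ?x) ^ (len y - len w) * Rpol y v) = ?x ^ (len y - len w) * (eps y * Rpol y v)"
      if y: "y \<in> coset_below w v" for y
    proof -
      have "len y = len w + (len y - len w)" using coset_below_len[OF w y] by simp
      then have "eps y = eps w * (-1) ^ (len y - len w)" unfolding eps_def by (metis power_add)
      then show ?thesis unfolding power_minus[of ?x] by (simp only: mult_ac)
    qed
    from sum.cong[OF HOL.refl this] have "eps w * RJ ?x w v = (\<Sum>y\<in>coset_below w v. ?x ^ (len y - len w) * (eps y * Rpol y v))"
      using w v by (simp only: RJ_def coset_sum_def sum_distrib_left if_True simp_thms)
    moreover have "eps w * RJ x u w * RJ ?x w v = RJ x u w * (eps w * RJ ?x w v)"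
      by (simp only: mult_ac)
    ultimately show "eps w * RJ x u w * RJ ?x w v
      = RJ x u w * (\<Sum>y\<in>coset_below w v. ?x ^ (len y - len w) * (eps y * Rpol y v))"
      by simp
  qed
  also have "\<dots> = (\<Sum>w\<in>coset_below u v. (- x) ^ (len w - len u) *
      (\<Sum>y\<in>Bint w v. Rpol w y * (eps y * Rpol y v)))"
    by (rule parabolic_sum_exchange[OF x u v])
  also have "\<dots> = (\<Sum>w\<in>coset_below u v. (- x) ^ (len w - len u) * (if w = v then eps v else 0))"
  proof (rule sum.cong[OF HOL.refl])
    fix w assume w: "w \<in> coset_below u v"
    have wc: "w \<in> W" using coset_below_closed[OF u w] .
    have "(\<Sum>y\<in>Bint w v. Rpol w y * (eps y * Rpol y v))
       = (\<Sum>y\<in>{y. y \<preceq> v}. Rpol w y * (eps y * Rpol y v))"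
    proof (rule sum.mono_neutral_left[OF finite_below[OF vc]])
      show "\<forall>y\<in>{y. y \<preceq> v} - Bint w v. Rpol w y * (eps y * Rpol y v) = 0"
      proof
        fix y assume y: "y \<in> {y. y \<preceq> v} - Bint w v"
        then have "y \<in> W" using ble_carrier vc by blast
        then have "\<not> w \<preceq> y" using y by (auto simp: bruhat_interval_def)
        then show "Rpol w y * (eps y * Rpol y v) = 0" using Rpol_zero wc \<open>y \<in> W\<close> by simp
      qed
    qed (auto simp: bruhat_interval_def)
    also have "\<dots> = (if w = v then eps v else 0)"
      using Rpol_kernel[OF wc vc] by (simp only: mult_ac)
    finally show "(- x) ^ (len w - len u) * (\<Sum>y\<in>Bint w v. Rpol w y * (eps y * Rpol y v))
      = (- x) ^ (len w - len u) * (if w = v then eps v else 0)" by simp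
  qed
  also have "\<dots> = (if v \<in> coset_below u v then (- x) ^ (len v - len u) * eps v else 0)"
    using finite_coset_below[OF vc, of u] by (simp add: if_distrib[of "\<lambda>p. _ * p"] cong: if_cong)
  also have "v \<in> coset_below u v \<longleftrightarrow> u = v"
  proof
    assume "v \<in> coset_below u v"
    then obtain z where z: "z \<in> WJ" "v = u \<otimes> z" by (auto simp: coset_below_def)
    then show "u = v" using MR_unique[OF u v z(1) generate.one] vc by simp
  qed (use coset_below_self v in auto)
  finally show ?thesis by simp
qed

end

section \<open>Parabolic Kazhdan--Lusztig polynomials\<close>

context parabolic
begin

text \<open>The form of the inversion identity from which Kazhdan--Lusztig polynomials are constructed.\<close>

lemma flip_kernel:
  assumes x: "x \<in> {-1, qX}" and u: "u \<in> MR" and v: "v \<in> MR"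
  shows "(\<Sum>w\<in>Jint u v. flip_len u w (RJ x u w) * to_fract (RJ x w v))
    = (if u = v then 1 else 0)"
proof -
  let ?x = "qX - 1 - x"
  have x': "?x * ?x = (qX - 1) * ?x + qX" using x by (intro x_relation) auto
  have vc: "v \<in> W" using v by simp
  have "(\<Sum>w\<in>Jint u v. flip_len u w (RJ x u w) * to_fract (RJ x w v))
    = (\<Sum>w\<in>Jint u v. to_fract (eps u * (eps w * RJ ?x u w * RJ x w v)))"
    using vc by (intro sum.cong) (simp_all add: par_interval_iff RJ_flip[OF x u] mult.assoc)
  also have "\<dots> = to_fract (eps u * (\<Sum>w\<in>Jint u v. eps w * RJ ?x u w * RJ (qX - 1 - ?x) w v))"
    by (simp add: sum_distrib_left del: to_fract_mult)
  also have "\<dots> = to_fract (eps u * (if u = v then eps v else 0))"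
    by (simp only: RJ_kernel[OF x' u v])
  also have "\<dots> = (if u = v then 1 else 0)"
    by (cases "u = v") (simp_all del: to_fract_mult)
  finally show ?thesis .
qed

text \<open>The conditions on a single polynomial \<open>P\<^bsub>u,v\<^esub> = p u\<close> of the column \<open>v\<close>. They involve \<open>p w\<close> only
  for \<open>w \<succeq> u\<close>, so columns can be built downwards from \<open>v\<close>.\<close>

definition KL_at :: "int poly \<Rightarrow> 'a \<Rightarrow> ('a \<Rightarrow> int poly) \<Rightarrow> 'a \<Rightarrow> bool" where
  "KL_at x v p u \<longleftrightarrow> (u = v \<longrightarrow> p u = 1) \<and> (u \<noteq> v \<longrightarrow> 2 * degree (p u) < len v - len u) \<and>
     flip_len u v (p u) = to_fract (\<Sum>w\<in>Jint u v. RJ x u w * p w)"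

text \<open>Solvability of the defining identity at \<open>u\<close>. Reversing each summand of \<open>z\<close> and expanding the
  reversal of \<open>p w\<close> gives a double sum; the inner sum is the inversion identity without its term for
  \<open>u\<close>, so it equals \<open>\<delta>\<^bsub>u,t\<^esub> - R\<^bsub>u,t\<^esub>\<close>, which vanishes at \<open>t = u\<close>. In particular
  the unknown \<open>p u\<close> drops out.\<close>

lemma KL_rest_antisymmetric:
  assumes x: "x \<in> {-1, qX}" and u: "u \<in> MR" and v: "v \<in> MR" and uv: "u \<preceq> v"
    and p: "\<And>w. w \<in> Jint u v - {u} \<Longrightarrow> KL_at x v p w"
    and z: "z = (\<Sum>w\<in>Jint u v - {u}. RJ x u w * p w)"
  shows "flip_len u v z = - to_fract z"
proof -
  have vc: "v \<in> W" using v by simp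
  let ?I = "Jint u v"
  let ?A = "\<lambda>w. flip_len u w (RJ x u w)"
  have fin: "finite ?I" using finite_par_interval vc by blast
  have uI: "u \<in> ?I" using u uv vc by (simp add: par_interval_iff)
  have "flip_len u v z
    = (\<Sum>w\<in>?I - {u}. flip_len u v (RJ x u w * p w))"
    unfolding z by (rule q_flip_sum)
  also have "\<dots> = (\<Sum>w\<in>?I - {u}. \<Sum>t\<in>?I. ?A w * to_fract (RJ x w t) * to_fract (p t))"
  proof (rule sum.cong[OF HOL.refl])
    fix w assume w: "w \<in> ?I - {u}"
    have "flip_len u v (RJ x u w * p w)
      = q_flip ((int (len w) - int (len u)) + (int (len v) - int (len w))) (RJ x u w * p w)" by simp
    also have "\<dots> = ?A w * flip_len w v (p w)" by (rule q_flip_mult)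
    also have "flip_len w v (p w) = to_fract (\<Sum>t\<in>Jint w v. RJ x w t * p t)"
      using p[OF w] by (simp add: KL_at_def)
    also have "(\<Sum>t\<in>Jint w v. RJ x w t * p t) = (\<Sum>t\<in>?I. RJ x w t * p t)"
    proof (rule sum.mono_neutral_left[OF fin])
      show "Jint w v \<subseteq> ?I"
        using w vc ble_trans[of u w] by (auto simp: par_interval_iff)
      show "\<forall>t\<in>?I - Jint w v. RJ x w t * p t = 0"
        using vc RJ_zero by (auto simp: par_interval_iff)
    qed
    finally show "flip_len u v (RJ x u w * p w)
      = (\<Sum>t\<in>?I. ?A w * to_fract (RJ x w t) * to_fract (p t))"
      by (simp add: sum_distrib_left mult.assoc)
  qed
  also have "\<dots> = (\<Sum>t\<in>?I. \<Sum>w\<in>?I - {u}. ?A w * to_fract (RJ x w t) * to_fract (p t))"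
    by (rule sum.swap)
  also have "\<dots> = (\<Sum>t\<in>?I. ((if t = u then 1 else 0) - to_fract (RJ x u t)) * to_fract (p t))"
  proof (rule sum.cong[OF HOL.refl])
    fix t assume t: "t \<in> ?I"
    then have tM: "t \<in> MR" and tc: "t \<in> W" and ut: "u \<preceq> t" "t \<preceq> v"
      using vc by (auto simp: par_interval_iff)
    have "(\<Sum>w\<in>?I. ?A w * to_fract (RJ x w t)) = (\<Sum>w\<in>Jint u t. ?A w * to_fract (RJ x w t))"
    proof (rule sum.mono_neutral_right[OF fin])
      show "Jint u t \<subseteq> ?I"
        using vc tc ut ble_trans[of _ t v] by (auto simp: par_interval_iff)
      show "\<forall>w\<in>?I - Jint u t. ?A w * to_fract (RJ x w t) = 0"
        using vc tc RJ_zero by (auto simp: par_interval_iff)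
    qed
    also have "\<dots> = (if t = u then 1 else 0)" using flip_kernel[OF x u tM] by auto
    finally have "(\<Sum>w\<in>?I - {u}. ?A w * to_fract (RJ x w t)) = (if t = u then 1 else 0) - to_fract (RJ x u t)"
      using fin uI u by (simp add: sum_diff1 RJ_self)
    then show "(\<Sum>w\<in>?I - {u}. ?A w * to_fract (RJ x w t) * to_fract (p t))
      = ((if t = u then 1 else 0) - to_fract (RJ x u t)) * to_fract (p t)"
      by (simp flip: sum_distrib_right)
  qed
  also have "\<dots> = (\<Sum>t\<in>?I - {u}. ((if t = u then 1 else 0) - to_fract (RJ x u t)) * to_fract (p t))"
    by (rule sum.mono_neutral_right[OF fin]) (use u in \<open>auto simp: RJ_self\<close>)
  also have "\<dots> = (\<Sum>t\<in>?I - {u}. - to_fract (RJ x u t * p t))"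
    by (rule sum.cong) auto
  also have "\<dots> = - to_fract z" by (simp add: z sum_negf)
  finally show ?thesis .
qed

lemma KL_exists:
  assumes x: "x \<in> {-1, qX}" and v: "v \<in> MR"
  shows "\<exists>p. \<forall>u\<in>MR. u \<preceq> v \<longrightarrow> KL_at x v p u"
proof -
  have vc: "v \<in> W" using v by simp
  have "\<exists>p. \<forall>u\<in>MR. u \<preceq> v \<and> len v - len u \<le> n \<longrightarrow> KL_at x v p u" for n
  proof (induction n)
    case 0
    have "KL_at x v (\<lambda>_. 1) u" if "u \<preceq> v" "len v - len u \<le> 0" for u
    proof -
      have uv: "u = v" using ble_eq that by simp
      have "w = v" if "w \<in> Jint v v" for w
        using that vc ble_antisym by (auto simp: par_interval_iff)
      then have "Jint v v = {v}" using v vc by (auto simp: par_interval_iff)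
      then show ?thesis using uv v by (simp add: KL_at_def RJ_self)
    qed
    then show ?case by blast
  next
    case (Suc n)
    then obtain p where p: "\<And>u. u \<in> MR \<Longrightarrow> u \<preceq> v \<Longrightarrow> len v - len u \<le> n \<Longrightarrow> KL_at x v p u" by blast
    define z where "z u = (\<Sum>w\<in>Jint u v - {u}. RJ x u w * p w)" for u
    \<comment> \<open>keep the values found so far and choose a solution at the next length difference\<close>
    define p' where "p' u = (if len v - len u \<le> n then p u else
      SOME r. 2 * degree r < len v - len u \<and> q_flip (int (len v - len u)) r = to_fract (r + z u))" for u
    have old: "p' w = p w" if "w \<in> Jint u v - {u}" "u \<preceq> v" "len v - len u \<le> Suc n" for u w
    proof -
      have "u \<preceq> w" "w \<noteq> u" "w \<preceq> v" using that vc by (auto simp: par_interval_iff)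
      then have "len u < len w" "len w \<le> len v" using ble_len ble_len_le by auto
      then have "len v - len w \<le> n" using that by linarith
      then show ?thesis by (simp add: p'_def)
    qed
    have "KL_at x v p' u" if u: "u \<in> MR" and uv: "u \<preceq> v" and l: "len v - len u \<le> Suc n" for u
    proof -
      have uI: "u \<in> Jint u v" using u uv vc by (simp add: par_interval_iff)
      have fin: "finite (Jint u v)" using finite_par_interval vc by blast
      have "(\<Sum>w\<in>Jint u v - {u}. RJ x u w * p' w) = z u"
        unfolding z_def by (rule sum.cong[OF HOL.refl]) (simp add: old[OF _ uv l])
      then have split: "(\<Sum>w\<in>Jint u v. RJ x u w * p' w) = p' u + z u"
        using sum.remove[OF fin uI, of "\<lambda>w. RJ x u w * p' w"] u by (simp add: RJ_self)
      show ?thesis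
      proof (cases "len v - len u \<le> n")
        case True
        have "(\<Sum>w\<in>Jint u v. RJ x u w * p w) = p u + z u"
          using sum.remove[OF fin uI, of "\<lambda>w. RJ x u w * p w"] u by (simp add: RJ_self z_def)
        then show ?thesis using p[OF u uv True] True split by (simp add: KL_at_def p'_def)
      next
        case False
        then have lu: "len u < len v" by linarith
        have "flip_len u v (z u) = - to_fract (z u)"
        proof (rule KL_rest_antisymmetric[OF x u v uv _ z_def])
          fix w assume w: "w \<in> Jint u v - {u}"
          then have "u \<preceq> w" "w \<noteq> u" "w \<preceq> v" "w \<in> MR" using vc by (auto simp: par_interval_iff)
          moreover from this have "len u < len w" using ble_len by auto
          ultimately show "KL_at x v p w" using l by (intro p) auto
        qed
        then have "q_flip (int (len v - len u)) (z u) = - to_fract (z u)" using lu by (simp add: of_nat_diff)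
        from q_flip_solution[OF this]
        have "\<exists>r. 2 * degree r < len v - len u \<and> q_flip (int (len v - len u)) r = to_fract (r + z u)"
          using lu by simp
        from someI_ex[OF this]
        have "2 * degree (p' u) < len v - len u" "q_flip (int (len v - len u)) (p' u) = to_fract (p' u + z u)"
          using False by (simp_all add: p'_def)
        then show ?thesis using lu split by (auto simp: KL_at_def of_nat_diff)
      qed
    qed
    then show ?case by blast
  qed
  from this[of "len v"] show ?thesis by auto
qed

text \<open>For \<open>u \<preceq> v\<close>, \<open>u \<noteq> v\<close>, the integer inequality of the definition is a strict inequality of
  natural numbers; for \<open>u\<close> not below \<open>v\<close>, the identity is \<open>0 = 0\<close>.\<close>

lemma is_par_P_family_alt:
  assumes x: "x \<in> {-1, qX}"
  shows "is_par_P_family G S J x P \<longleftrightarrow> supported_on MR P \<and>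
    (\<forall>u\<in>MR. \<forall>v\<in>MR. if u \<preceq> v then KL_at x v (\<lambda>w. P w v) u else P u v = 0)"
proof -
  have "((\<not> u \<preceq> v \<longrightarrow> P u v = 0) \<and> P u u = 1 \<and>
      (bruhat_less G S u v \<longrightarrow> 2 * int (degree (P u v)) \<le> int (len v) - int (len u) - 1) \<and>
      flip_len u v (P u v) =
        to_fract (\<Sum>w\<in>Jint u v. par_R G S J x u w * P w v)) \<longleftrightarrow>
      (if u \<preceq> v then KL_at x v (\<lambda>w. P w v) u else P u v = 0) \<and> P u u = 1"
    if "u \<in> MR" "v \<in> MR" for u v
  proof (cases "u \<preceq> v")
    case True
    have "2 * int (degree (P u v)) \<le> int (len v) - int (len u) - 1 \<longleftrightarrow> 2 * degree (P u v) < len v - len u"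
      using ble_len_le[OF True] by linarith
    then show ?thesis using True by (auto simp: KL_at_def bruhat_less_def par_R_eq[OF x_relation[OF x]])
  next
    case False
    have "w \<notin> Jint u v" for w
      using False that ble_trans[of u w v] by (auto simp: par_interval_iff)
    then have "Jint u v = {}" by blast
    then show ?thesis using False by (auto simp: bruhat_less_def)
  qed
  then have "is_par_P_family G S J x P \<longleftrightarrow> supported_on MR P \<and>
    (\<forall>u\<in>MR. \<forall>v\<in>MR. (if u \<preceq> v then KL_at x v (\<lambda>w. P w v) u else P u v = 0) \<and> P u u = 1)"
    unfolding is_par_P_family_def by (simp cong: ball_cong)
  moreover have "P u u = 1"
    if "\<forall>u\<in>MR. \<forall>v\<in>MR. if u \<preceq> v then KL_at x v (\<lambda>w. P w v) u else P u v = 0" "u \<in> MR" for u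
    using that by (force simp: KL_at_def)
  ultimately show ?thesis by blast
qed

lemma par_P_family_exists:
  assumes x: "x \<in> {-1, qX}"
  shows "\<exists>P. is_par_P_family G S J x P"
proof -
  obtain p where p: "\<And>v u. v \<in> MR \<Longrightarrow> u \<in> MR \<Longrightarrow> u \<preceq> v \<Longrightarrow> KL_at x v (p v) u"
    using KL_exists[OF x] by metis
  define P where "P u v = (if u \<in> MR \<and> v \<in> MR \<and> u \<preceq> v then p v u else 0)" for u v
  have "KL_at x v (\<lambda>w. P w v) u" if u: "u \<in> MR" and v: "v \<in> MR" and uv: "u \<preceq> v" for u v
  proof -
    have "(\<Sum>w\<in>Jint u v. RJ x u w * P w v) = (\<Sum>w\<in>Jint u v. RJ x u w * p v w)"
      using v by (intro sum.cong) (auto simp: P_def par_interval_iff)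
    then show ?thesis using p[OF v u uv] that by (auto simp: KL_at_def P_def)
  qed
  then have "is_par_P_family G S J x P"
    unfolding is_par_P_family_alt[OF x] by (auto simp: P_def supported_on_def)
  then show ?thesis by blast
qed

text \<open>The defining identity with the unknown polynomial split off from the sum.\<close>

lemma KL_at_split:
  assumes u: "u \<in> MR" and v: "v \<in> MR" and uv: "u \<preceq> v" and p: "KL_at x v p u"
  shows "q_flip (int (len v - len u)) (p u)
    = to_fract (p u + (\<Sum>w\<in>Jint u v - {u}. RJ x u w * p w))"
proof -
  have vc: "v \<in> W" using v by simp
  have uI: "u \<in> Jint u v" using u uv vc by (simp add: par_interval_iff)
  have fin: "finite (Jint u v)" using finite_par_interval vc by blast
  have "int (len v - len u) = int (len v) - int (len u)" using ble_len_le[OF uv] by simp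
  then show ?thesis
    using p sum.remove[OF fin uI, of "\<lambda>w. RJ x u w * p w"] u by (simp add: KL_at_def RJ_self)
qed

lemma par_P_family_unique:
  assumes x: "x \<in> {-1, qX}" and F: "is_par_P_family G S J x F" and H: "is_par_P_family G S J x H"
  shows "F = H"
proof (intro ext)
  fix u v
  note F' = F[unfolded is_par_P_family_alt[OF x]] and H' = H[unfolded is_par_P_family_alt[OF x]]
  have "F u v = H u v" if "u \<in> MR" "v \<in> MR" for u
    using that
  proof (induction "len v - len u" arbitrary: u rule: less_induct)
    case less
    note u = less.prems(1) and v = less.prems(2)
    show ?case
    proof (cases "u \<preceq> v \<and> u \<noteq> v")
      case True
      then have uv: "u \<preceq> v" and K: "KL_at x v (\<lambda>w. F w v) u" "KL_at x v (\<lambda>w. H w v) u"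
        using F' H' u v by (meson+)
      have "F w v = H w v" if w: "w \<in> Jint u v - {u}" for w
      proof -
        have ww: "w \<in> MR" "u \<preceq> w" "w \<noteq> u" "w \<preceq> v" using w v by (auto simp: par_interval_iff)
        then have "len u < len w" "len w \<le> len v" using ble_len[of u w] ble_len_le[of w v] by auto
        then show ?thesis using less.hyps[of w] ww v by simp
      qed
      then have e: "(\<Sum>w\<in>Jint u v - {u}. RJ x u w * F w v)
        = (\<Sum>w\<in>Jint u v - {u}. RJ x u w * H w v)" by (intro sum.cong) auto
      have "2 * degree (F u v) < len v - len u" "2 * degree (H u v) < len v - len u"
        using K True by (simp_all add: KL_at_def)
      then show ?thesis
        using KL_at_split[OF u v uv K(1), unfolded e] KL_at_split[OF u v uv K(2)] by (rule q_flip_unique)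
    next
      case False
      then consider "u = v" | "\<not> u \<preceq> v" by blast
      then show ?thesis
      proof cases
        case 1
        have "KL_at x v (\<lambda>w. F w v) v" "KL_at x v (\<lambda>w. H w v) v" using F' H' v ble_refl by (meson+)
        then show ?thesis using 1 by (simp add: KL_at_def)
      qed (use F' H' u v in auto)
    qed
  qed
  then show "F u v = H u v" using F' H' by (cases "u \<in> MR \<and> v \<in> MR") (auto simp: supported_on_def)
qed

lemma is_par_P_family_par_P:
  assumes x: "x \<in> {-1, qX}"
  shows "is_par_P_family G S J x (par_P G S J x)"
proof -
  have "\<exists>!P. is_par_P_family G S J x P"
    using par_P_family_exists[OF x] par_P_family_unique[OF x] by blast
  then show ?thesis unfolding par_P_def by (rule theI')
qed

lemma par_P_KL_at:
  "x \<in> {-1, qX} \<Longrightarrow> u \<in> MR \<Longrightarrow> v \<in> MR \<Longrightarrow> u \<preceq> v \<Longrightarrow> KL_at x v (\<lambda>w. par_P G S J x w v) u"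
  using is_par_P_family_par_P is_par_P_family_alt by metis

lemma par_P_zero: "x \<in> {-1, qX} \<Longrightarrow> \<not> u \<preceq> v \<Longrightarrow> par_P G S J x u v = 0"
  using is_par_P_family_par_P[of x] is_par_P_family_alt[of x "par_P G S J x"]
  by (cases "u \<in> MR \<and> v \<in> MR") (auto simp: supported_on_def)

end

section \<open>The ordinary polynomials\<close>

context coxeter_system
begin

lemma parabolic_empty: "parabolic G S {}"
  by unfold_locales simp

lemma RJ_empty:
  assumes "u \<in> W" "v \<in> W"
  shows "parabolic.RJ G S {} x u v = Rpol u v"
proof -
  interpret E: parabolic G S "{}" by (rule parabolic_empty)
  have "E.coset_below u v = (if u \<preceq> v then {u} else {})"
    using assms by (auto simp: E.coset_below_def generate_empty)
  then show ?thesis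
    using assms Rpol_zero by (auto simp: E.RJ_def E.coset_sum_def min_reps_empty)
qed

lemma par_interval_empty: "par_interval G S {} u v = Bint u v"
  by (auto simp: par_interval_def min_reps_empty bruhat_interval_def)

lemma ord_R_eq: "u \<in> W \<Longrightarrow> v \<in> W \<Longrightarrow> ord_R G S u v = Rpol u v"
proof -
  interpret E: parabolic G S "{}" by (rule parabolic_empty)
  show "u \<in> W \<Longrightarrow> v \<in> W \<Longrightarrow> ord_R G S u v = Rpol u v"
    by (simp add: ord_R_def E.par_R_eq RJ_empty)
qed

lemma ord_P_self: "v \<in> W \<Longrightarrow> ord_P G S v v = 1"
  and ord_P_degree: "u \<preceq> v \<Longrightarrow> u \<noteq> v \<Longrightarrow> v \<in> W \<Longrightarrow> 2 * degree (ord_P G S u v) < len v - len u"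
  and ord_P_flip: "u \<preceq> v \<Longrightarrow> v \<in> W \<Longrightarrow> flip_len u v (ord_P G S u v)
    = to_fract (\<Sum>w\<in>Bint u v. Rpol u w * ord_P G S w v)"
proof -
  interpret E: parabolic G S "{}" by (rule parabolic_empty)
  have K: "E.KL_at (-1) v (\<lambda>w. ord_P G S w v) u" if "u \<preceq> v" "v \<in> W" for u v
    using E.par_P_KL_at[of "-1" u v] that ble_carrier by (simp add: ord_P_def min_reps_empty)
  show "v \<in> W \<Longrightarrow> ord_P G S v v = 1" using K[of v v] by (simp add: E.KL_at_def)
  show "u \<preceq> v \<Longrightarrow> u \<noteq> v \<Longrightarrow> v \<in> W \<Longrightarrow> 2 * degree (ord_P G S u v) < len v - len u"
    using K[of u v] by (simp add: E.KL_at_def)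
  assume uv: "u \<preceq> v" "v \<in> W"
  then have u: "u \<in> W" using ble_carrier by blast
  have "(\<Sum>w\<in>Bint u v. E.RJ (-1) u w * ord_P G S w v)
    = (\<Sum>w\<in>Bint u v. Rpol u w * ord_P G S w v)"
    using u by (intro sum.cong) (auto simp: bruhat_interval_def RJ_empty)
  then show "flip_len u v (ord_P G S u v)
    = to_fract (\<Sum>w\<in>Bint u v. Rpol u w * ord_P G S w v)"
    using K[OF uv] by (simp only: E.KL_at_def par_interval_empty)
qed

end

context parabolic
begin

text \<open>For \<open>x = q\<close> the other root is \<open>-1\<close>, so the alternating coset sums \<open>Q\<close> of ordinary
  polynomials satisfy the defining identity by \<open>parabolic_sum_exchange\<close>, and they keep the degree
  bound. For \<open>x = -1\<close> the same computation would require weights \<open>q\<^bsup>\<ell>(w) - \<ell>(u)\<^esup>\<close>, which can violate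
  the bound.\<close>

lemma par_P_q_eq:
  assumes u: "u \<in> MR" and v: "v \<in> MR"
  shows "par_P G S J qX u v = (\<Sum>w\<in>coset_below u v. (-1) ^ (len w - len u) * ord_P G S w v)"
proof -
  define Q where "Q u v = (if u \<in> MR \<and> v \<in> MR
    then \<Sum>w\<in>coset_below u v. (-1) ^ (len w - len u) * ord_P G S w v else 0)" for u v
  have KL: "KL_at qX v (\<lambda>w. Q w v) u" if u: "u \<in> MR" and v: "v \<in> MR" and uv: "u \<preceq> v" for u v
    unfolding KL_at_def
  proof (intro conjI impI)
    have vc: "v \<in> W" using v by simp
    show "Q u v = 1" if "u = v"
      using that v by (simp add: Q_def coset_below_self ord_P_self)
    show "2 * degree (Q u v) < len v - len u" if "u \<noteq> v"
    proof -
      have "degree ((-1) ^ (len w - len u) * ord_P G S w v) \<le> (len v - len u - 1) div 2"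
        if w: "w \<in> coset_below u v" for w
      proof -
        have wv: "w \<preceq> v" using w by (simp add: coset_below_def)
        have "w \<noteq> v"
        proof
          assume "w = v"
          then obtain z where z: "z \<in> WJ" "u \<otimes> z = v \<otimes> \<one>" using w vc by (auto simp: coset_below_def)
          then show False using MR_unique[OF u v z(1) generate.one z(2)] \<open>u \<noteq> v\<close> by simp
        qed
        then have "2 * degree (ord_P G S w v) < len v - len w" using ord_P_degree wv vc by simp
        then have d: "2 * degree (ord_P G S w v) < len v - len u" using coset_below_len[OF u w] by linarith
        have "degree ((-1) ^ (len w - len u) * ord_P G S w v) = degree (ord_P G S w v)"
          by (cases "even (len w - len u)") simp_all
        then show ?thesis using d by linarith
      qed
      then have "degree (Q u v) \<le> (len v - len u - 1) div 2"
        using u v finite_coset_below[OF vc, of u] by (auto simp: Q_def intro!: degree_sum_le)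
      moreover have "len u < len v" using ble_len[OF uv] that by simp
      ultimately show ?thesis by linarith
    qed
    have "(\<Sum>w\<in>Jint u v. RJ qX u w * Q w v)
      = (\<Sum>w\<in>Jint u v. RJ qX u w *
          (\<Sum>y\<in>coset_below w v. (qX - 1 - qX) ^ (len y - len w) * ord_P G S y v))"
      using v vc by (intro sum.cong) (auto simp: Q_def par_interval_iff)
    also have "\<dots> = (\<Sum>w\<in>coset_below u v. (- qX) ^ (len w - len u) *
        (\<Sum>y\<in>Bint w v. Rpol w y * ord_P G S y v))"
      by (rule parabolic_sum_exchange[OF _ u v]) (rule x_relation, simp)
    finally have "to_fract (\<Sum>w\<in>Jint u v. RJ qX u w * Q w v)
      = (\<Sum>w\<in>coset_below u v. to_fract ((- qX) ^ (len w - len u)) *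
        to_fract (\<Sum>y\<in>Bint w v. Rpol w y * ord_P G S y v))"
      by (simp only: to_fract_sum to_fract_mult)
    also have "\<dots> = (\<Sum>w\<in>coset_below u v. flip_len u v
        ((-1) ^ (len w - len u) * ord_P G S w v))"
    proof (rule sum.cong[OF HOL.refl])
      fix w assume w: "w \<in> coset_below u v"
      then have wv: "w \<preceq> v" by (simp add: coset_below_def)
      let ?k = "len w - len u"
      have "int (len v) - int (len u) = int ?k * 1 + (int (len v) - int (len w))"
        using coset_below_len[OF u w] by simp
      then have "flip_len u v ((-1) ^ ?k * ord_P G S w v)
        = q_flip (int ?k * 1) ((-1) ^ ?k) * flip_len w v (ord_P G S w v)"
        by (simp only: q_flip_mult)
      also have "q_flip (int ?k * 1) ((-1) ^ ?k) = to_fract (- qX) ^ ?k"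
      proof -
        have "q_flip 1 (-1) = to_fract (- qX)"
        proof -
          have "q_flip 1 1 = to_fract qX" by (simp add: q_flip_inv_eval)
          then show ?thesis by (simp only: q_flip_uminus to_fract_uminus)
        qed
        then show ?thesis by (simp only: q_flip_power)
      qed
      finally show "to_fract ((- qX) ^ ?k) * to_fract (\<Sum>y\<in>Bint w v. Rpol w y * ord_P G S y v)
        = flip_len u v ((-1) ^ ?k * ord_P G S w v)"
        by (simp only: ord_P_flip[OF wv vc] to_fract_power)
    qed
    also have "\<dots> = flip_len u v (Q u v)"
      using u v by (simp add: Q_def q_flip_sum)
    finally show "flip_len u v (Q u v)
      = to_fract (\<Sum>w\<in>Jint u v. RJ qX u w * Q w v)" by simp
  qed
  have "Q u v = 0" if "\<not> u \<preceq> v" for u v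
  proof -
    have "w \<notin> coset_below u v" if "u \<in> MR" for w
      using \<open>\<not> u \<preceq> v\<close> coset_below_ble[OF that, of w v] ble_trans[of u w v] by (auto simp: coset_below_def)
    then have "coset_below u v = {}" if "u \<in> MR" using that by blast
    then show ?thesis by (simp add: Q_def)
  qed
  moreover have "supported_on MR Q" by (auto simp: supported_on_def Q_def)
  ultimately have "is_par_P_family G S J qX Q"
    using KL unfolding is_par_P_family_alt[of qX, simplified] by auto
  moreover have "is_par_P_family G S J qX (par_P G S J qX)"
    by (rule is_par_P_family_par_P) simp
  ultimately have "Q = par_P G S J qX"
    by (intro par_P_family_unique[of qX]) auto
  then have "Q u v = par_P G S J qX u v" by simp
  then show ?thesis using u v by (simp add: Q_def)
qed

end

section \<open>Combinatorial description of the cosets in an interval\<close>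

context parabolic
begin

lemma covers_ble: "bruhat_covers G S u a \<Longrightarrow> u \<preceq> a \<and> u \<noteq> a"
  by (simp add: bruhat_covers_def bruhat_less_def)

lemma covers_of_len:
  assumes "u \<preceq> a" "len a = Suc (len u)"
  shows "bruhat_covers G S u a"
proof -
  have "\<not> (bruhat_less G S u z \<and> bruhat_less G S z a)" for z
    using ble_len[of u z] ble_len[of z a] assms(2) by (auto simp: bruhat_less_def)
  moreover have "u \<noteq> a" using assms(2) by auto
  ultimately show ?thesis using assms(1) by (simp add: bruhat_covers_def bruhat_less_def)
qed

text \<open>If \<open>y\<close> has representative \<open>w \<noteq> u\<close> in \<open>W\<^sup>J\<close>, then some atom of \<open>[u, w]\<close> lies in \<open>W\<^sup>J\<close>. If \<open>y \<in> u W\<^sub>J\<close>,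
  then an element of \<open>W\<^sup>J\<close> below \<open>y\<close> is below \<open>u\<close> by projection.\<close>

lemma coset_below_atoms:
  assumes u: "u \<in> MR" and v: "v \<in> MR"
  shows "coset_below u v
    = {y \<in> Bint u v. \<not> (\<exists>a\<in>Jatoms u v. a \<preceq> y)}"
proof (intro equalityI subsetI)
  fix y assume y: "y \<in> coset_below u v"
  then obtain z where z: "z \<in> WJ" "y = u \<otimes> z" "y \<preceq> v" by (auto simp: coset_below_def)
  have "\<not> a \<preceq> y" if "a \<in> Jatoms u v" for a
  proof
    assume "a \<preceq> y"
    moreover have a: "a \<in> MR" "u \<preceq> a" "u \<noteq> a" using that covers_ble by (auto simp: par_atoms_def)
    ultimately have "a \<preceq> u" using MR_ble_project[OF _ u z(1)] z by simp
    then show False using ble_antisym a by blast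
  qed
  then show "y \<in> {y \<in> Bint u v. \<not> (\<exists>a\<in>Jatoms u v. a \<preceq> y)}"
    using y z coset_below_ble[OF u y] coset_below_closed[OF u y] by (auto simp: bruhat_interval_def)
next
  fix y assume "y \<in> {y \<in> Bint u v. \<not> (\<exists>a\<in>Jatoms u v. a \<preceq> y)}"
  then have y: "y \<in> W" "u \<preceq> y" "y \<preceq> v" and no: "\<And>a. a \<in> Jatoms u v \<Longrightarrow> \<not> a \<preceq> y"
    by (auto simp: bruhat_interval_def)
  obtain w z where w: "w \<in> MR" "z \<in> WJ" "y = w \<otimes> z" using y(1) by (rule MR_decomposition)
  have uw: "u \<preceq> w" using MR_ble_project[OF u w(1,2)] y w by simp
  have wy: "w \<preceq> y" using MR_ble_mult[OF w(1,2)] w by simp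
  have "w = u"
  proof (rule ccontr)
    assume "w \<noteq> u"
    then obtain a where a: "a \<in> MR" "u \<preceq> a" "a \<preceq> w" "len a = Suc (len u)"
      using MR_atom_exists[OF u w(1) uw] by blast
    have "a \<preceq> y" using a wy ble_trans by blast
    moreover from this have "a \<preceq> v" using y ble_trans by blast
    then have "a \<in> Jatoms u v" using a covers_of_len by (simp add: par_atoms_def)
    ultimately show False using no by blast
  qed
  then show "y \<in> coset_below u v" using w y by (auto simp: coset_below_def)
qed

text \<open>Covering in \<open>W\<close> is visible inside \<open>[u, v]\<close>, so an isomorphism that respects \<open>W\<^sup>J\<close> respects the
  atoms.\<close>

lemma par_atoms_iff:
  assumes v: "v \<in> W"
  shows "a \<in> Jatoms u v \<longleftrightarrow> a \<in> Jint u v \<and> a \<noteq> u \<and>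
    (\<forall>y\<in>Bint u v. y \<preceq> a \<longrightarrow> y = u \<or> y = a)"
proof
  assume a: "a \<in> Jatoms u v"
  then have "a \<in> MR" "u \<preceq> a" "u \<noteq> a" "a \<preceq> v" using covers_ble by (auto simp: par_atoms_def)
  moreover have "\<forall>y\<in>Bint u v. y \<preceq> a \<longrightarrow> y = u \<or> y = a"
    using a by (auto simp: par_atoms_def bruhat_covers_def bruhat_less_def bruhat_interval_def)
  ultimately show "a \<in> Jint u v \<and> a \<noteq> u \<and>
    (\<forall>y\<in>Bint u v. y \<preceq> a \<longrightarrow> y = u \<or> y = a)"
    using v by (auto simp: par_interval_iff)
next
  assume a: "a \<in> Jint u v \<and> a \<noteq> u \<and>
    (\<forall>y\<in>Bint u v. y \<preceq> a \<longrightarrow> y = u \<or> y = a)"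
  then have "a \<in> MR" "u \<preceq> a" "a \<preceq> v" using v by (auto simp: par_interval_iff)
  then show "a \<in> Jatoms u v"
    using a ble_trans[of _ a v]
    by (auto simp: par_atoms_def bruhat_covers_def bruhat_less_def bruhat_interval_def)
qed

lemma par_atoms_interval: "v \<in> W \<Longrightarrow> Jatoms u v \<subseteq> Bint u v"
  by (auto simp: par_atoms_iff par_interval_def)

end

section \<open>Transport along isomorphisms of intervals\<close>

locale interval_iso = W1: parabolic W1 S1 J1 + W2: parabolic W2 S2 J2
  for W1 :: "'a monoid" and S1 J1 and W2 :: "'b monoid" and S2 J2 +
  fixes u1 v1 :: 'a and u2 v2 :: 'b and \<phi> :: "'a \<Rightarrow> 'b"
  assumes u1: "u1 \<in> min_reps W1 S1 J1" and v1: "v1 \<in> min_reps W1 S1 J1"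
    and u2: "u2 \<in> min_reps W2 S2 J2" and v2: "v2 \<in> min_reps W2 S2 J2"
    and le1: "bruhat_le W1 S1 u1 v1"
    and iso: "poset_iso \<phi> (bruhat_interval W1 S1 u1 v1) (bruhat_le W1 S1)
                           (bruhat_interval W2 S2 u2 v2) (bruhat_le W2 S2)"
begin

abbreviation "I1 \<equiv> W1.Bint u1 v1"
abbreviation "I2 \<equiv> W2.Bint u2 v2"

lemma bij: "bij_betw \<phi> I1 I2"
  using iso by (simp add: poset_iso_def)

lemma le_iff: "x \<in> I1 \<Longrightarrow> y \<in> I1 \<Longrightarrow> W1.ble x y \<longleftrightarrow> W2.ble (\<phi> x) (\<phi> y)"
  using iso by (simp add: poset_iso_def)

lemma image_in: "x \<in> I1 \<Longrightarrow> \<phi> x \<in> I2"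
  using bij by (auto simp: bij_betw_def)

lemma preimage:
  assumes "y \<in> I2"
  obtains x where "x \<in> I1" "\<phi> x = y"
proof -
  have "y \<in> \<phi> ` I1" using assms by (simp only: bij_betw_imp_surj_on[OF bij])
  then show ?thesis using that by (elim imageE) simp
qed

lemma ends_in: "u1 \<in> I1" "v1 \<in> I1"
  using le1 u1 v1 by (auto simp: bruhat_interval_def)

lemma bottom: "\<phi> u1 = u2" and top: "\<phi> v1 = v2"
proof -
  have "W2.ble u2 v2"
    using image_in[OF ends_in(1)] W2.ble_trans by (auto simp: bruhat_interval_def)
  then have I: "u2 \<in> I2" "v2 \<in> I2" using W2.ble_refl W2.MR_closed[OF u2] W2.MR_closed[OF v2]
    by (simp_all add: bruhat_interval_def)
  obtain y where y: "y \<in> I1" "\<phi> y = u2" using I(1) by (rule preimage)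
  then have "W2.ble (\<phi> u1) u2"
    using le_iff[of u1 y] ends_in by (auto simp: bruhat_interval_def)
  then show "\<phi> u1 = u2" using W2.ble_antisym image_in[OF ends_in(1)] by (auto simp: bruhat_interval_def)
  obtain z where z: "z \<in> I1" "\<phi> z = v2" using I(2) by (rule preimage)
  then have "W2.ble v2 (\<phi> v1)"
    using le_iff[of z v1] ends_in by (auto simp: bruhat_interval_def)
  then show "\<phi> v1 = v2" using W2.ble_antisym image_in[OF ends_in(2)] by (auto simp: bruhat_interval_def)
qed

lemma sub_iso:
  assumes a: "a \<in> I1" and b: "b \<in> I1"
  shows "poset_iso \<phi> (W1.Bint a b) (W1.ble)
                       (W2.Bint (\<phi> a) (\<phi> b)) (W2.ble)"
proof -
  have 1: "y \<in> W1.Bint a b \<longleftrightarrow> y \<in> I1 \<and> W1.ble a y \<and> W1.ble y b" for y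
    using a b W1.ble_trans[of u1 a y] W1.ble_trans[of y b v1] by (auto simp: bruhat_interval_def)
  have 2: "y \<in> W2.Bint (\<phi> a) (\<phi> b) \<longleftrightarrow>
      y \<in> I2 \<and> W2.ble (\<phi> a) y \<and> W2.ble y (\<phi> b)" for y
    using image_in[OF a] image_in[OF b] W2.ble_trans[of u2 "\<phi> a" y] W2.ble_trans[of y "\<phi> b" v2]
    by (auto simp: bruhat_interval_def)
  have "\<phi> ` W1.Bint a b = W2.Bint (\<phi> a) (\<phi> b)"
  proof (intro equalityI subsetI)
    fix y assume "y \<in> \<phi> ` W1.Bint a b"
    then obtain x where x: "x \<in> W1.Bint a b" "y = \<phi> x" by blast
    then have "x \<in> I1" by (simp only: 1)
    then show "y \<in> W2.Bint (\<phi> a) (\<phi> b)"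
      using x le_iff[OF a] le_iff[OF _ b] image_in by (simp add: 1 2)
  next
    fix y assume y: "y \<in> W2.Bint (\<phi> a) (\<phi> b)"
    then have "y \<in> I2" by (simp only: 2)
    then obtain x where x: "x \<in> I1" "\<phi> x = y" by (rule preimage)
    then have "x \<in> W1.Bint a b" using y le_iff[OF a x(1)] le_iff[OF x(1) b] by (simp add: 1 2)
    then show "y \<in> \<phi> ` W1.Bint a b" using x by blast
  qed
  moreover have "W1.Bint a b \<subseteq> I1" using 1 by blast
  moreover have "inj_on \<phi> I1" using bij by (rule bij_betw_imp_inj_on)
  ultimately have "bij_betw \<phi> (W1.Bint a b) (W2.Bint (\<phi> a) (\<phi> b))"
    by (simp only: bij_betw_def inj_on_subset)
  then show ?thesis using le_iff by (simp add: poset_iso_def 1)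
qed

lemma sub_interval_iso:
  assumes "a \<in> W1.Jint u1 v1" "b \<in> W1.Jint u1 v1" "W1.ble a b"
    and "\<phi> a \<in> W2.MR" "\<phi> b \<in> W2.MR"
  shows "interval_iso W1 S1 J1 W2 S2 J2 a b (\<phi> a) (\<phi> b) \<phi>"
  using assms sub_iso[of a b] by unfold_locales (auto simp: par_interval_def)

end

locale CIC_interval_iso = interval_iso W1 S1 J1 W2 S2 J2 u1 v1 u2 v2 \<phi>
  for W1 :: "'a monoid" and S1 J1 and W2 :: "'b monoid" and S2 J2 and u1 v1 u2 v2 \<phi> +
  assumes CIC: "CIC TYPE('a) TYPE('b)"
begin

lemma ord_eq:
  assumes a: "a \<in> I1" and b: "b \<in> I1"
  shows "ord_R W1 S1 a b = ord_R W2 S2 (\<phi> a) (\<phi> b)" "ord_P W1 S1 a b = ord_P W2 S2 (\<phi> a) (\<phi> b)"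
proof -
  have c: "a \<in> W1.W" "b \<in> W1.W" "\<phi> a \<in> W2.W" "\<phi> b \<in> W2.W"
    using a b image_in[OF a] image_in[OF b] by (auto simp: bruhat_interval_def)
  have "coxeter_system W1 S1" "coxeter_system W2 S2" by unfold_locales
  then have "ord_R W1 S1 a b = ord_R W2 S2 (\<phi> a) (\<phi> b) \<and> ord_P W1 S1 a b = ord_P W2 S2 (\<phi> a) (\<phi> b)"
    using CIC c sub_iso[OF a b] unfolding CIC_def by blast
  then show "ord_R W1 S1 a b = ord_R W2 S2 (\<phi> a) (\<phi> b)" "ord_P W1 S1 a b = ord_P W2 S2 (\<phi> a) (\<phi> b)"
    by auto
qed

lemma Rpol_eq:
  assumes a: "a \<in> I1" and b: "b \<in> I1"
  shows "W1.Rpol a b = W2.Rpol (\<phi> a) (\<phi> b)"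
proof -
  have c: "a \<in> W1.W" "b \<in> W1.W" "\<phi> a \<in> W2.W" "\<phi> b \<in> W2.W"
    using a b image_in[OF a] image_in[OF b] by (auto simp: bruhat_interval_def)
  then show ?thesis using ord_eq(1)[OF a b] by (simp add: W1.ord_R_eq W2.ord_R_eq)
qed

text \<open>Both sides are degrees of ordinary R-polynomials, which the conjecture transports.\<close>

lemma len_diff_eq:
  assumes a: "a \<in> I1" and b: "b \<in> I1" and ab: "W1.ble a b"
  shows "W1.len b - W1.len a = W2.len (\<phi> b) - W2.len (\<phi> a)"
proof -
  have c: "b \<in> W1.W" "\<phi> b \<in> W2.W"
    using b image_in[OF b] by (auto simp: bruhat_interval_def)
  have "W2.ble (\<phi> a) (\<phi> b)" using ab le_iff a b by simp
  then show ?thesis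
    using W1.Rpol_degree[OF c(1) ab] W2.Rpol_degree[OF c(2), of "\<phi> a"] Rpol_eq[OF a b] by simp
qed

text \<open>The index sets of both coset formulas correspond under \<open>\<phi>\<close> by \<open>coset_below_atoms\<close>, and the summands
  agree by the conjecture.\<close>

lemma refined:
  assumes atoms: "bij_betw \<phi> (W1.Jatoms u1 v1) (W2.Jatoms u2 v2)"
  shows "W1.RJ x u1 v1 = W2.RJ x u2 v2"
    and "par_P W1 S1 J1 qX u1 v1 = par_P W2 S2 J2 qX u2 v2"
proof -
  have vc: "v1 \<in> W1.W" "v2 \<in> W2.W" using v1 v2 by auto
  \<comment> \<open>\<open>\<phi>\<close> preserves and reflects the property of lying above an atom\<close>
  have above: "(\<exists>a\<in>W1.Jatoms u1 v1. W1.ble a y) \<longleftrightarrow>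
      (\<exists>a\<in>W2.Jatoms u2 v2. W2.ble a (\<phi> y))" if y: "y \<in> I1" for y
  proof -
    have "W2.Jatoms u2 v2 = \<phi> ` W1.Jatoms u1 v1"
      using atoms by (simp add: bij_betw_def)
    moreover have "W1.ble a y \<longleftrightarrow> W2.ble (\<phi> a) (\<phi> y)"
      if "a \<in> W1.Jatoms u1 v1" for a
      using le_iff[of a y] y that W1.par_atoms_interval[OF vc(1)] by blast
    ultimately show ?thesis by auto
  qed
  have img: "\<phi> ` W1.coset_below u1 v1 = W2.coset_below u2 v2"
    unfolding W1.coset_below_atoms[OF u1 v1] W2.coset_below_atoms[OF u2 v2]
  proof (intro equalityI subsetI)
    fix y assume "y \<in> {y \<in> I2. \<not> (\<exists>a\<in>W2.Jatoms u2 v2. W2.ble a y)}"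
    moreover from this have "y \<in> I2" by blast
    then obtain x where "x \<in> I1" "\<phi> x = y" by (rule preimage)
    ultimately show "y \<in> \<phi> ` {y \<in> I1. \<not> (\<exists>a\<in>W1.Jatoms u1 v1. W1.ble a y)}"
      using above by auto
  qed (use above image_in in auto)
  have sub: "W1.coset_below u1 v1 \<subseteq> I1" using W1.coset_below_atoms[OF u1 v1] by blast
  have bc: "bij_betw \<phi> (W1.coset_below u1 v1) (W2.coset_below u2 v2)"
    using bij_betw_subset[OF bij sub img] .
  have len: "W2.len (\<phi> y) - W2.len u2 = W1.len y - W1.len u1" if "y \<in> W1.coset_below u1 v1" for y
    using len_diff_eq[of u1 y] ends_in that sub bottom by (auto simp: bruhat_interval_def)
  have "W2.coset_sum x u2 v2 = (\<Sum>y\<in>W1.coset_below u1 v1.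
      (- x) ^ (W2.len (\<phi> y) - W2.len u2) * W2.Rpol (\<phi> y) v2)"
    unfolding W2.coset_sum_def by (rule sum.reindex_bij_betw[OF bc, symmetric])
  also have "\<dots> = W1.coset_sum x u1 v1"
    unfolding W1.coset_sum_def
    using sub ends_in Rpol_eq[of _ v1] by (intro sum.cong) (auto simp: len top)
  finally show "W1.RJ x u1 v1 = W2.RJ x u2 v2"
    using u1 v1 u2 v2 by (simp add: W1.RJ_def W2.RJ_def)
  have "par_P W2 S2 J2 qX u2 v2 = (\<Sum>y\<in>W1.coset_below u1 v1.
      (-1) ^ (W2.len (\<phi> y) - W2.len u2) * ord_P W2 S2 (\<phi> y) v2)"
    unfolding W2.par_P_q_eq[OF u2 v2] by (rule sum.reindex_bij_betw[OF bc, symmetric])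
  also have "\<dots> = par_P W1 S1 J1 qX u1 v1"
    unfolding W1.par_P_q_eq[OF u1 v1]
    using sub ends_in ord_eq(2)[of _ v1] by (intro sum.cong) (auto simp: len top)
  finally show "par_P W1 S1 J1 qX u1 v1 = par_P W2 S2 J2 qX u2 v2" by simp
qed

end

locale par_interval_iso = interval_iso W1 S1 J1 W2 S2 J2 u1 v1 u2 v2 \<phi>
  for W1 :: "'a monoid" and S1 J1 and W2 :: "'b monoid" and S2 J2 and u1 v1 u2 v2 \<phi> +
  assumes par_image: "\<phi> ` W1.Jint u1 v1 = W2.Jint u2 v2"
begin

lemma MR_iff: "y \<in> I1 \<Longrightarrow> y \<in> W1.MR \<longleftrightarrow> \<phi> y \<in> W2.MR"
proof
  assume "y \<in> I1" "y \<in> W1.MR"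
  then show "\<phi> y \<in> W2.MR" using par_image by (auto simp: par_interval_def)
next
  assume y: "y \<in> I1" "\<phi> y \<in> W2.MR"
  then have "\<phi> y \<in> \<phi> ` W1.Jint u1 v1"
    unfolding par_image using image_in by (simp add: par_interval_def)
  then obtain x where "x \<in> I1" "x \<in> W1.MR" "\<phi> y = \<phi> x" by (auto simp: par_interval_def)
  then show "y \<in> W1.MR" using bij y by (metis bij_betw_def inj_onD)
qed

lemma par_bij: "bij_betw \<phi> (W1.Jint u1 v1) (W2.Jint u2 v2)"
  using bij_betw_subset[OF bij _ par_image] by (simp add: par_interval_def)

lemma atoms_bij: "bij_betw \<phi> (W1.Jatoms u1 v1) (W2.Jatoms u2 v2)"
proof -
  have vc: "v1 \<in> W1.W" "v2 \<in> W2.W" using v1 v2 by auto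
  have inj: "\<phi> x = \<phi> y \<longleftrightarrow> x = y" if "x \<in> I1" "y \<in> I1" for x y
    using bij that by (metis bij_betw_def inj_onD)
  have img2: "I2 = \<phi> ` I1" using bij by (simp add: bij_betw_def)
  have iff: "a \<in> W1.Jatoms u1 v1 \<longleftrightarrow> \<phi> a \<in> W2.Jatoms u2 v2" if a: "a \<in> I1" for a
  proof -
    have "a \<in> W1.Jint u1 v1 \<longleftrightarrow> \<phi> a \<in> W2.Jint u2 v2"
      using MR_iff[OF a] a image_in[OF a] by (auto simp: par_interval_def)
    moreover have "a \<noteq> u1 \<longleftrightarrow> \<phi> a \<noteq> u2" using inj[OF a ends_in(1)] bottom by simp
    moreover have "(\<forall>y\<in>I1. W1.ble y a \<longrightarrow> y = u1 \<or> y = a) \<longleftrightarrow>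
        (\<forall>y\<in>I2. W2.ble y (\<phi> a) \<longrightarrow> y = u2 \<or> y = \<phi> a)"
      unfolding img2 using inj ends_in a le_iff bottom by auto
    ultimately show ?thesis by (simp only: W1.par_atoms_iff[OF vc(1)] W2.par_atoms_iff[OF vc(2)])
  qed
  have "\<phi> ` W1.Jatoms u1 v1 = W2.Jatoms u2 v2"
  proof (intro equalityI subsetI)
    fix y assume y: "y \<in> W2.Jatoms u2 v2"
    then have "y \<in> I2" using W2.par_atoms_interval[OF vc(2)] by blast
    then obtain x where "x \<in> I1" "y = \<phi> x" unfolding img2 by blast
    then show "y \<in> \<phi> ` W1.Jatoms u1 v1" using iff y by blast
  qed (use iff W1.par_atoms_interval[OF vc(1)] in blast)
  then show ?thesis using bij_betw_subset[OF bij W1.par_atoms_interval[OF vc(1)]] by simp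
qed

lemma sub_par_interval_iso:
  assumes a: "a \<in> W1.Jint u1 v1" and b: "b \<in> W1.Jint u1 v1"
    and ab: "W1.ble a b"
  shows "par_interval_iso W1 S1 J1 W2 S2 J2 a b (\<phi> a) (\<phi> b) \<phi>"
proof -
  have I: "a \<in> I1" "b \<in> I1" "a \<in> W1.MR" "b \<in> W1.MR" using a b by (auto simp: par_interval_def)
  interpret sub: interval_iso W1 S1 J1 W2 S2 J2 a b "\<phi> a" "\<phi> b" \<phi>
    using sub_interval_iso[OF a b ab] MR_iff I by simp
  have sub: "sub.I1 \<subseteq> I1" using I W1.ble_trans[of u1 a] W1.ble_trans[of _ b v1] by (auto simp: bruhat_interval_def)
  have "\<phi> ` W1.Jint a b = W2.Jint (\<phi> a) (\<phi> b)"
  proof (intro equalityI subsetI)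
    fix y assume y: "y \<in> W2.Jint (\<phi> a) (\<phi> b)"
    then have "y \<in> sub.I2" by (simp add: par_interval_def)
    then obtain x where x: "x \<in> sub.I1" "\<phi> x = y" by (rule sub.preimage)
    then have "x \<in> W1.Jint a b" using y MR_iff[of x] sub by (auto simp: par_interval_def)
    then show "y \<in> \<phi> ` W1.Jint a b" using x by blast
  next
    fix y assume "y \<in> \<phi> ` W1.Jint a b"
    then obtain x where x: "x \<in> sub.I1" "x \<in> W1.MR" "y = \<phi> x" by (auto simp: par_interval_def)
    then show "y \<in> W2.Jint (\<phi> a) (\<phi> b)"
      using MR_iff[of x] sub sub.image_in[OF x(1)] by (auto simp: par_interval_def)
  qed
  then show ?thesis by unfold_locales
qed

end

text \<open>All R-polynomials with indices in \<open>[u, v]\<^sup>J\<close> agree by \<open>refined\<close>. The defining identity then determines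
  the Kazhdan--Lusztig polynomials by induction from \<open>v\<close> downwards, for either \<open>x\<close>.\<close>

lemma CIC_imp_parabolic_polynomials:
  assumes CIC: "CIC TYPE('a) TYPE('b)" and iso: "par_interval_iso (W1 :: 'a monoid) S1 J1 (W2 :: 'b monoid) S2 J2 u1 v1 u2 v2 \<phi>"
    and x: "x \<in> {-1, qX}"
  shows "par_R W1 S1 J1 x u1 v1 = par_R W2 S2 J2 x u2 v2 \<and> par_P W1 S1 J1 x u1 v1 = par_P W2 S2 J2 x u2 v2"
proof -
  interpret par_interval_iso W1 S1 J1 W2 S2 J2 u1 v1 u2 v2 \<phi> by (rule iso)
  interpret CIC_interval_iso W1 S1 J1 W2 S2 J2 u1 v1 u2 v2 \<phi> by unfold_locales (rule CIC)
  let ?P1 = "W1.Jint u1 v1"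
  have ends: "u1 \<in> ?P1" "v1 \<in> ?P1" using ends_in u1 v1 by (auto simp: par_interval_def)
  have sub: "?P1 \<subseteq> I1" by (auto simp: par_interval_def)
  have R: "W1.RJ x a b = W2.RJ x (\<phi> a) (\<phi> b)" if a: "a \<in> ?P1" and b: "b \<in> ?P1" and ab: "W1.ble a b" for a b
  proof -
    interpret sub: par_interval_iso W1 S1 J1 W2 S2 J2 a b "\<phi> a" "\<phi> b" \<phi>
      using sub_par_interval_iso[OF a b ab] .
    interpret sub: CIC_interval_iso W1 S1 J1 W2 S2 J2 a b "\<phi> a" "\<phi> b" \<phi> by unfold_locales (rule CIC)
    show ?thesis using sub.refined(1) sub.atoms_bij by blast
  qed
  have P: "par_P W1 S1 J1 x a v1 = par_P W2 S2 J2 x (\<phi> a) v2" if "a \<in> ?P1" for a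
    using that
  proof (induction "W1.len v1 - W1.len a" arbitrary: a rule: less_induct)
    case less
    note a = less.prems
    have aM: "a \<in> W1.MR" "\<phi> a \<in> W2.MR" and aI: "a \<in> I1" and av: "W1.ble a v1"
      using a MR_iff[of a] by (auto simp: par_interval_def bruhat_interval_def)
    have av2: "W2.ble (\<phi> a) v2" using av le_iff[OF aI ends_in(2)] top by simp
    have K: "W1.KL_at x v1 (\<lambda>w. par_P W1 S1 J1 x w v1) a" "W2.KL_at x v2 (\<lambda>w. par_P W2 S2 J2 x w v2) (\<phi> a)"
      using W1.par_P_KL_at[OF x aM(1) v1 av] W2.par_P_KL_at[OF x aM(2) v2 av2] by auto
    show ?case
    proof (cases "a = v1")
      case True
      then show ?thesis using K top by (simp add: W1.KL_at_def W2.KL_at_def)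
    next
      case False
      then have "\<phi> a \<noteq> v2" using bij aI ends_in top by (metis bij_betw_def inj_onD)
      have len: "W2.len v2 - W2.len (\<phi> a) = W1.len v1 - W1.len a"
        using len_diff_eq[OF aI ends_in(2) av] top by simp
      interpret sub: par_interval_iso W1 S1 J1 W2 S2 J2 a v1 "\<phi> a" v2 \<phi>
        using sub_par_interval_iso[OF a ends(2) av] top by simp
      let ?A1 = "W1.Jint a v1 - {a}" and ?A2 = "W2.Jint (\<phi> a) v2 - {\<phi> a}"
      have aa: "a \<in> W1.Jint a v1" using sub.ends_in aM by (simp add: par_interval_def)
      have bA: "bij_betw \<phi> ?A1 ?A2"
        using aa sub.par_image by (intro bij_betw_DiffI[OF sub.par_bij] bij_betw_singletonI) auto
      have "(\<Sum>w\<in>?A2. W2.RJ x (\<phi> a) w * par_P W2 S2 J2 x w v2)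
        = (\<Sum>w\<in>?A1. W2.RJ x (\<phi> a) (\<phi> w) * par_P W2 S2 J2 x (\<phi> w) v2)"
        by (rule sum.reindex_bij_betw[OF bA, symmetric])
      also have "\<dots> = (\<Sum>w\<in>?A1. W1.RJ x a w * par_P W1 S1 J1 x w v1)"
      proof (rule sum.cong[OF HOL.refl])
        fix w assume w: "w \<in> ?A1"
        then have aw: "W1.ble a w" "W1.ble w v1" "w \<noteq> a" "w \<in> W1.MR" "w \<in> W1.W"
          by (auto simp: par_interval_def bruhat_interval_def)
        then have wP: "w \<in> ?P1" using aI W1.ble_trans[of u1 a w] by (auto simp: par_interval_def bruhat_interval_def)
        have "W1.len a < W1.len w" "W1.len w \<le> W1.len v1"
          using W1.ble_len[of a w] W1.ble_len_le[of w v1] aw by auto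
        then have "par_P W1 S1 J1 x w v1 = par_P W2 S2 J2 x (\<phi> w) v2" using less.hyps[of w] wP by simp
        moreover have "W1.RJ x a w = W2.RJ x (\<phi> a) (\<phi> w)" using R a wP aw by blast
        ultimately show "W2.RJ x (\<phi> a) (\<phi> w) * par_P W2 S2 J2 x (\<phi> w) v2 = W1.RJ x a w * par_P W1 S1 J1 x w v1"
          by simp
      qed
      finally have e: "(\<Sum>w\<in>?A2. W2.RJ x (\<phi> a) w * par_P W2 S2 J2 x w v2)
        = (\<Sum>w\<in>?A1. W1.RJ x a w * par_P W1 S1 J1 x w v1)" .
      have "2 * degree (par_P W1 S1 J1 x a v1) < W1.len v1 - W1.len a"
        "2 * degree (par_P W2 S2 J2 x (\<phi> a) v2) < W1.len v1 - W1.len a"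
        using K False \<open>\<phi> a \<noteq> v2\<close> len by (simp_all add: W1.KL_at_def W2.KL_at_def)
      then show ?thesis
        using W1.KL_at_split[OF aM(1) v1 av K(1)] W2.KL_at_split[OF aM(2) v2 av2 K(2), unfolded e len]
        by (rule q_flip_unique)
    qed
  qed
  have rel: "x * x = (qX - 1) * x + qX" by (rule x_relation[OF x])
  show ?thesis
    using R[OF ends le1] P[OF ends(1)] bottom top W1.par_R_eq[OF rel] W2.par_R_eq[OF rel] by simp
qed

lemma CIC_imp_refined_polynomials:
  assumes CIC: "CIC TYPE('a) TYPE('b)"
    and iso: "interval_iso (W1 :: 'a monoid) S1 J1 (W2 :: 'b monoid) S2 J2 u1 v1 u2 v2 \<phi>"
    and atoms: "bij_betw \<phi> (par_atoms W1 S1 J1 u1 v1) (par_atoms W2 S2 J2 u2 v2)"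
  shows "(\<forall>x\<in>{-1, qX}. par_R W1 S1 J1 x u1 v1 = par_R W2 S2 J2 x u2 v2) \<and>
    par_P W1 S1 J1 qX u1 v1 = par_P W2 S2 J2 qX u2 v2"
proof -
  interpret interval_iso W1 S1 J1 W2 S2 J2 u1 v1 u2 v2 \<phi> by (rule iso)
  interpret CIC_interval_iso W1 S1 J1 W2 S2 J2 u1 v1 u2 v2 \<phi> by unfold_locales (rule CIC)
  have "par_R W1 S1 J1 x u1 v1 = par_R W2 S2 J2 x u2 v2" if "x \<in> {-1, qX}" for x
    using refined(1)[OF atoms] W1.par_R_eq[OF x_relation[OF that]] W2.par_R_eq[OF x_relation[OF that]] by simp
  then show ?thesis using refined(2)[OF atoms] by blast
qed

lemma poset_iso_empty_iff: "poset_iso \<phi> A leA B leB \<Longrightarrow> A = {} \<longleftrightarrow> B = {}"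
  by (auto simp: poset_iso_def bij_betw_def)

lemma interval_iso_cases:
  fixes W1 :: "'a monoid" and W2 :: "'b monoid"
  assumes W: "coxeter_system W1 S1" "coxeter_system W2 S2" "J1 \<subseteq> S1" "J2 \<subseteq> S2"
    and m: "u1 \<in> min_reps W1 S1 J1" "v1 \<in> min_reps W1 S1 J1" "u2 \<in> min_reps W2 S2 J2" "v2 \<in> min_reps W2 S2 J2"
    and iso: "poset_iso \<phi> (bruhat_interval W1 S1 u1 v1) (bruhat_le W1 S1)
                           (bruhat_interval W2 S2 u2 v2) (bruhat_le W2 S2)"
  obtains (nonempty) "interval_iso W1 S1 J1 W2 S2 J2 u1 v1 u2 v2 \<phi>"
  | (empty) "bruhat_interval W1 S1 u1 v1 = {}" "bruhat_interval W2 S2 u2 v2 = {}"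
    "\<And>x. x \<in> {-1, qX} \<Longrightarrow> par_R W1 S1 J1 x u1 v1 = par_R W2 S2 J2 x u2 v2"
    "\<And>x. x \<in> {-1, qX} \<Longrightarrow> par_P W1 S1 J1 x u1 v1 = par_P W2 S2 J2 x u2 v2"
proof (cases "bruhat_le W1 S1 u1 v1")
  case True
  then have "interval_iso W1 S1 J1 W2 S2 J2 u1 v1 u2 v2 \<phi>"
    using W m iso
    by (intro interval_iso.intro interval_iso_axioms.intro parabolic.intro parabolic_axioms.intro)
  then show ?thesis by (rule nonempty)
next
  case False
  interpret W1: parabolic W1 S1 J1 using W by (intro parabolic.intro parabolic_axioms.intro)
  interpret W2: parabolic W2 S2 J2 using W by (intro parabolic.intro parabolic_axioms.intro)
  have e1: "W1.Bint u1 v1 = {}" using False W1.ble_trans by (auto simp: bruhat_interval_def)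
  then have e2: "W2.Bint u2 v2 = {}" using poset_iso_empty_iff[OF iso] by simp
  then have "\<not> W2.ble u2 v2" using W2.MR_closed[OF m(3)] by (auto simp: bruhat_interval_def)
  then show ?thesis
    using False W1.par_R_eq[OF x_relation] W2.par_R_eq[OF x_relation]
    by (intro empty[OF e1 e2]) (simp_all only: W1.RJ_zero W2.RJ_zero W1.par_P_zero W2.par_P_zero not_False_eq_True)
qed

lemma CIC_imp_parabolic_CIC:
  assumes CIC: "CIC TYPE('a) TYPE('b)"
  shows "parabolic_CIC TYPE('a) TYPE('b)"
  unfolding parabolic_CIC_def
proof (intro allI impI ballI, elim conjE exE)
  fix W1 :: "'a monoid" and S1 J1 and W2 :: "'b monoid" and S2 J2 u1 v1 u2 v2 \<phi>
  assume W: "coxeter_system W1 S1" "coxeter_system W2 S2" "J1 \<subseteq> S1" "J2 \<subseteq> S2"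
    and m: "u1 \<in> min_reps W1 S1 J1" "v1 \<in> min_reps W1 S1 J1" "u2 \<in> min_reps W2 S2 J2" "v2 \<in> min_reps W2 S2 J2"
    and iso: "poset_iso \<phi> (bruhat_interval W1 S1 u1 v1) (bruhat_le W1 S1)
                           (bruhat_interval W2 S2 u2 v2) (bruhat_le W2 S2)"
    and par: "poset_iso \<phi> (par_interval W1 S1 J1 u1 v1) (bruhat_le W1 S1)
                           (par_interval W2 S2 J2 u2 v2) (bruhat_le W2 S2)"
  show "(\<forall>x\<in>{-1, qX}. par_R W1 S1 J1 x u1 v1 = par_R W2 S2 J2 x u2 v2) \<and>
        (\<forall>x\<in>{-1, qX}. par_P W1 S1 J1 x u1 v1 = par_P W2 S2 J2 x u2 v2)"
    using W m iso
  proof (cases rule: interval_iso_cases)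
    case nonempty
    then have "par_interval_iso W1 S1 J1 W2 S2 J2 u1 v1 u2 v2 \<phi>"
      using par by (intro par_interval_iso.intro par_interval_iso_axioms.intro)
        (auto simp: poset_iso_def bij_betw_def)
    then show ?thesis using CIC_imp_parabolic_polynomials[OF CIC] by blast
  qed blast
qed

lemma CIC_imp_refined_parabolic_CIC:
  assumes CIC: "CIC TYPE('a) TYPE('b)"
  shows "refined_parabolic_CIC TYPE('a) TYPE('b)"
  unfolding refined_parabolic_CIC_def
proof (intro allI impI ballI, elim conjE exE)
  fix W1 :: "'a monoid" and S1 J1 and W2 :: "'b monoid" and S2 J2 u1 v1 u2 v2 \<phi>
  assume W: "coxeter_system W1 S1" "coxeter_system W2 S2" "J1 \<subseteq> S1" "J2 \<subseteq> S2"
    and m: "u1 \<in> min_reps W1 S1 J1" "v1 \<in> min_reps W1 S1 J1" "u2 \<in> min_reps W2 S2 J2" "v2 \<in> min_reps W2 S2 J2"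
    and iso: "poset_iso \<phi> (bruhat_interval W1 S1 u1 v1) (bruhat_le W1 S1)
                           (bruhat_interval W2 S2 u2 v2) (bruhat_le W2 S2)"
    and atoms: "bij_betw \<phi> (par_atoms W1 S1 J1 u1 v1) (par_atoms W2 S2 J2 u2 v2)"
  show "(\<forall>x\<in>{-1, qX}. par_R W1 S1 J1 x u1 v1 = par_R W2 S2 J2 x u2 v2) \<and>
        par_P W1 S1 J1 qX u1 v1 = par_P W2 S2 J2 qX u2 v2"
    using W m iso
  proof (cases rule: interval_iso_cases)
    case nonempty
    then show ?thesis using CIC_imp_refined_polynomials[OF CIC _ atoms] by blast
  qed blast
qed

lemma parabolic_CIC_imp_CIC:
  assumes pCIC: "parabolic_CIC TYPE('a) TYPE('b)"
  shows "CIC TYPE('a) TYPE('b)"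
  unfolding CIC_def
proof (intro allI impI ballI, elim conjE exE)
  fix W1 :: "'a monoid" and S1 and W2 :: "'b monoid" and S2 u1 v1 u2 v2 \<phi>
  assume W: "coxeter_system W1 S1" "coxeter_system W2 S2"
    and c: "u1 \<in> carrier W1" "v1 \<in> carrier W1" "u2 \<in> carrier W2" "v2 \<in> carrier W2"
    and iso: "poset_iso \<phi> (bruhat_interval W1 S1 u1 v1) (bruhat_le W1 S1)
                           (bruhat_interval W2 S2 u2 v2) (bruhat_le W2 S2)"
  have "(\<forall>x\<in>{-1, qX}. par_R W1 S1 {} x u1 v1 = par_R W2 S2 {} x u2 v2) \<and>
        (\<forall>x\<in>{-1, qX}. par_P W1 S1 {} x u1 v1 = par_P W2 S2 {} x u2 v2)"
    using pCIC[unfolded parabolic_CIC_def, rule_format, of W1 S1 W2 S2 "{}" "{}" u1 v1 u2 v2] W c iso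
    by (auto simp: coxeter_system.min_reps_empty coxeter_system.par_interval_empty)
  then show "ord_R W1 S1 u1 v1 = ord_R W2 S2 u2 v2 \<and> ord_P W1 S1 u1 v1 = ord_P W2 S2 u2 v2"
    by (simp add: ord_R_def ord_P_def)
qed

lemma refined_parabolic_CIC_imp_CIC:
  assumes rCIC: "refined_parabolic_CIC TYPE('a) TYPE('b)"
  shows "CIC TYPE('a) TYPE('b)"
  unfolding CIC_def
proof (intro allI impI ballI, elim conjE exE)
  fix W1 :: "'a monoid" and S1 and W2 :: "'b monoid" and S2 u1 v1 u2 v2 \<phi>
  assume W: "coxeter_system W1 S1" "coxeter_system W2 S2"
    and c: "u1 \<in> carrier W1" "v1 \<in> carrier W1" "u2 \<in> carrier W2" "v2 \<in> carrier W2"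
    and iso: "poset_iso \<phi> (bruhat_interval W1 S1 u1 v1) (bruhat_le W1 S1)
                           (bruhat_interval W2 S2 u2 v2) (bruhat_le W2 S2)"
  interpret W1: parabolic W1 S1 "{}" using W(1) by (rule coxeter_system.parabolic_empty)
  interpret W2: parabolic W2 S2 "{}" using W(2) by (rule coxeter_system.parabolic_empty)
  have m: "u1 \<in> W1.MR" "v1 \<in> W1.MR" "u2 \<in> W2.MR" "v2 \<in> W2.MR"
    using c by (simp_all add: W1.min_reps_empty W2.min_reps_empty)
  have "bij_betw \<phi> (par_atoms W1 S1 {} u1 v1) (par_atoms W2 S2 {} u2 v2)"
    using W empty_subsetI empty_subsetI m iso
  proof (cases rule: interval_iso_cases)
    case nonempty
    then interpret interval_iso W1 S1 "{}" W2 S2 "{}" u1 v1 u2 v2 \<phi> .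
    interpret par_interval_iso W1 S1 "{}" W2 S2 "{}" u1 v1 u2 v2 \<phi>
      using bij by unfold_locales (simp add: W1.par_interval_empty W2.par_interval_empty bij_betw_def)
    show ?thesis by (rule atoms_bij)
  next
    case empty
    then have "par_atoms W1 S1 {} u1 v1 = {}" "par_atoms W2 S2 {} u2 v2 = {}"
      using W1.par_atoms_interval[OF c(2)] W2.par_atoms_interval[OF c(4)] by blast+
    then show ?thesis by (simp add: bij_betw_def)
  qed
  then have "(\<forall>x\<in>{-1, qX}. par_R W1 S1 {} x u1 v1 = par_R W2 S2 {} x u2 v2) \<and>
        par_P W1 S1 {} qX u1 v1 = par_P W2 S2 {} qX u2 v2"
    using rCIC[unfolded refined_parabolic_CIC_def, rule_format, of W1 S1 W2 S2 "{}" "{}" u1 v1 u2 v2] W m iso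
    by blast
  then show "ord_R W1 S1 u1 v1 = ord_R W2 S2 u2 v2 \<and> ord_P W1 S1 u1 v1 = ord_P W2 S2 u2 v2"
    using W1.par_P_empty_indep[of "-1" qX] W2.par_P_empty_indep[of "-1" qX] by (simp add: ord_R_def ord_P_def)
qed

theorem theorem1p6:
  shows "(CIC TYPE('a) TYPE('b) \<longleftrightarrow> parabolic_CIC TYPE('a) TYPE('b)) \<and>
         (parabolic_CIC TYPE('a) TYPE('b) \<longleftrightarrow> refined_parabolic_CIC TYPE('a) TYPE('b))"
  using CIC_imp_parabolic_CIC CIC_imp_refined_parabolic_CIC
    parabolic_CIC_imp_CIC refined_parabolic_CIC_imp_CIC by blast

end
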